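(* Let $g$ and $m$ be positive integers. Assume that in the semi-free group $\Gamma_{\mathrm{KG}(m,2)}$, with identity element $\varepsilon$, the equality $z_1^2z_2^2\cdots z_g^2=\varepsilon$ implies $z_1z_2\cdots z_g=\varepsilon$ (for all elements $z_1,\ldots,z_g$ of the group). Then no odd quadrangulation of a non-orientable surface of genus $g$ has a local $3$-coloring using at most $m$ colors.
   Context: For a graph $H$, the semi-free group $\Gamma_H$ is the group given by generators and relations as follows: the generators are the vertices of $H$ and the relations are $xy=yx$ for the edges $xy$ of $H$. The Kneser graph $\mathrm{KG}(m,2)$ has as vertices the $2$-element subsets of $[m]=\{1,\ldots,m\}$, two of them being adjacent if and only if they are disjoint. A surface is a compact connected 2-manifold without boundary. The genus of a non-orientable surface is its non-orientable genus $g\ge 1$ (number of crosscaps; the Euler characteristic is $2-g$). A quadrangulation of a surface is a (finite) loopless graph embedded on the surface such that all faces are quadrilaterals; parallel edges are allowed, and quadrilateral faces may have some of their vertices or even edges coinciding. Odd and even quadrangulations: choose an arbitrary orientation of each face, viewed as a closed walk along its boundary. Consistency is not broken at an edge if the edge is traversed in opposite directions when considering the faces at its two sides; otherwise the edge breaks consistency. The parity of the number of edges breaking consistency does not depend on the chosen orientations of the faces; the quadrangulation is called odd or even according to this parity. For a vertex $v$ of a graph $G$, $N(v)$ denotes the set of vertices adjacent to $v$. A proper vertex-coloring $c$ of $G$ is a local $3$-coloring if $|c(N(v))|\le 2$ for every vertex $v$ of $G$. *)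

theory Defs
  imports "HOL-Analysis.Analysis" "HOL-Algebra.Group"
begin

section \<open>Groups given by generators and relations; semi-free groups\<close>

text \<open>A letter \<open>(x, True)\<close> stands for the generator \<open>x\<close>, and \<open>(x, False)\<close> for its inverse.\<close>

type_synonym 'x word = "('x \<times> bool) list"

inductive pres_eq :: "'x set \<Rightarrow> ('x word \<times> 'x word) set \<Rightarrow> 'x word \<Rightarrow> 'x word \<Rightarrow> bool"
  for X :: "'x set" and R :: "('x word \<times> 'x word) set" where
  pres_refl: "w \<in> lists (X \<times> UNIV) \<Longrightarrow> pres_eq X R w w"
| pres_sym: "pres_eq X R v w \<Longrightarrow> pres_eq X R w v"
| pres_trans: "pres_eq X R u v \<Longrightarrow> pres_eq X R v w \<Longrightarrow> pres_eq X R u w"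
| pres_cancel: "u \<in> lists (X \<times> UNIV) \<Longrightarrow> v \<in> lists (X \<times> UNIV) \<Longrightarrow> x \<in> X \<Longrightarrow>
    pres_eq X R (u @ [(x, b), (x, \<not> b)] @ v) (u @ v)"
| pres_rel: "u \<in> lists (X \<times> UNIV) \<Longrightarrow> v \<in> lists (X \<times> UNIV) \<Longrightarrow> (r, s) \<in> R \<Longrightarrow>
    r \<in> lists (X \<times> UNIV) \<Longrightarrow> s \<in> lists (X \<times> UNIV) \<Longrightarrow>
    pres_eq X R (u @ r @ v) (u @ s @ v)"

definition presented_group :: "'x set \<Rightarrow> ('x word \<times> 'x word) set \<Rightarrow> 'x word set monoid" where
  "presented_group X R =
    \<lparr> carrier = lists (X \<times> UNIV) // {(v, w). pres_eq X R v w},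
      mult = (\<lambda>A B. \<Union>a\<in>A. \<Union>b\<in>B. {w. pres_eq X R (a @ b) w}),
      one = {w. pres_eq X R [] w} \<rparr>"

text \<open>A finite or infinite simple graph is a pair of its vertex set and its set of edges,
  the edges being two-element sets of vertices.\<close>

definition semi_free_group :: "'v set \<times> 'v set set \<Rightarrow> 'v word set monoid" where
  "semi_free_group H = presented_group (fst H)
     {([(x, True), (y, True)], [(y, True), (x, True)]) | x y. {x, y} \<in> snd H}"

definition kneser_graph :: "nat \<Rightarrow> nat \<Rightarrow> nat set set \<times> nat set set set" where
  "kneser_graph m k =
     (let V = {A. A \<subseteq> {1..m} \<and> card A = k}
      in (V, {{A, B} | A B. A \<in> V \<and> B \<in> V \<and> A \<noteq> B \<and> A \<inter> B = {}}))"

lemma pres_eq_words: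
  "pres_eq X R v w \<Longrightarrow> v \<in> lists (X \<times> UNIV) \<and> w \<in> lists (X \<times> UNIV)"
  by (induction rule: pres_eq.induct) auto

lemma pres_eq_ctxt:
  assumes "pres_eq X R v w" "a \<in> lists (X \<times> UNIV)" "b \<in> lists (X \<times> UNIV)"
  shows "pres_eq X R (a @ v @ b) (a @ w @ b)"
  using assms(1)
proof (induction rule: pres_eq.induct)
  case (pres_refl w)
  then show ?case using assms by (intro pres_eq.pres_refl) auto
next
  case (pres_sym v w)
  then show ?case by (blast intro: pres_eq.pres_sym)
next
  case (pres_trans u v w)
  then show ?case by (blast intro: pres_eq.pres_trans)
next
  case (pres_cancel u v x c)
  then show ?case
    using assms pres_eq.pres_cancel[of "a @ u" X "v @ b" x R c] by auto
next
  case (pres_rel u v r s)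
  then show ?case
    using assms pres_eq.pres_rel[of "a @ u" X "v @ b" r s R] by auto
qed

lemma pres_eq_append:
  assumes "pres_eq X R v w" "pres_eq X R v' w'"
  shows "pres_eq X R (v @ v') (w @ w')"
proof -
  have "pres_eq X R (v @ v') (w @ v')"
    using pres_eq_ctxt[OF assms(1), of "[]" v'] pres_eq_words[OF assms(2)] by auto
  moreover have "pres_eq X R (w @ v') (w @ w')"
    using pres_eq_ctxt[OF assms(2), of w "[]"] pres_eq_words[OF assms(1)] by auto
  ultimately show ?thesis by (rule pres_trans)
qed

lemma equiv_pres_eq: "equiv (lists (X \<times> UNIV)) {(v, w). pres_eq X R v w}"
proof (rule equivI)
  show "{(v, w). pres_eq X R v w} \<subseteq> lists (X \<times> UNIV) \<times> lists (X \<times> UNIV)"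
    using pres_eq_words by fastforce
  show "refl_on (lists (X \<times> UNIV)) {(v, w). pres_eq X R v w}"
    using pres_eq_words by (fastforce simp: refl_on_def intro: pres_refl)
  show "sym {(v, w). pres_eq X R v w}"
    by (auto intro: symI pres_sym)
  show "trans {(v, w). pres_eq X R v w}"
    by (auto intro: transI pres_trans)
qed

lemma presented_group_class_mult:
  assumes "v \<in> lists (X \<times> UNIV)" "w \<in> lists (X \<times> UNIV)"
  shows "{u. pres_eq X R v u} \<otimes>\<^bsub>presented_group X R\<^esub> {u. pres_eq X R w u}
    = {u. pres_eq X R (v @ w) u}" (is "?L = ?R")
proof -
  have L: "u \<in> ?L \<longleftrightarrow> (\<exists>a b. pres_eq X R v a \<and> pres_eq X R w b \<and> pres_eq X R (a @ b) u)" for u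
    by (simp add: presented_group_def)
  show ?thesis
  proof (rule subset_antisym; rule subsetI)
    fix u assume "u \<in> ?L"
    then obtain a b where "pres_eq X R v a" "pres_eq X R w b" "pres_eq X R (a @ b) u"
      unfolding L by blast
    then show "u \<in> ?R" using pres_trans[OF pres_eq_append] by blast
  next
    fix u assume "u \<in> ?R"
    then show "u \<in> ?L"
      unfolding L using pres_refl[OF assms(1)] pres_refl[OF assms(2)] by blast
  qed
qed

lemma presented_group_carrier:
  "A \<in> carrier (presented_group X R) \<longleftrightarrow>
     (\<exists>w\<in>lists (X \<times> UNIV). A = {u. pres_eq X R w u})"
  by (auto simp: presented_group_def quotient_def)

lemma word_inverse_in:
  "w \<in> lists (X \<times> UNIV) \<Longrightarrow> rev (map (\<lambda>(x, b). (x, \<not> b)) w) \<in> lists (X \<times> UNIV)"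
  by (induction w) auto

lemma pres_eq_inverse:
  assumes "w \<in> lists (X \<times> UNIV)"
  shows "pres_eq X R (rev (map (\<lambda>(x, b). (x, \<not> b)) w) @ w) []"
  using assms
proof (induction w rule: list.induct)
  case Nil
  then show ?case by (auto intro: pres_refl)
next
  case (Cons p w)
  obtain x b where p: "p = (x, b)" by force
  let ?i = "rev (map (\<lambda>(x, b). (x, \<not> b)) w)"
  have w: "w \<in> lists (X \<times> UNIV)" and x: "x \<in> X"
    using Cons.prems p by (simp_all only: Cons_in_lists_iff mem_Sigma_iff)
  have "pres_eq X R (?i @ [(x, \<not> b), (x, \<not> \<not> b)] @ w) (?i @ w)"
    by (rule pres_cancel[OF word_inverse_in[OF w] w x])
  then show ?case using Cons.IH[OF w] p by (auto intro: pres_trans)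
qed

lemma group_presented_group: "group (presented_group X R)"
proof -
  let ?G = "presented_group X R"
  let ?c = "\<lambda>w. {u. pres_eq X R w u}"
  have mult: "?c v \<otimes>\<^bsub>?G\<^esub> ?c w = ?c (v @ w)"
    if "v \<in> lists (X \<times> UNIV)" "w \<in> lists (X \<times> UNIV)" for v w
    using presented_group_class_mult[OF that] .
  have one: "\<one>\<^bsub>?G\<^esub> = ?c []" by (simp add: presented_group_def)
  have carr: "?c w \<in> carrier ?G" if "w \<in> lists (X \<times> UNIV)" for w
    using that unfolding presented_group_carrier by blast
  have nil: "[] \<in> lists (X \<times> UNIV)" by simp
  show ?thesis
  proof (rule groupI)
    fix A B assume "A \<in> carrier ?G" "B \<in> carrier ?G"
    then obtain v w where vw: "v \<in> lists (X \<times> UNIV)" "w \<in> lists (X \<times> UNIV)"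
      and "A = ?c v" "B = ?c w" unfolding presented_group_carrier by blast
    moreover have "v @ w \<in> lists (X \<times> UNIV)" using vw by (simp only: append_in_lists_conv)
    ultimately show "A \<otimes>\<^bsub>?G\<^esub> B \<in> carrier ?G" by (simp only: mult carr)
  next
    show "\<one>\<^bsub>?G\<^esub> \<in> carrier ?G" unfolding one by (rule carr[OF nil])
  next
    fix A B C assume "A \<in> carrier ?G" "B \<in> carrier ?G" "C \<in> carrier ?G"
    then obtain u v w where uvw: "u \<in> lists (X \<times> UNIV)" "v \<in> lists (X \<times> UNIV)"
      "w \<in> lists (X \<times> UNIV)" and "A = ?c u" "B = ?c v" "C = ?c w"
      unfolding presented_group_carrier by blast
    moreover have "u @ v \<in> lists (X \<times> UNIV)" "v @ w \<in> lists (X \<times> UNIV)"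
      using uvw by (simp_all only: append_in_lists_conv)
    ultimately show "A \<otimes>\<^bsub>?G\<^esub> B \<otimes>\<^bsub>?G\<^esub> C = A \<otimes>\<^bsub>?G\<^esub> (B \<otimes>\<^bsub>?G\<^esub> C)"
      by (simp only: mult append_assoc)
  next
    fix A assume "A \<in> carrier ?G"
    then obtain w where w: "w \<in> lists (X \<times> UNIV)" and A: "A = ?c w"
      unfolding presented_group_carrier by blast
    show "\<one>\<^bsub>?G\<^esub> \<otimes>\<^bsub>?G\<^esub> A = A"
      unfolding one A by (simp only: mult[OF nil w] append_Nil)
    let ?i = "rev (map (\<lambda>(x, b). (x, \<not> b)) w)"
    have i: "?i \<in> lists (X \<times> UNIV)" using w by (rule word_inverse_in)
    have eq: "?c (?i @ w) = ?c []"
      using pres_trans[OF pres_eq_inverse[OF w]] pres_trans[OF pres_sym[OF pres_eq_inverse[OF w]]]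
      by (intro Collect_cong iffI)
    have "?c ?i \<otimes>\<^bsub>?G\<^esub> A = \<one>\<^bsub>?G\<^esub>"
      unfolding A one mult[OF i w] by (rule eq)
    then show "\<exists>B\<in>carrier ?G. B \<otimes>\<^bsub>?G\<^esub> A = \<one>\<^bsub>?G\<^esub>" using carr[OF i] by blast
  qed
qed

lemma group_semi_free_group: "group (semi_free_group H)"
  unfolding semi_free_group_def by (rule group_presented_group)


section \<open>Surfaces\<close>

definition surface :: "'a topology \<Rightarrow> bool" where
  "surface S \<longleftrightarrow> topspace S \<noteq> {} \<and> compact_space S \<and> connected_space S \<and> Hausdorff_space S \<and>
     (\<forall>x\<in>topspace S. \<exists>U. openin S U \<and> x \<in> U \<and>
        subtopology S U homeomorphic_space (euclidean :: (real^2) topology))"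

text \<open>The sphere with \<open>g\<close> crosscaps is a \<open>2g\<close>-gon with its sides identified along the word
  \<open>a\<^sub>1 a\<^sub>1 a\<^sub>2 a\<^sub>2 \<dots> a\<^sub>g a\<^sub>g\<close>. The polygon is the closed unit disc with its boundary circle divided
  into \<open>2g\<close> equal arcs; the pair of consecutive arcs number \<open>2j\<close> and \<open>2j + 1\<close>, traversed in the
  same direction, forms the crosscap number \<open>j\<close>. For \<open>g = 1\<close> this is the disc with antipodal
  boundary points identified.\<close>

definition crosscap_pairing :: "nat \<Rightarrow> complex \<Rightarrow> complex \<Rightarrow> bool" where
  "crosscap_pairing g x y \<longleftrightarrow> (\<exists>j<g. \<exists>t\<in>{0..1}.
     x = cis (2 * pi * (real (2 * j) + t) / real (2 * g)) \<and>
     y = cis (2 * pi * (real (2 * j + 1) + t) / real (2 * g)))"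

text \<open>The condition on \<open>q\<close> says that \<open>S\<close> is homeomorphic to the quotient space of the polygon.\<close>

definition nonorientable_surface_of_genus :: "nat \<Rightarrow> 'a topology \<Rightarrow> bool" where
  "nonorientable_surface_of_genus g S \<longleftrightarrow> surface S \<and> g \<ge> 1 \<and>
     (\<exists>q. quotient_map (top_of_set (cball 0 1)) S q \<and>
       (\<forall>x\<in>cball 0 1. \<forall>y\<in>cball 0 1. q x = q y \<longleftrightarrow> equivclp (crosscap_pairing g) x y))"


section \<open>Graphs embedded on a surface\<close>

text \<open>The elements of \<open>edges G\<close> are mere names, so that parallel edges are possible; the edge
  \<open>e\<close> is drawn as the arc \<open>curve G e\<close>, parametrized by the unit interval.\<close>

record ('a, 'e) drawing =
  verts :: "'a set"
  edges :: "'e set"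
  curve :: "'e \<Rightarrow> real \<Rightarrow> 'a"

text \<open>As \<open>curve G e\<close> is injective on the whole unit interval, there are no loops.\<close>

definition embedded_graph :: "'a topology \<Rightarrow> ('a, 'e) drawing \<Rightarrow> bool" where
  "embedded_graph S G \<longleftrightarrow>
     finite (verts G) \<and> finite (edges G) \<and> verts G \<subseteq> topspace S \<and>
     (\<forall>e\<in>edges G. embedding_map (top_of_set {0..1}) S (curve G e) \<and>
        curve G e 0 \<in> verts G \<and> curve G e 1 \<in> verts G \<and>
        curve G e ` {0<..<1} \<inter> verts G = {}) \<and>
     (\<forall>e\<in>edges G. \<forall>e'\<in>edges G. e \<noteq> e' \<longrightarrow>
        curve G e ` {0<..<1} \<inter> curve G e' ` {0<..<1} = {})"

definition faces :: "'a topology \<Rightarrow> ('a, 'e) drawing \<Rightarrow> 'a set set" where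
  "faces S G = connected_components_of
     (subtopology S (topspace S - (verts G \<union> (\<Union>e\<in>edges G. curve G e ` {0..1}))))"

text \<open>A step \<open>(e, True)\<close> of a walk traverses the edge \<open>e\<close> from \<open>curve G e 0\<close> to \<open>curve G e 1\<close>,
  and \<open>(e, False)\<close> traverses it the other way.\<close>

definition step_path :: "('a, 'e) drawing \<Rightarrow> 'e \<times> bool \<Rightarrow> real \<Rightarrow> 'a" where
  "step_path G d t = curve G (fst d) (if snd d then t else 1 - t)"

text \<open>The face \<open>f\<close> is a quadrilateral with boundary walk \<open>w\<close>: a closed disc, whose boundary circle
  is divided into four sides, is mapped to the surface so that its interior is mapped
  homeomorphically onto \<open>f\<close> and its sides run along the successive edges of \<open>w\<close>. The vertices
  and edges of \<open>w\<close> may repeat. Choosing \<open>w\<close> amounts to choosing an orientation of the face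
  (and a first step): the other orientation is \<open>w\<close> run backwards.\<close>

definition quad_boundary_walk ::
    "'a topology \<Rightarrow> ('a, 'e) drawing \<Rightarrow> 'a set \<Rightarrow> ('e \<times> bool) list \<Rightarrow> bool" where
  "quad_boundary_walk S G f w \<longleftrightarrow>
     length w = 4 \<and> fst ` set w \<subseteq> edges G \<and>
     (\<exists>\<phi>. continuous_map (top_of_set (cball (0::complex) 1)) S \<phi> \<and>
        homeomorphic_map (top_of_set (ball 0 1)) (subtopology S f) \<phi> \<and>
        (\<forall>k<4. \<forall>t\<in>{0..1}. \<phi> (cis (2 * pi * (real k + t) / 4)) = step_path G (w ! k) t))"

definition quadrangulation :: "'a topology \<Rightarrow> ('a, 'e) drawing \<Rightarrow> bool" where
  "quadrangulation S G \<longleftrightarrow> surface S \<and> embedded_graph S G \<and>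
     (\<forall>f\<in>faces S G. \<exists>w. quad_boundary_walk S G f w)"

text \<open>\<open>W\<close> assigns to every face its boundary walk in the chosen orientation. The two sides of an
  edge are the two places \<open>(f, i)\<close> where it occurs in these walks (possibly twice in the
  walk of one face); it breaks consistency if it has the same direction at both.\<close>

definition breaks_consistency ::
    "'a topology \<Rightarrow> ('a, 'e) drawing \<Rightarrow> ('a set \<Rightarrow> ('e \<times> bool) list) \<Rightarrow> 'e \<Rightarrow> bool" where
  "breaks_consistency S G W e \<longleftrightarrow>
     (\<exists>f\<in>faces S G. \<exists>f'\<in>faces S G. \<exists>i<length (W f). \<exists>j<length (W f'). (f, i) \<noteq> (f', j) \<and>
        fst (W f ! i) = e \<and> fst (W f' ! j) = e \<and> snd (W f ! i) = snd (W f' ! j))"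

text \<open>The parity does not depend on \<open>W\<close>, so that the existential quantifier could as well be
  a universal one.\<close>

definition odd_quadrangulation :: "'a topology \<Rightarrow> ('a, 'e) drawing \<Rightarrow> bool" where
  "odd_quadrangulation S G \<longleftrightarrow> quadrangulation S G \<and>
     (\<exists>W. (\<forall>f\<in>faces S G. quad_boundary_walk S G f (W f)) \<and>
          odd (card {e \<in> edges G. breaks_consistency S G W e}))"


section \<open>Local 3-colorings\<close>

definition nbrs :: "('a, 'e) drawing \<Rightarrow> 'a \<Rightarrow> 'a set" where
  "nbrs G v = {w. \<exists>e\<in>edges G. {curve G e 0, curve G e 1} = {v, w}}"

definition local_3_coloring :: "('a, 'e) drawing \<Rightarrow> ('a \<Rightarrow> 'c) \<Rightarrow> bool" where
  "local_3_coloring G c \<longleftrightarrow>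
     (\<forall>v\<in>verts G. \<forall>w\<in>nbrs G v. c v \<noteq> c w) \<and>
     (\<forall>v\<in>verts G. card (c ` nbrs G v) \<le> 2)"

end

theory Submission
  imports Defs
begin

text \<open>
  A local 3-coloring labels each directed edge by an element of \<open>\<Gamma>\<close>, a product of a generator
  and an inverse of a generator (either possibly missing), so that the label of every face is trivial. Mapping the generator
  \<open>{a, b}\<close> to the transposition of \<open>a\<close> and \<open>b\<close> gives a homomorphism from \<open>\<Gamma>\<close> to permutations, and
  (after a gauge transformation) each edge label swaps the colors \<open>1\<close> and \<open>2\<close>. So a closed walk of
  odd length has a nontrivial label.

  Pull the labelling back along the quotient map \<open>q\<close> from the polygon to the surface. The polygon is
  simply connected, so there is a parallel function \<open>T\<close> on it; on the two arcs of the crosscap \<open>j\<close>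
  it differs by a constant factor \<open>z j\<close>, and going once around the boundary shows that the product
  of the squares of the \<open>z j\<close> is trivial.

  For the oddness, let the sign of a group element tell whether it swaps \<open>1\<close> and \<open>2\<close>. The signs form a
  real line bundle \<open>L\<close> on the surface, and the complex bundle \<open>L \<otimes> \<complex>\<close> has a section that turns by half
  a circle along each edge and vanishes only at the centres of the faces, where its index has the
  parity of the number of edges traversed forwards. The sum of these indices is odd exactly if the
  quadrangulation is odd. Transported to the polygon by the sign of \<open>T\<close>, the section has this
  winding number, modulo 2, along the boundary; but it is multiplied by the sign of \<open>z j\<close> between
  the two arcs of the crosscap \<open>j\<close>, which forces the product of these signs to be \<open>-1\<close>.
\<close>

section \<open>Winding numbers of continuous functions on the disc\<close>

text \<open>The sign cannot be the parity of the permutation, because before the gauge an edge label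
  consists of zero, one or two transpositions, depending on the edge. What every edge reverses is an
  ordered pair of colors attached to each vertex: its own color and one chosen color of its
  neighbors. The gauge moves all these pairs to \<open>(1, 2)\<close>. Closed faces need not be
  embedded: a face may meet a vertex at several corners or an edge from both sides. Displacements
  between points of the surface are therefore a relation with a scale, and single-valued only at a
  scale depending on the point. The parallel function is not locally constant; it jumps between
  cells, and the signs of these jumps are what makes the section continuous. The coordinate changes
  between faces and polygon are only known to be injective and continuous, so indices are computed
  modulo 2. The decisive step at the rim is a division by 2: each crosscap is passed twice in the
  same direction, so the sum of the phase differences is half the total turn, which is an odd
  multiple of a full circle.\<close>

lemma continuous_on_image_compact_lift:
  fixes p :: "'a::metric_space \<Rightarrow> 'b::metric_space" and f :: "'b \<Rightarrow> 'c::metric_space"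
  assumes "compact A" "continuous_on A p" "continuous_on A (f \<circ> p)"
  shows "continuous_on (p ` A) f"
proof (subst continuous_on_closed_vimage)
  show cl: "closed (p ` A)"
    using assms by (simp add: compact_continuous_image compact_imp_closed)
  show "\<forall>B. closed B \<longrightarrow> closed (f -` B \<inter> p ` A)"
  proof (intro allI impI)
    fix B :: "'c set" assume B: "closed B"
    \<comment> \<open>A continuous map from a compact set to a Hausdorff space is closed, so closed
      sets may be tested upstairs in \<open>A\<close>.\<close>
    have eq: "f -` B \<inter> p ` A = p ` ((f \<circ> p) -` B \<inter> A)" by auto
    have "closed ((f \<circ> p) -` B \<inter> A)"
      using continuous_on_closed_vimage[OF compact_imp_closed[OF assms(1)], of "f \<circ> p"] assms(3) B
      by blast
    then have "compact (A \<inter> ((f \<circ> p) -` B \<inter> A))"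
      by (rule compact_Int_closed[OF assms(1)])
    moreover have "A \<inter> ((f \<circ> p) -` B \<inter> A) = (f \<circ> p) -` B \<inter> A" by blast
    ultimately have "compact ((f \<circ> p) -` B \<inter> A)" by (simp only:)
    moreover have "continuous_on ((f \<circ> p) -` B \<inter> A) p"
      by (rule continuous_on_subset[OF assms(2)]) blast
    ultimately show "closed (f -` B \<inter> p ` A)"
      unfolding eq by (intro compact_imp_closed compact_continuous_image)
  qed
qed

lemma cis_image_circle: "cis ` {0..2*pi} = sphere 0 1"
proof -
  have "z \<in> cis ` {0..2*pi}" if "norm z = 1" for z
  proof -
    have "z = cis (Arg2pi z)"
      using that Arg2pi_eq[of z] by (simp add: cis_conv_exp)
    then show ?thesis using Arg2pi[of z] by (intro image_eqI[of _ _ "Arg2pi z"]) auto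
  qed
  then show ?thesis by auto
qed

text \<open>The parametrization of the circle by \<open>{0..2*pi}\<close> is a quotient map that
  only glues the two ends.\<close>

lemma continuous_on_circle_lift:
  fixes g :: "real \<Rightarrow> complex"
  assumes "continuous_on {0..2*pi} g" "g 0 = g (2*pi)"
  obtains h where "continuous_on (sphere 0 1) h" "\<And>t. t \<in> {0..2*pi} \<Longrightarrow> h (cis t) = g t"
proof
  let ?h = "g \<circ> Arg2pi"
  show *: "?h (cis t) = g t" if "t \<in> {0..2*pi}" for t
  proof (cases "t = 2*pi")
    case True
    then show ?thesis using assms(2) Arg2pi_of_real[of 1] by (simp add: cis_2pi)
  next
    case False
    then have "Arg2pi (cis t) = t" using that by (intro Arg2pi_unique[of 1]) (auto simp: cis_conv_exp)
    then show ?thesis by simp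
  qed
  have "continuous_on (cis ` {0..2*pi}) ?h"
  proof (rule continuous_on_image_compact_lift)
    show "continuous_on {0..2 * pi} (?h \<circ> cis)"
      using assms(1) by (rule continuous_on_eq) (use * in auto)
  qed (auto intro!: continuous_intros)
  then show "continuous_on (sphere 0 1) ?h" by (simp add: cis_image_circle)
qed

text \<open>Distinct logarithms of one number are at least \<open>2*pi\<close> apart, so
  \<open>f\<close> has discrete range.\<close>

lemma exp_eq_exp_connected_const:
  fixes f :: "'a::topological_space \<Rightarrow> complex"
  assumes "connected A" "continuous_on A f" "\<And>x. x \<in> A \<Longrightarrow> exp (f x) = c"
  obtains d where "\<And>x. x \<in> A \<Longrightarrow> f x = d"
proof (cases "A = {}")
  case False
  then obtain a where a: "a \<in> A" by auto
  have "f constant_on A"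
  proof (rule continuous_discrete_range_constant[OF assms(1,2)])
    fix x assume x: "x \<in> A"
    show "\<exists>e>0. \<forall>y. y \<in> A \<and> f y \<noteq> f x \<longrightarrow> e \<le> norm (f y - f x)"
    proof (intro exI conjI allI impI)
      show "0 < 2*pi" by simp
      fix y assume y: "y \<in> A \<and> f y \<noteq> f x"
      then have "exp (f y) = exp (f x)" using assms(3) x by simp
      then obtain n :: int where n: "f y = f x + (of_int (2*n) * pi) * \<i>"
        unfolding exp_eq by blast
      with y have "n \<noteq> 0" by auto
      then have "1 \<le> \<bar>real_of_int n\<bar>" by linarith
      moreover have "norm (f y - f x) = 2 * \<bar>real_of_int n\<bar> * pi"
        by (simp add: n norm_mult abs_mult)
      ultimately show "2*pi \<le> norm (f y - f x)"
        using pi_gt_zero by (metis mult.commute mult_le_cancel_left_pos mult.left_commute mult_2_right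
            mult.right_neutral pi_gt_zero zero_less_mult_iff zero_less_numeral)
    qed
  qed
  then show ?thesis using that by (auto simp: constant_on_def)
qed (use that in auto)

text \<open>Borsuk's argument for odd maps: the difference of the values of \<open>h\<close> at
  antipodal points of the circle is an odd function and has odd degree; moving the second point to
  the centre deforms it to the wanted function. Injectivity keeps the difference away from
  zero.\<close>

lemma odd_degree_injective:
  fixes h :: "complex \<Rightarrow> complex"
  assumes cont: "continuous_on (cball p r) h" and inj: "inj_on h (cball p r)" and r: "0 < r"
  obtains n :: int and L where "odd n" "continuous_on (sphere 0 1) L"
    "\<And>\<xi>. \<xi> \<in> sphere 0 1 \<Longrightarrow> h (p + of_real r * \<xi>) - h p = \<xi> powi n * exp (L \<xi>)"
proof -
  \<comment> \<open>\<open>fst x\<close> is the deformation parameter, \<open>1\<close> for the odd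
    map and \<open>0\<close> for the wanted one; \<open>snd x\<close> is the angle.\<close>
  define N where "N = (\<lambda>x::real\<times>real. h (p + of_real r * cis (snd x)) - h (p - of_real (fst x * r) * cis (snd x)))"
  let ?Q = "{0..1} \<times> {0..2*pi}"
  have dom1: "p + of_real r * cis t \<in> cball p r" for t
    using r by (simp add: dist_norm norm_mult)
  have dom2: "p - of_real (s * r) * cis t \<in> cball p r" if "s \<in> {0..1}" for s t
    using r that by (auto simp: dist_norm norm_mult mult_le_cancel_right1 abs_mult)
  have contN: "continuous_on ?Q N"
    unfolding N_def
    by (intro continuous_on_diff continuous_on_compose2[OF cont] continuous_intros)
       (use dom1 dom2 in \<open>auto intro!: continuous_intros\<close>)
  have N0: "N x \<noteq> 0" if "x \<in> ?Q" for x
  proof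
    assume "N x = 0"
    then have "p + of_real r * cis (snd x) = p - of_real (fst x * r) * cis (snd x)"
      unfolding N_def using inj_onD[OF inj] dom1 dom2 that by fastforce
    then have "of_real (r * (1 + fst x)) * cis (snd x) = 0" by (simp add: algebra_simps)
    then have "r * (1 + fst x) = 0" by (simp only: mult_eq_0_iff of_real_eq_0_iff cis_neq_zero simp_thms)
    then show False using r that by auto
  qed
  obtain L where L: "continuous_on ?Q L" "\<And>x. x \<in> ?Q \<Longrightarrow> N x = exp (L x)"
    using continuous_logarithm_on_contractible[OF contN convex_imp_contractible N0]
    by (metis convex_Times convex_real_interval(5))
  have Lt: "continuous_on A (\<lambda>t. L (f t))"
    if "continuous_on A f" "f ` A \<subseteq> ?Q" for f and A :: "real set"
    using continuous_on_compose2[OF L(1) that] .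
  \<comment> \<open>Half a turn negates \<open>N (1, t)\<close>, so the logarithm grows by an odd
    multiple of \<open>\<i> * pi\<close>, and by the same amount \<open>d\<close> on both halves of
    the circle.\<close>
  have "exp (L (1, t + pi) - L (1, t)) = -1" if "t \<in> {0..pi}" for t
  proof -
    have "cis (t + pi) = - cis t" by (metis cis_mult cis_pi mult_minus1_right)
    then have "N (1, t + pi) = - N (1, t)" by (simp add: N_def)
    then show ?thesis using L(2)[of "(1, t+pi)"] L(2)[of "(1,t)"] that
      by (auto simp: exp_diff N0 field_simps)
  qed
  note e1 = this
  have "continuous_on {0..pi} (\<lambda>t. L (1, t + pi) - L (1, t))"
    by (intro continuous_on_diff Lt continuous_intros) auto
  from connected_Icc this e1
  obtain d where d: "\<And>t. t \<in> {0..pi} \<Longrightarrow> L (1, t + pi) - L (1, t) = d"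
    by (rule exp_eq_exp_connected_const) (assumption | blast)+
  have "exp d = -1" using e1[of 0] d[of 0] by auto
  then have "exp d = exp (\<i> * pi)" by simp
  then obtain k :: int where k: "d = \<i> * pi + (of_int (2*k) * pi) * \<i>"
    unfolding exp_eq by blast
  define n where "n = 2 * k + 1"
  have d2: "2 * d = 2 * pi * of_int n * \<i>" by (simp add: k n_def algebra_simps)
  have L1: "L (1, 2*pi) - L (1, 0) = 2 * d"
    using d[of 0] d[of pi] by (simp add: algebra_simps)
  have e2: "exp (L (s, 2*pi) - L (s, 0)) = 1" if "s \<in> {0..1}" for s
  proof -
    have "N (s, 2*pi) = N (s, 0)" by (simp add: N_def)
    then show ?thesis using L(2)[of "(s, 2*pi)"] L(2)[of "(s,0)"] that
      by (auto simp: exp_diff N0)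
  qed
  \<comment> \<open>The growth around the circle does not depend on \<open>s\<close>, which carries
    the odd degree from \<open>s = 1\<close> to \<open>s = 0\<close>.\<close>
  have "continuous_on {0..1} (\<lambda>s. L (s, 2*pi) - L (s, 0))"
    by (intro continuous_on_diff Lt continuous_intros) auto
  from connected_Icc this e2
  obtain d' where d': "\<And>s. s \<in> {0..1} \<Longrightarrow> L (s, 2*pi) - L (s, 0) = d'"
    by (rule exp_eq_exp_connected_const) (assumption | blast)+
  have L0: "L (0, 2*pi) - L (0, 0) = 2 * pi * of_int n * \<i>"
    using d'[of 0] d'[of 1] L1 d2 by simp
  have "continuous_on {0..2*pi} (\<lambda>t. L (0, t) - \<i> * of_int n * of_real t)"
    by (intro continuous_on_diff Lt continuous_intros) auto
  then obtain \<Lambda> where \<Lambda>: "continuous_on (sphere 0 1) \<Lambda>"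
      "\<And>t. t \<in> {0..2*pi} \<Longrightarrow> \<Lambda> (cis t) = L (0, t) - \<i> * of_int n * of_real t"
    by (rule continuous_on_circle_lift) (use L0 in \<open>auto simp: algebra_simps\<close>)
  show thesis
  proof
    show "odd n" by (simp add: n_def)
    show "continuous_on (sphere 0 1) \<Lambda>" by fact
    fix \<xi> :: complex assume "\<xi> \<in> sphere 0 1"
    then obtain t where t: "t \<in> {0..2*pi}" "\<xi> = cis t" using cis_image_circle by (metis imageE)
    have "h (p + of_real r * \<xi>) - h p = N (0, t)" by (simp add: N_def t)
    also have "\<dots> = exp (L (0, t))" using L(2) t by auto
    also have "\<dots> = cis t powi n * exp (\<Lambda> (cis t))"
    proof -
      have "cis t powi n = exp (\<i> * of_int n * of_real t)"
        unfolding cis_power_int by (simp add: cis_conv_exp mult_ac)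
      then show ?thesis using t by (simp add: \<Lambda> exp_diff)
    qed
    finally show "h (p + of_real r * \<xi>) - h p = \<xi> powi n * exp (\<Lambda> \<xi>)" by (simp add: t)
  qed
qed

text \<open>\<open>n\<close> is a winding number around 0. The remaining factor has a continuous
  logarithm, so that products and powers become arithmetic of exponents.\<close>

definition circle_degree :: "(complex \<Rightarrow> complex) \<Rightarrow> int \<Rightarrow> bool" where
  "circle_degree f n \<longleftrightarrow> (\<exists>L. continuous_on (sphere 0 1) L \<and>
     (\<forall>\<xi>\<in>sphere 0 1. f \<xi> = \<xi> powi n * exp (L \<xi>)))"

lemma circle_degreeI:
  assumes "continuous_on (sphere 0 1) L" "\<And>\<xi>. \<xi> \<in> sphere 0 1 \<Longrightarrow> f \<xi> = \<xi> powi n * exp (L \<xi>)"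
  shows "circle_degree f n"
  using assms unfolding circle_degree_def by blast

lemma circle_degree_cong:
  assumes "circle_degree f n" "\<And>\<xi>. \<xi> \<in> sphere 0 1 \<Longrightarrow> g \<xi> = f \<xi>"
  shows "circle_degree g n"
  using assms unfolding circle_degree_def by auto

lemma circle_degree_mult:
  assumes "circle_degree f m" "circle_degree g n"
  shows "circle_degree (\<lambda>z. f z * g z) (m + n)"
proof -
  obtain K L where "continuous_on (sphere 0 1) K" "continuous_on (sphere 0 1) L"
    "\<And>\<xi>. \<xi> \<in> sphere 0 1 \<Longrightarrow> f \<xi> = \<xi> powi m * exp (K \<xi>)"
    "\<And>\<xi>. \<xi> \<in> sphere 0 1 \<Longrightarrow> g \<xi> = \<xi> powi n * exp (L \<xi>)"
    using assms unfolding circle_degree_def by metis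
  moreover have "\<xi> powi (m + n) = \<xi> powi m * \<xi> powi n" if "norm \<xi> = 1" for \<xi> :: complex
    using that by (intro power_int_add) auto
  ultimately show ?thesis
    by (intro circle_degreeI[of "\<lambda>z. K z + L z"]) (auto intro!: continuous_intros simp: exp_add)
qed

lemma circle_degree_powi:
  assumes "circle_degree f m"
  shows "circle_degree (\<lambda>z. f z powi k) (m * k)"
proof -
  obtain L where L: "continuous_on (sphere 0 1) L"
    "\<And>\<xi>. \<xi> \<in> sphere 0 1 \<Longrightarrow> f \<xi> = \<xi> powi m * exp (L \<xi>)"
    using assms unfolding circle_degree_def by metis
  show ?thesis
  proof (rule circle_degreeI)
    show "continuous_on (sphere 0 1) (\<lambda>z. of_int k * L z)"
      by (intro continuous_intros L)
    show "f \<xi> powi k = \<xi> powi (m * k) * exp (of_int k * L \<xi>)" if "\<xi> \<in> sphere 0 1" for \<xi>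
      using that by (simp add: L(2) power_int_mult_distrib power_int_mult exp_power_int)
  qed
qed

lemma circle_degree_0:
  assumes "continuous_on (cball 0 1) f" "\<And>z. z \<in> cball 0 1 \<Longrightarrow> f z \<noteq> 0"
  shows "circle_degree f 0"
proof -
  obtain L where "continuous_on (cball 0 1) L" "\<And>z. z \<in> cball 0 1 \<Longrightarrow> f z = exp (L z)"
    using continuous_logarithm_on_cball[OF assms] by metis
  then show ?thesis
    by (intro circle_degreeI[of L]) (auto elim: continuous_on_subset)
qed

text \<open>On the unit circle \<open>z - p = z * (1 - p * cnj z)\<close>, and the second factor has
  positive real part because \<open>p\<close> lies inside.\<close>

lemma circle_degree_linear:
  assumes "p \<in> ball 0 1" "0 < r"
  shows "circle_degree (\<lambda>z. (z - p) / of_real r) 1"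
proof (rule circle_degreeI)
  have pos: "0 < Re (1 - p * cnj z)" if "z \<in> sphere 0 1" for z
  proof -
    have "Re (p * cnj z) \<le> norm (p * cnj z)" by (rule complex_Re_le_cmod)
    also have "\<dots> < 1" using that assms by (simp add: norm_mult)
    finally show ?thesis by simp
  qed
  have pos': "0 < Re ((1 - p * cnj z) / of_real r)" if "z \<in> sphere 0 1" for z
    using pos[OF that] assms(2) by (simp add: Re_divide_of_real)
  show "continuous_on (sphere 0 1) (\<lambda>z. Ln ((1 - p * cnj z) / of_real r))"
  proof (intro continuous_intros)
    fix z :: complex assume "z \<in> sphere 0 1"
    from pos'[OF this] show "(1 - p * cnj z) / of_real r \<notin> \<real>\<^sub>\<le>\<^sub>0"
      by (metis complex_nonpos_Reals_iff not_le)
  qed (use assms(2) in auto)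
  show "(z - p) / of_real r = z powi 1 * exp (Ln ((1 - p * cnj z) / of_real r))"
    if z: "z \<in> sphere 0 1" for z
  proof -
    have "(1 - p * cnj z) / of_real r \<noteq> 0" using pos'[OF z] by fastforce
    moreover have "z * cnj z = 1" using z by (simp add: complex_norm_square[symmetric])
    then have "z - p = z * (1 - p * cnj z)" by (simp add: algebra_simps)
    ultimately show ?thesis by simp
  qed
qed

text \<open>An argument principle modulo 2 for continuous functions. Zeros are removed one at a
  time: \<open>u\<close> is divided by a power of \<open>z - p\<close> outside a small disc around
  \<open>p\<close>, and the disc is filled without zeros. Indices are given on all small circles, so
  that the radius can be fitted to the other zeros.\<close>

lemma circle_degree_sum_zeros:
  fixes u :: "complex \<Rightarrow> complex"
  assumes "finite P" "P \<subseteq> ball 0 1" "continuous_on (cball 0 1) u"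
    and "\<And>z. z \<in> cball 0 1 \<Longrightarrow> u z = 0 \<longleftrightarrow> z \<in> P"
    and "\<And>p. p \<in> P \<Longrightarrow> \<exists>r0>0. \<forall>r. 0 < r \<and> r < r0 \<longrightarrow>
      (\<exists>m. circle_degree (\<lambda>\<xi>. u (p + of_real r * \<xi>)) m \<and> even (m - d p))"
  shows "\<exists>M. circle_degree u M \<and> even (M - (\<Sum>p\<in>P. d p))"
  using assms
proof (induction P arbitrary: u rule: finite_induct)
  case empty
  then show ?case using circle_degree_0[of u] by (intro exI[of _ 0]) simp
next
  case (insert p P u)
  obtain r0 where r0: "r0 > 0"
    "\<And>r. 0 < r \<and> r < r0 \<Longrightarrow> \<exists>m. circle_degree (\<lambda>\<xi>. u (p + of_real r * \<xi>)) m \<and> even (m - d p)"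
    using insert.prems(4)[of p] by auto
  have "open (ball 0 1 - P)" using insert.hyps(1) by (simp add: open_Diff finite_imp_closed)
  moreover have "p \<in> ball 0 1 - P" using insert by auto
  ultimately obtain e where e: "e > 0" "cball p e \<subseteq> ball 0 1 - P"
    by (meson open_contains_cball)
  define r where "r = min e (r0 / 2)"
  have r: "0 < r" "r < r0" "cball p r \<subseteq> ball 0 1 - P"
    using r0(1) e by (auto simp: r_def)
  obtain m L where m: "even (m - d p)" and L: "continuous_on (sphere 0 1) L"
    "\<And>\<xi>. \<xi> \<in> sphere 0 1 \<Longrightarrow> u (p + of_real r * \<xi>) = \<xi> powi m * exp (L \<xi>)"
    using r0(2)[of r] r unfolding circle_degree_def by blast
  \<comment> \<open>After the winding is divided out, the values on the small circle have a
    logarithm; its extension to the plane fills the disc.\<close>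
  obtain L' where L': "continuous_on UNIV L'" "\<And>\<xi>. \<xi> \<in> sphere 0 1 \<Longrightarrow> L' \<xi> = L \<xi>"
    using Tietze_unbounded[OF L(1), of UNIV] by auto
  define w where "w = (\<lambda>z. (z - p) / of_real r)"
  have w0: "w z \<noteq> 0 \<longleftrightarrow> z \<noteq> p" for z using r by (simp add: w_def)
  have pw: "p + of_real r * w z = z" for z using r by (simp add: w_def)
  have contw: "continuous_on A w" for A unfolding w_def using r by (intro continuous_intros) auto
  define v where "v = (\<lambda>z. if z \<in> cball p r then exp (L' (w z)) else u z * w z powi (- m))"
  have contv: "continuous_on (cball 0 1) v"
  proof -
    have eq: "cball 0 1 = cball p r \<union> (cball 0 1 - ball p r)" using r ball_subset_cball by blast
    show ?thesis unfolding v_def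
    proof (subst eq, rule continuous_on_cases)
      show "continuous_on (cball p r) (\<lambda>z. exp (L' (w z)))"
        by (intro continuous_intros continuous_on_compose2[OF L'(1)] contw) auto
      show "continuous_on (cball 0 1 - ball p r) (\<lambda>z. u z * w z powi - m)"
        using w0 r(1) by (intro continuous_intros contw continuous_on_subset[OF insert.prems(2)]) auto
      show "\<forall>z. z \<in> cball p r \<and> z \<notin> cball p r \<or> z \<in> cball 0 1 - ball p r \<and> z \<in> cball p r \<longrightarrow>
         exp (L' (w z)) = u z * w z powi - m"
      proof (intro allI impI)
        fix z assume "z \<in> cball p r \<and> z \<notin> cball p r \<or> z \<in> cball 0 1 - ball p r \<and> z \<in> cball p r"
        then have "dist p z = r" by auto
        then have wz: "w z \<in> sphere 0 1" using r(1) by (auto simp: w_def norm_divide dist_norm norm_minus_commute)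
        then have "w z \<noteq> 0" by auto
        then show "exp (L' (w z)) = u z * w z powi - m"
          using L(2)[OF wz] by (simp add: pw L'(2)[OF wz] power_int_minus field_simps)
      qed
    qed auto
  qed
  have zv: "v z = 0 \<longleftrightarrow> z \<in> P" if "z \<in> cball 0 1" for z
    using insert.prems(3)[OF that] r w0[of z] insert.hyps(2) by (auto simp: v_def)
  have "\<exists>M. circle_degree v M \<and> even (M - (\<Sum>p\<in>P. d p))"
  proof (rule insert.IH[OF _ contv zv])
    show "P \<subseteq> ball 0 1" using insert.prems(1) by auto
    fix p' assume p': "p' \<in> P"
    obtain r1 where r1: "r1 > 0"
      "\<And>r. 0 < r \<and> r < r1 \<Longrightarrow>
        \<exists>m. circle_degree (\<lambda>\<xi>. u (p' + of_real r * \<xi>)) m \<and> even (m - d p')"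
      using insert.prems(4)[of p'] p' by auto
    have "p' \<in> - cball p r" using p' r(3) by auto
    then obtain r2 where r2: "r2 > 0" "ball p' r2 \<subseteq> - cball p r"
      by (meson open_contains_ball open_Compl closed_cball)
    show "\<exists>r0>0. \<forall>s. 0 < s \<and> s < r0 \<longrightarrow>
        (\<exists>m. circle_degree (\<lambda>\<xi>. v (p' + of_real s * \<xi>)) m \<and> even (m - d p'))"
    proof (intro exI[of _ "min r1 r2"] conjI allI impI)
      show "0 < min r1 r2" using r1 r2 by simp
      fix s assume s: "0 < s \<and> s < min r1 r2"
      have out: "p' + of_real s * z \<in> - cball p r" if "z \<in> cball 0 1" for z
      proof -
        have "norm (of_real s * z) \<le> s" using that s by (simp add: norm_mult mult_le_cancel_left1)
        then show ?thesis using s r2 by (auto simp: subset_iff dist_norm)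
      qed
      \<comment> \<open>Near another zero of \<open>u\<close> the function \<open>w\<close> has no
        zeros, so the division leaves the index there unchanged.\<close>
      have "circle_degree (\<lambda>\<xi>. w (p' + of_real s * \<xi>)) 0"
      proof (rule circle_degree_0)
        show "continuous_on (cball 0 1) (\<lambda>\<xi>. w (p' + of_real s * \<xi>))"
          by (intro continuous_on_compose2[OF contw] continuous_intros) auto
        show "w (p' + of_real s * z) \<noteq> 0" if "z \<in> cball 0 1" for z
          using out[OF that] w0 r(1) by fastforce
      qed
      note w = circle_degree_powi[OF this, of "- m"]
      obtain m' where m': "circle_degree (\<lambda>\<xi>. u (p' + of_real s * \<xi>)) m'" "even (m' - d p')"
        using r1(2)[of s] s by auto
      have "circle_degree (\<lambda>\<xi>. u (p' + of_real s * \<xi>) * w (p' + of_real s * \<xi>) powi - m) m'"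
        using circle_degree_mult[OF m'(1) w] by simp
      then have "circle_degree (\<lambda>\<xi>. v (p' + of_real s * \<xi>)) m'"
        by (rule circle_degree_cong) (use out in \<open>force simp: v_def\<close>)
      then show "\<exists>m. circle_degree (\<lambda>\<xi>. v (p' + of_real s * \<xi>)) m \<and> even (m - d p')"
        using m'(2) by blast
    qed
  qed
  then obtain M where M: "circle_degree v M" "even (M - (\<Sum>p\<in>P. d p))" by blast
  \<comment> \<open>Multiplying the power of \<open>w\<close> back adds \<open>m\<close>, as
    \<open>w\<close> winds once around 0 along the unit circle.\<close>
  have "circle_degree w 1"
    unfolding w_def using insert.prems(1) r(1) by (intro circle_degree_linear) auto
  then have "circle_degree (\<lambda>z. v z * w z powi m) (M + 1 * m)"
    by (intro circle_degree_mult circle_degree_powi M)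
  then have "circle_degree u (M + m)"
    unfolding mult_1
  proof (rule circle_degree_cong)
    fix z :: complex assume z: "z \<in> sphere 0 1"
    then have "z \<notin> cball p r" using r(3) by auto
    moreover from this have "w z \<noteq> 0" using w0 r(1) by auto
    ultimately show "u z = v z * w z powi m" by (simp add: v_def power_int_minus)
  qed
  then show ?case using insert.hyps m M(2) by (intro exI[of _ "M + m"]) auto
qed

text \<open>Let \<Psi> be a logarithm of \<open>u\<close> along the rim, with arcs as units. Between
  corresponding points of the two arcs of a crosscap it differs by a constant \<zeta>. Comparing the
  starting points and the end points shows that \<Psi> grows by twice \<zeta> over both arcs. The
  total growth is \<open>2 * pi * \<i> * M\<close>; halving it and exponentiating gives
  \<open>-1\<close> to the power \<open>M\<close>.\<close>

lemma crosscap_sign_product: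
  fixes u :: "complex \<Rightarrow> complex" and \<epsilon> :: "nat \<Rightarrow> complex"
  assumes deg: "circle_degree u M" and "odd M" and g: "g \<ge> 1"
    and rel: "\<And>j t. j < g \<Longrightarrow> t \<in> {0..1} \<Longrightarrow>
      u (cis (2 * pi * (real (2 * j + 1) + t) / real (2 * g))) =
      \<epsilon> j * u (cis (2 * pi * (real (2 * j) + t) / real (2 * g)))"
  shows "(\<Prod>j<g. \<epsilon> j) = -1"
proof -
  obtain L where L: "continuous_on (sphere 0 1) L" "\<And>\<xi>. \<xi> \<in> sphere 0 1 \<Longrightarrow> u \<xi> = \<xi> powi M * exp (L \<xi>)"
    using deg unfolding circle_degree_def by metis
  define \<Psi> where "\<Psi> = (\<lambda>s::real. L (cis (2 * pi * s / (2 * g))) + \<i> * of_int M * of_real (2 * pi * s / (2 * g)))"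
  have u: "u (cis (2 * pi * s / (2 * g))) = exp (\<Psi> s)" for s
    using L(2)[of "cis (2 * pi * s / (2 * g))"]
    by (simp add: \<Psi>_def exp_add cis_power_int) (simp add: cis_conv_exp mult_ac)
  have cont: "continuous_on A \<Psi>" for A
    unfolding \<Psi>_def using g by (intro continuous_intros continuous_on_compose2[OF L(1)]) auto
  define \<zeta> where "\<zeta> = (\<lambda>j. \<Psi> (2*j+1) - \<Psi> (2*j))"
  have \<zeta>: "exp (\<zeta> j) = \<epsilon> j" "\<Psi> (2*j+2) - \<Psi> (2*j+1) = \<zeta> j"
    if j: "j < g" for j :: nat
  proof -
    let ?d = "\<lambda>t::real. \<Psi> (2*j+1+t) - \<Psi> (2*j+t)"
    have c: "continuous_on {0..1} ?d"
      by (intro continuous_on_diff continuous_on_compose2[OF cont[of UNIV]] continuous_intros) auto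
    have e: "exp (?d t) = \<epsilon> j" if "t \<in> {0..1}" for t
      using rel[OF j that] u[of "2*j+1+t"] u[of "2*j+t"] by (simp add: exp_diff field_simps)
    from connected_Icc c e obtain d where "\<And>t. t \<in> {0..1} \<Longrightarrow> ?d t = d"
      by (rule exp_eq_exp_connected_const) (assumption | blast)+
    from this[of 0] this[of 1] e[of 0]
    show "exp (\<zeta> j) = \<epsilon> j" "\<Psi> (2*j+2) - \<Psi> (2*j+1) = \<zeta> j" by (auto simp: add_ac \<zeta>_def)
  qed
  have "2 * (\<Sum>j<g. \<zeta> j) = (\<Sum>j<g. \<Psi> (2 * Suc j) - \<Psi> (2 * j))"
    unfolding sum_distrib_left
  proof (rule sum.cong)
    fix j assume "j \<in> {..<g}"
    then show "2 * \<zeta> j = \<Psi> (2 * Suc j) - \<Psi> (2 * j)"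
      using \<zeta>(2)[of j] by (simp add: \<zeta>_def algebra_simps)
  qed simp
  also have "\<dots> = \<Psi> (2 * g) - \<Psi> 0"
    using sum_lessThan_telescope[of "\<lambda>j. \<Psi> (2 * j)" g] by simp
  also have "\<dots> = 2 * (\<i> * of_int M * pi)"
  proof -
    have "cis (pi * 2) = 1" using cis_2pi by (simp add: mult.commute)
    then show ?thesis using g by (simp add: \<Psi>_def)
  qed
  finally have "(\<Sum>j<g. \<zeta> j) = \<i> * of_int M * pi" by simp
  moreover have "(\<Prod>j<g. \<epsilon> j) = exp (\<Sum>j<g. \<zeta> j)"
    by (simp add: exp_sum \<zeta>(1))
  moreover have "cis pi powi M = exp (\<i> * of_int M * pi)"
    unfolding cis_power_int by (simp add: cis_conv_exp mult_ac)
  ultimately have "(\<Prod>j<g. \<epsilon> j) = cis pi powi M" by simp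
  then show ?thesis using \<open>odd M\<close> by (simp add: power_int_minus_left)
qed

section \<open>Parallel functions with values in a group\<close>

text \<open>A flat connection without a topology on \<open>K\<close>: \<open>R e a b k\<close> says
  that \<open>k\<close> is a displacement from \<open>a\<close> to \<open>b\<close> visible at scale
  \<open>e\<close>. Several \<open>k\<close> may be visible at a large scale. Displacements act from
  the right, so constants may be multiplied from the left.\<close>

locale transport = group K for K :: "('k, 'm) monoid_scheme" (structure) +
  fixes R :: "real \<Rightarrow> 'a::metric_space \<Rightarrow> 'a \<Rightarrow> 'k \<Rightarrow> bool" and D :: "'a set"
  assumes R_mono: "\<And>e d a b k. R e a b k \<Longrightarrow> e \<le> d \<Longrightarrow> R d a b k"
    and R_carrier: "\<And>e a b k. R e a b k \<Longrightarrow> k \<in> carrier K"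
    and R_ex: "\<And>a e. a \<in> D \<Longrightarrow> e > 0 \<Longrightarrow> \<exists>d>0. \<forall>b\<in>D. dist a b < d \<longrightarrow> (\<exists>k. R e a b k)"
begin

definition parallel :: "'a set \<Rightarrow> ('a \<Rightarrow> 'k) \<Rightarrow> bool" where
  "parallel W T \<longleftrightarrow> T \<in> W \<rightarrow> carrier K \<and>
     (\<forall>a\<in>W. \<exists>e>0. \<forall>b\<in>W. dist a b < e \<longrightarrow> (\<forall>k. R e a b k \<longrightarrow> T b = T a \<otimes> k))"

lemma parallel_subset: "parallel W T \<Longrightarrow> V \<subseteq> W \<Longrightarrow> parallel V T"
  unfolding parallel_def by (blast intro: Pi_anti_mono[THEN subsetD])

lemma parallel_mult_left:
  assumes "parallel W T" "c \<in> carrier K"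
  shows "parallel W (\<lambda>z. c \<otimes> T z)"
proof -
  have T: "\<And>z. z \<in> W \<Longrightarrow> T z \<in> carrier K" using assms unfolding parallel_def by auto
  have "\<exists>e>0. \<forall>b\<in>W. dist a b < e \<longrightarrow> (\<forall>k. R e a b k \<longrightarrow> c \<otimes> T b = c \<otimes> T a \<otimes> k)" if a: "a \<in> W" for a
  proof -
    obtain e where "e > 0" "\<And>b k. b \<in> W \<Longrightarrow> dist a b < e \<Longrightarrow> R e a b k \<Longrightarrow> T b = T a \<otimes> k"
      using assms a unfolding parallel_def by metis
    then show ?thesis using T[OF a] assms(2) R_carrier by (intro exI[of _ e]) (auto simp: m_assoc)
  qed
  then show ?thesis using T assms(2) unfolding parallel_def by auto
qed

text \<open>Agreement is both open and closed: near each point the two functions follow a common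
  displacement, which cancels.\<close>

lemma parallel_unique:
  assumes "parallel W T" "parallel W T'" "connected W" "W \<subseteq> D" "a \<in> W" "T a = T' a" "b \<in> W"
  shows "T b = T' b"
proof -
  have "(\<lambda>x y. T x = T' x \<longleftrightarrow> T y = T' y) a b"
  proof (rule connected_equivalence_relation[OF assms(3,5,7)])
    fix x assume x: "x \<in> W"
    obtain e where e: "e > 0" "\<And>b k. b \<in> W \<Longrightarrow> dist x b < e \<Longrightarrow> R e x b k \<Longrightarrow> T b = T x \<otimes> k"
      using assms(1) x unfolding parallel_def by metis
    obtain e' where e': "e' > 0" "\<And>b k. b \<in> W \<Longrightarrow> dist x b < e' \<Longrightarrow> R e' x b k \<Longrightarrow> T' b = T' x \<otimes> k"
      using assms(2) x unfolding parallel_def by metis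
    obtain d where d: "d > 0" "\<And>b. b \<in> D \<Longrightarrow> dist x b < d \<Longrightarrow> \<exists>k. R (min e e') x b k"
      using R_ex[of x "min e e'"] assms(4) x e(1) e'(1) by (metis min_less_iff_conj subsetD)
    have T: "T x \<in> carrier K" "T' x \<in> carrier K" using assms x unfolding parallel_def by auto
    show "\<exists>V. openin (top_of_set W) V \<and> x \<in> V \<and> (\<forall>y\<in>V. (T x = T' x) = (T y = T' y))"
    proof (intro exI conjI ballI)
      show "openin (top_of_set W) (W \<inter> ball x (min d (min e e')))" by blast
      show "x \<in> W \<inter> ball x (min d (min e e'))" using x d e e' by auto
      fix y assume y: "y \<in> W \<inter> ball x (min d (min e e'))"
      then obtain k where k: "R (min e e') x y k" using d(2)[of y] assms(4) by auto
      have "T y = T x \<otimes> k" "T' y = T' x \<otimes> k"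
        using y e(2)[of y k] e'(2)[of y k] R_mono[OF k, of e] R_mono[OF k, of e'] by auto
      then show "(T x = T' x) = (T y = T' y)" using T R_carrier[OF k] by simp
    qed
  qed auto
  then show ?thesis using assms(6) by blast
qed

text \<open>Near a point outside a closed set, the requirement on the points of that set is
  vacuous.\<close>

lemma parallel_glue:
  assumes A: "closed A" "parallel A T" and B: "closed B" "parallel B T'"
    and agree: "\<And>z. z \<in> A \<inter> B \<Longrightarrow> T z = T' z"
  shows "parallel (A \<union> B) (\<lambda>z. if z \<in> A then T z else T' z)" (is "parallel _ ?U")
proof -
  have ex: "\<exists>e>0. \<forall>b\<in>A. dist a b < e \<longrightarrow> (\<forall>k. R e a b k \<longrightarrow> T b = T a \<otimes> k)"
    if A: "closed A" "parallel A T" and a: "a \<in> A \<or> a \<notin> A" for A T a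
  proof (cases "a \<in> A")
    case True
    then show ?thesis using A unfolding parallel_def by auto
  next
    case False
    then obtain e where "e > 0" "ball a e \<subseteq> - A"
      using A(1) by (meson open_contains_ball open_Compl ComplI)
    then show ?thesis by (intro exI[of _ e]) auto
  qed
  have "\<exists>e>0. \<forall>b\<in>A\<union>B. dist a b < e \<longrightarrow> (\<forall>k. R e a b k \<longrightarrow> ?U b = ?U a \<otimes> k)" if a: "a \<in> A \<union> B" for a
  proof -
    obtain e where e: "e > 0" "\<And>b k. b \<in> A \<Longrightarrow> dist a b < e \<Longrightarrow> R e a b k \<Longrightarrow> T b = T a \<otimes> k"
      using ex[OF A] by blast
    obtain e' where e': "e' > 0" "\<And>b k. b \<in> B \<Longrightarrow> dist a b < e' \<Longrightarrow> R e' a b k \<Longrightarrow> T' b = T' a \<otimes> k"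
      using ex[OF B] by blast
    obtain d where d: "d > 0" "a \<in> A \<or> ball a d \<inter> A = {}"
      using A(1) by (metis open_contains_ball open_Compl ComplI disjoint_eq_subset_Compl zero_less_one)
    obtain d' where d': "d' > 0" "a \<in> B \<or> ball a d' \<inter> B = {}"
      using B(1) by (metis open_contains_ball open_Compl ComplI disjoint_eq_subset_Compl zero_less_one)
    let ?e = "min (min e e') (min d d')"
    show ?thesis
    proof (intro exI[of _ ?e] conjI ballI allI impI)
      show "0 < ?e" using e e' d d' by simp
      fix b k assume b: "b \<in> A \<union> B" "dist a b < ?e" and k: "R ?e a b k"
      have inA: "a \<in> A" "?U b = ?U a \<otimes> k" if "b \<in> A"
      proof -
        show "a \<in> A" using d b that by (force simp: disjoint_iff)
        then show "?U b = ?U a \<otimes> k" using e(2)[OF that] b R_mono[OF k, of e] that by simp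
      qed
      have inB: "?U b = ?U a \<otimes> k" if "b \<in> B" "b \<notin> A"
      proof -
        have "a \<in> B" using d' b that by (force simp: disjoint_iff)
        then have "?U a = T' a" using agree[of a] by simp
        then show ?thesis using e'(2)[OF that(1)] b R_mono[OF k, of e'] that by simp
      qed
      show "?U b = ?U a \<otimes> k" using inA inB b by blast
    qed
  qed
  then show ?thesis using A(2) B(2) unfolding parallel_def by (auto simp: Pi_iff)
qed

text \<open>A left factor makes the functions agree at one point of the overlap, hence on all of it
  by connectedness.\<close>

lemma parallel_union_ex:
  assumes A: "closed A" "\<exists>T. parallel A T" and B: "closed B" "\<exists>T. parallel B T"
    and "connected (A \<inter> B)" "A \<union> B \<subseteq> D"
  shows "\<exists>T. parallel (A \<union> B) T"
proof -
  obtain T T' where T: "parallel A T" "parallel B T'" using A B by auto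
  show ?thesis
  proof (cases "A \<inter> B = {}")
    case True
    then show ?thesis using parallel_glue[OF A(1) T(1) B(1) T(2)] by auto
  next
    case False
    then obtain a where a: "a \<in> A \<inter> B" by auto
    then have c: "T a \<in> carrier K" "T' a \<in> carrier K" using T unfolding parallel_def by auto
    let ?T' = "\<lambda>z. (T a \<otimes> inv (T' a)) \<otimes> T' z"
    have T': "parallel B ?T'" using T c by (intro parallel_mult_left) auto
    have "T z = ?T' z" if "z \<in> A \<inter> B" for z
    proof (rule parallel_unique[where T = T and T' = ?T' and W = "A \<inter> B" and a = a])
      show "T a = ?T' a" using c by (simp add: m_assoc)
    qed (use parallel_subset[OF T(1)] parallel_subset[OF T'] assms a that in auto)
    then show ?thesis using parallel_glue[OF A(1) T(1) B(1) T'] by blast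
  qed
qed

text \<open>Consecutive slabs meet exactly in a level set of \<open>f\<close>, so they can be glued;
  by boundedness finitely many cover \<open>C\<close>.\<close>

lemma parallel_slabs_ex:
  fixes f :: "'a \<Rightarrow> real"
  assumes C: "closed C" "C \<subseteq> D" "bounded (f ` C)"
    and f: "\<And>a b. closed (C \<inter> f -` {a..b})" "\<And>c. connected (C \<inter> f -` {c})"
    and h: "h > 0" "\<And>s. \<exists>T. parallel (C \<inter> f -` {s..s+h}) T"
  shows "\<exists>T. parallel C T"
proof -
  have slab: "\<exists>T. parallel (C \<inter> f -` {s..s + real n * h}) T" for s n
  proof (induction n)
    case 0
    have "C \<inter> f -` {s..s + real 0 * h} \<subseteq> C \<inter> f -` {s..s+h}" using h by auto
    then show ?case using h(2)[of s] parallel_subset by metis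
  next
    case (Suc n)
    let ?A = "C \<inter> f -` {s..s + real n * h}"
    let ?B = "C \<inter> f -` {s + real n * h..s + real n * h + h}"
    have nh: "0 \<le> real n * h" using h by simp
    define w where "w = s + real n * h"
    have w: "s \<le> w" "w \<le> w + h" "s + real (Suc n) * h = w + h"
      using h(1) nh by (auto simp: w_def algebra_simps)
    have "?A \<union> ?B = C \<inter> f -` {s..s + real (Suc n) * h}"
      unfolding w(3) w_def[symmetric] using w(1,2) by auto
    moreover have "?A \<inter> ?B = C \<inter> f -` {w}"
      unfolding w_def[symmetric] using w(1,2) by auto
    moreover have "\<exists>T. parallel (?A \<union> ?B) T"
    proof (rule parallel_union_ex)
      show "connected (?A \<inter> ?B)" using f(2) calculation(2) by (simp only:)
      show "?A \<union> ?B \<subseteq> D" using C(2) by blast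
    qed (use f Suc h(2) in blast)+
    ultimately show ?case by (simp only:)
  qed
  obtain B where B: "\<And>z. z \<in> C \<Longrightarrow> \<bar>f z\<bar> \<le> B" using C(3) by (auto simp: bounded_iff)
  obtain n :: nat where n: "2 * B / h < real n" using reals_Archimedean2 by blast
  have "C \<inter> f -` {-B..-B + real n * h} = C"
  proof -
    have "2 * B < real n * h" using n h by (simp add: field_simps)
    then have "f z \<in> {-B..-B + real n * h}" if "z \<in> C" for z using B[OF that] by (simp add: abs_le_iff)
    then show ?thesis by blast
  qed
  then show ?thesis using slab[of "-B" n] by simp
qed

end


section \<open>Trivial monodromy over compact convex sets in the plane\<close>

locale planar_transport = transport K R D for K :: "('k, 'm) monoid_scheme" (structure) and R and D :: "complex set" +
  assumes D: "compact D" "convex D"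
    and local: "\<And>a. a \<in> D \<Longrightarrow> \<exists>d>0. \<exists>T. parallel (D \<inter> ball a d) T"
begin

text \<open>A Lebesgue number for the local solutions gives a grid of small squares. These are glued
  along horizontal segments to vertical strips, and the strips along vertical segments; convexity
  makes all overlaps connected.\<close>

lemma parallel_ex: "\<exists>T. parallel D T"
proof (cases "D = {}")
  case True
  then show ?thesis by (auto simp: parallel_def)
next
  case False
  obtain d where d: "\<And>a. a \<in> D \<Longrightarrow> d a > 0 \<and> (\<exists>T. parallel (D \<inter> ball a (d a)) T)"
    using local by metis
  obtain \<delta> where \<delta>: "0 < \<delta>"
    "\<And>V. V \<subseteq> D \<Longrightarrow> diameter V < \<delta> \<Longrightarrow> \<exists>B \<in> (\<lambda>a. ball a (d a)) ` D. V \<subseteq> B"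
    using Lebesgue_number_lemma[OF D(1), of "(\<lambda>a. ball a (d a)) ` D"] False d
    by (smt (verit, best) UN_iff centre_in_ball image_iff image_is_empty open_ball subsetI)
  have small: "\<exists>T. parallel V T" if V: "V \<subseteq> D" "diameter V < \<delta>" for V
  proof -
    obtain a where "a \<in> D" "V \<subseteq> D \<inter> ball a (d a)" using \<delta>(2)[OF V] V(1) by auto
    then show ?thesis using d parallel_subset by metis
  qed
  \<comment> \<open>A square of side \<open>h\<close> has diameter at most \<open>2 * h\<close>,
    which is less than \<delta>.\<close>
  define h where "h = \<delta> / 4"
  have h: "h > 0" using \<delta> by (simp add: h_def)
  have Re_conv: "convex (Re -` {a..b})" "convex (Im -` {a..b})"
    and Re_cl: "closed (Re -` {a..b})" "closed (Im -` {a..b})" for a b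
    by (intro convex_linear_vimage closed_vimage convex_real_interval bounded_linear.linear
        bounded_linear_Re bounded_linear_Im continuous_intros closed_real_atLeastAtMost)+
  have Dcl: "closed D" using D compact_imp_closed by blast
  have bdd: "bounded (f ` V)" if "V \<subseteq> D" "\<And>z. \<bar>f z\<bar> \<le> norm z" for V and f :: "complex \<Rightarrow> real"
  proof -
    obtain B where "\<And>z. z \<in> D \<Longrightarrow> norm z \<le> B" using D(1) compact_imp_bounded bounded_iff by metis
    then have "norm (f z) \<le> B" if "z \<in> V" for z
      using that \<open>V \<subseteq> D\<close> \<open>\<And>z. \<bar>f z\<bar> \<le> norm z\<close>[of z] by (metis order_trans real_norm_def subsetD)
    then show ?thesis unfolding bounded_iff by blast
  qed
  have single: "f -` {c} = f -` {c..c}" for f :: "complex \<Rightarrow> real" and c by auto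
  have strip: "\<exists>T. parallel (D \<inter> Re -` {s..s+h}) T" for s
  proof (rule parallel_slabs_ex[where f = Im and h = h])
    fix t
    let ?V = "D \<inter> Re -` {s..s+h} \<inter> Im -` {t..t+h}"
    have "diameter ?V \<le> 2 * h"
    proof (rule diameter_le)
      show "?V \<noteq> {} \<or> 0 \<le> 2 * h" using h by simp
      fix x y assume "x \<in> ?V" "y \<in> ?V"
      then have "\<bar>Re (x - y)\<bar> \<le> h" "\<bar>Im (x - y)\<bar> \<le> h" by auto
      then show "norm (x - y) \<le> 2 * h" using cmod_le[of "x - y"] by linarith
    qed
    then have "diameter ?V < \<delta>" using \<delta> by (simp add: h_def)
    then show "\<exists>T. parallel ?V T" by (intro small) auto
  next
    show "bounded (Im ` (D \<inter> Re -` {s..s+h}))" by (intro bdd) (auto simp: abs_Im_le_cmod)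
    show "connected (D \<inter> Re -` {s..s+h} \<inter> Im -` {c})" for c
      unfolding single by (intro convex_connected convex_Int D Re_conv)
    show "closed (D \<inter> Re -` {s..s+h} \<inter> Im -` {a..b})" for a b
      by (intro closed_Int Dcl Re_cl)
  qed (use h Dcl Re_cl in auto)
  show ?thesis
  proof (rule parallel_slabs_ex[where f = Re and h = h])
    show "bounded (Re ` D)" by (intro bdd) (auto simp: abs_Re_le_cmod)
    show "connected (D \<inter> Re -` {c})" for c
      unfolding single by (intro convex_connected convex_Int D Re_conv)
  qed (use h Dcl Re_cl strip in auto)
qed

end

section \<open>Surfaces and quarter circles\<close>

lemma surface_chart:
  assumes "surface S" "x \<in> topspace S"
  obtains U \<phi> \<phi>' where "openin S U" "x \<in> U"
    "homeomorphic_maps (subtopology S U) (euclidean :: (real^2) topology) \<phi> \<phi>'"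
proof -
  obtain U where "openin S U" "x \<in> U" "subtopology S U homeomorphic_space (euclidean :: (real^2) topology)"
    using assms unfolding surface_def by blast
  then show ?thesis using that unfolding homeomorphic_space_def by blast
qed

text \<open>Invariance of domain, read in a chart around each image point.\<close>

lemma surface_open_image:
  fixes \<Psi> :: "complex \<Rightarrow> 'a"
  assumes S: "surface S" and R: "open R" and cont: "continuous_map (top_of_set R) S \<Psi>"
    and inj: "inj_on \<Psi> R"
  shows "openin S (\<Psi> ` R)"
proof (subst openin_subopen, intro ballI)
  fix y assume "y \<in> \<Psi> ` R"
  then obtain z where z: "z \<in> R" "y = \<Psi> z" by auto
  have "y \<in> topspace S" using z continuous_map_image_subset_topspace[OF cont] by auto
  then obtain U \<phi> \<phi>' where U: "openin S U" "y \<in> U"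
    "homeomorphic_maps (subtopology S U) (euclidean :: (real^2) topology) \<phi> \<phi>'"
    using surface_chart[OF S] by metis
  have UT: "topspace (subtopology S U) = U" by (rule topspace_subtopology_subset[OF openin_subset[OF U(1)]])
  have \<phi>: "continuous_map (subtopology S U) euclidean \<phi>" "\<And>x. x \<in> U \<Longrightarrow> \<phi>' (\<phi> x) = x"
    using U(3) UT by (auto simp: homeomorphic_maps_def)
  define R' where "R' = {x \<in> R. \<Psi> x \<in> U}"
  have "openin (top_of_set R) R'"
    using openin_continuous_map_preimage[OF cont U(1)] by (simp add: R'_def)
  then have oR': "open R'" using R openin_open_eq by blast
  have "continuous_map (top_of_set R') (subtopology S U) \<Psi>"
    using cont by (auto simp: continuous_map_in_subtopology R'_def intro: continuous_map_from_subtopology_mono)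
  from continuous_map_compose[OF this \<phi>(1)]
  have "continuous_on R' (\<phi> \<circ> \<Psi>)" by (simp add: continuous_map_iff_continuous)
  moreover have "inj_on (\<phi> \<circ> \<Psi>) R'"
    by (rule inj_onI) (metis (mono_tags, lifting) R'_def \<phi>(2) comp_apply inj inj_onD mem_Collect_eq)
  ultimately have op: "open ((\<phi> \<circ> \<Psi>) ` R')"
    by (intro invariance_of_domain_gen oR') auto
  have "{x \<in> U. \<phi> x \<in> (\<phi> \<circ> \<Psi>) ` R'} = \<Psi> ` R'"
  proof
    show "{x \<in> U. \<phi> x \<in> (\<phi> \<circ> \<Psi>) ` R'} \<subseteq> \<Psi> ` R'"
    proof
      fix x assume "x \<in> {x \<in> U. \<phi> x \<in> (\<phi> \<circ> \<Psi>) ` R'}"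
      then obtain r where "x \<in> U" "r \<in> R'" "\<phi> x = \<phi> (\<Psi> r)" by auto
      then show "x \<in> \<Psi> ` R'" using \<phi>(2) R'_def by (metis (mono_tags, lifting) image_eqI mem_Collect_eq)
    qed
  qed (auto simp: R'_def)
  then have "openin (subtopology S U) (\<Psi> ` R')"
    using openin_continuous_map_preimage[OF \<phi>(1), of "(\<phi> \<circ> \<Psi>) ` R'"] op unfolding UT by simp
  then have "openin S (\<Psi> ` R')" using U(1) openin_trans_full by blast
  moreover have "y \<in> \<Psi> ` R'" using z U(2) by (auto simp: R'_def)
  moreover have "\<Psi> ` R' \<subseteq> \<Psi> ` R" by (auto simp: R'_def)
  ultimately show "\<exists>T. openin S T \<and> y \<in> T \<and> T \<subseteq> \<Psi> ` R" by blast
qed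

text \<open>Invariance of domain again, with the plane now as target. It shows later that an open
  part of a surface fits neither into an arc nor into a half-disc with its boundary.\<close>

lemma surface_open_coordinates:
  fixes p :: "'a \<Rightarrow> complex"
  assumes S: "surface S" and V: "openin S V" and cont: "continuous_map (subtopology S V) euclidean p"
    and inj: "inj_on p V"
  shows "open (p ` V)"
proof (subst openin_subopen[of euclidean, simplified], intro ballI)
  fix y assume "y \<in> p ` V"
  then obtain x where x: "x \<in> V" "y = p x" by auto
  have "x \<in> topspace S" using x V openin_subset by blast
  then obtain U \<phi> \<phi>' where U: "openin S U" "x \<in> U"
    "homeomorphic_maps (subtopology S U) (euclidean :: (real^2) topology) \<phi> \<phi>'"
    using surface_chart[OF S] by metis
  have UT: "topspace (subtopology S U) = U" by (rule topspace_subtopology_subset[OF openin_subset[OF U(1)]])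
  have \<phi>': "continuous_map euclidean (subtopology S U) \<phi>'" "\<And>x. x \<in> U \<Longrightarrow> \<phi>' (\<phi> x) = x" "\<And>z. \<phi> (\<phi>' z) = z"
    using U(3) UT by (auto simp: homeomorphic_maps_def)
  define Q where "Q = {z. \<phi>' z \<in> V}"
  have "continuous_map euclidean S \<phi>'" using \<phi>'(1) continuous_map_in_subtopology by blast
  from openin_continuous_map_preimage[OF this V] have oQ: "open Q" by (simp add: Q_def)
  have "continuous_map (top_of_set Q) (subtopology S V) \<phi>'"
    using \<open>continuous_map euclidean S \<phi>'\<close>
    by (auto simp: continuous_map_in_subtopology Q_def continuous_map_from_subtopology)
  from continuous_map_compose[OF this cont]
  have "continuous_on Q (p \<circ> \<phi>')" by (simp add: continuous_map_iff_continuous)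
  moreover have "inj_on (p \<circ> \<phi>') Q"
    by (rule inj_onI) (metis (mono_tags, lifting) Q_def \<phi>'(3) comp_apply inj inj_onD mem_Collect_eq)
  ultimately have op: "open ((p \<circ> \<phi>') ` Q)"
    by (intro invariance_of_domain_gen oQ) auto
  moreover have "\<phi> x \<in> Q" using x U \<phi>' by (simp add: Q_def)
  then have "y \<in> (p \<circ> \<phi>') ` Q" using x U \<phi>' by (metis comp_apply image_eqI)
  moreover have "(p \<circ> \<phi>') ` Q \<subseteq> p ` V" by (auto simp: Q_def)
  ultimately show "\<exists>T. open T \<and> y \<in> T \<and> T \<subseteq> p ` V" by blast
qed

abbreviation disc :: "complex set" where "disc \<equiv> cball 0 1"

section \<open>Quarter circles and the quadrants behind them\<close>

definition side :: "nat \<Rightarrow> real \<Rightarrow> complex" where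
  "side k t = cis (2 * pi * (real k + t) / 4)"

lemma norm_side [simp]: "norm (side k t) = 1" by (simp add: side_def)

lemma side_eq: "side k t = \<i> ^ k * cis (pi * t / 2)"
proof -
  have "side k t = cis (real k * (pi / 2) + pi * t / 2)" 
    unfolding side_def by (rule arg_cong[of _ _ cis]) (simp add: field_simps)
  also have "\<dots> = cis (pi / 2) ^ k * cis (pi * t / 2)" 
    by (simp only: Complex.DeMoivre cis_mult)
  finally show ?thesis by simp
qed

lemma side_0: "side k 0 = \<i> ^ k" by (simp add: side_eq)

lemma side_1: "side k 1 = side (Suc k) 0" by (simp add: side_def add.commute)

lemma i4: "\<i> ^ 4 = 1" by (simp add: numeral_eq_Suc)

lemma continuous_on_side [continuous_intros]:
  "continuous_on A f \<Longrightarrow> continuous_on A (\<lambda>x. side k (f x))"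
  unfolding side_def by (intro continuous_intros) auto

lemma Arg2pi_side: "k < 4 \<Longrightarrow> 0 \<le> t \<Longrightarrow> t < 1 \<Longrightarrow> Arg2pi (side k t) = pi * (real k + t) / 2"
proof (rule Arg2pi_unique[of 1])
  assume a: "k < 4" "0 \<le> t" "t < 1"
  then have "real k + t < 4" by linarith
  then show "pi * (real k + t) / 2 < 2 * pi" by simp
qed (auto simp: side_def cis_conv_exp)

lemma side_inj:
  assumes "k < 4" "0 \<le> t" "t < 1" "k' < 4" "0 \<le> t'" "t' < 1" "side k t = side k' t'"
  shows "k = k' \<and> t = t'"
proof -
  have "real k + t = real k' + t'"
    using Arg2pi_side[OF assms(1-3)] Arg2pi_side[OF assms(4-6)] assms(7) by simp
  moreover from this have "k = k'" using assms by linarith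
  ultimately show ?thesis by simp
qed

lemma sphere_side:
  assumes "norm z = 1"
  obtains k t where "k < 4" "0 \<le> t" "t < 1" "z = side k t"
proof -
  define p where "p = 2 * Arg2pi z / pi"
  have p: "0 \<le> p" "p < 4" using Arg2pi[of z] by (auto simp: p_def field_simps)
  define k where "k = nat \<lfloor>p\<rfloor>"
  show thesis
  proof (rule that[of k "p - real k"])
    show "k < 4" "0 \<le> p - real k" "p - real k < 1" using p by (auto simp: k_def) linarith+
    show "z = side k (p - real k)"
      using Arg2pi_eq[of z] assms by (simp add: side_def p_def cis_conv_exp)
  qed
qed

text \<open>The open quadrant spanned by side \<open>k\<close>. It contains the open side with all
  nearby points of the disc, and so tells sides apart also for points off the circle.\<close>

definition sector :: "nat \<Rightarrow> complex set" where
  "sector k = {z. 0 < Re (z * cnj (\<i> ^ k)) \<and> 0 < Im (z * cnj (\<i> ^ k))}"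

lemma less_4_cases: "(k::nat) < 4 \<Longrightarrow> k = 0 \<or> k = 1 \<or> k = 2 \<or> k = 3" by linarith

lemma i_pow: "\<i> ^ 0 = 1" "\<i> ^ 1 = \<i>" "\<i> ^ 2 = -1" "\<i> ^ 3 = -\<i>"
  by (simp_all add: numeral_eq_Suc)

lemma sector_disjoint: "j < 4 \<Longrightarrow> k < 4 \<Longrightarrow> z \<in> sector j \<Longrightarrow> z \<in> sector k \<Longrightarrow> j = k"
  by (drule less_4_cases, drule less_4_cases, elim disjE) (auto simp: sector_def i_pow)

lemma open_sector: "open (sector k)"
proof -
  have "sector k = (\<lambda>z. Re (z * cnj (\<i> ^ k))) -` {0<..} \<inter> (\<lambda>z. Im (z * cnj (\<i> ^ k))) -` {0<..}"
    by (auto simp: sector_def)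
  then show ?thesis by (auto intro!: open_Int open_vimage continuous_intros)
qed

lemma i_unit: "\<i> ^ k * cnj (\<i> ^ k) = 1"
  by (simp add: power_mult_distrib[symmetric])

lemma scaled_side_in_sector:
  assumes "0 < r" "0 < t" "t < 1"
  shows "of_real r * side k t \<in> sector k"
proof -
  have "of_real r * side k t * cnj (\<i> ^ k) = of_real r * cis (pi * t / 2) * (\<i> ^ k * cnj (\<i> ^ k))"
    by (simp add: side_eq mult_ac)
  then have "of_real r * side k t * cnj (\<i> ^ k) = of_real r * cis (pi * t / 2)"
    by (simp only: i_unit mult_1_right)
  moreover have "0 < cos (pi * t / 2)" "0 < sin (pi * t / 2)"
    using assms by (auto intro!: cos_gt_zero_pi sin_gt_zero simp: field_simps)
       (smt (verit) mult_pos_pos pi_gt_zero mult_less_cancel_left2)+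
  ultimately show ?thesis using assms unfolding sector_def mem_Collect_eq by (simp only: Re_complex_of_real Im_complex_of_real times_complex.sel cis.sel) simp
qed

lemma side_in_sector: "0 < t \<Longrightarrow> t < 1 \<Longrightarrow> side k t \<in> sector k"
  using scaled_side_in_sector[of 1 t k] by simp

lemma corner_not_in_sector: "j < 4 \<Longrightarrow> k < 4 \<Longrightarrow> side j 0 \<notin> sector k"
  by (drule less_4_cases, drule less_4_cases, elim disjE) (auto simp: sector_def side_0 i_pow)

lemma side_sector_iff:
  assumes "j < 4" "k < 4" "0 \<le> t" "t < 1"
  shows "side j t \<in> sector k \<longleftrightarrow> j = k \<and> 0 < t"
  using assms corner_not_in_sector[of j k] side_in_sector[of t j] sector_disjoint[of j k "side j t"]
  by (cases "t = 0") auto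

text \<open>One coordinate of the corner is \<open>1\<close> or \<open>-1\<close>, and within
  distance \<open>1/2\<close> its sign is preserved; this leaves the two adjacent quadrants.\<close>

lemma sector_near_corner:
  assumes "j < 4" "k < 4" "z \<in> sector j" "dist z (side k 0) < 1/2"
  shows "j = k \<or> Suc j mod 4 = k"
proof -
  have "\<bar>Re z - Re (\<i> ^ k)\<bar> < 1/2" "\<bar>Im z - Im (\<i> ^ k)\<bar> < 1/2"
    using assms(4) abs_Re_le_cmod[of "z - \<i> ^ k"] abs_Im_le_cmod[of "z - \<i> ^ k"]
    by (auto simp: dist_norm side_0)
  then show ?thesis
    using less_4_cases[OF assms(1)] less_4_cases[OF assms(2)] assms(3)
    by (elim disjE) (auto simp: sector_def i_pow)
qed

text \<open>The bound \<open>1\<close> is the sum of two radii \<open>1/2\<close>, the scale used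
  around vertices.\<close>

lemma corners_apart:
  assumes "j < 4" "k < 4" "dist (side j 0) (side k 0) < 1"
  shows "j = k"
proof -
  have "\<bar>Re (\<i> ^ j) - Re (\<i> ^ k)\<bar> < 1" "\<bar>Im (\<i> ^ j) - Im (\<i> ^ k)\<bar> < 1"
    using assms(3) abs_Re_le_cmod[of "\<i> ^ j - \<i> ^ k"] abs_Im_le_cmod[of "\<i> ^ j - \<i> ^ k"]
    by (auto simp: dist_norm side_0)
  then show ?thesis
    using less_4_cases[OF assms(1)] less_4_cases[OF assms(2)]
    by (elim disjE) (auto simp: i_pow)
qed

section \<open>Quadrangulated surfaces\<close>

locale quadrangulated_surface =
  fixes S :: "'a topology" and G :: "('a, 'e) drawing"
    and W :: "'a set \<Rightarrow> ('e \<times> bool) list" and \<Phi> :: "'a set \<Rightarrow> complex \<Rightarrow> 'a"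
  assumes surf: "surface S" and emb: "embedded_graph S G"
    and W_len: "\<And>f. f \<in> faces S G \<Longrightarrow> length (W f) = 4"
    and W_edges: "\<And>f. f \<in> faces S G \<Longrightarrow> fst ` set (W f) \<subseteq> edges G"
    and Phi_cont: "\<And>f. f \<in> faces S G \<Longrightarrow> continuous_map (top_of_set disc) S (\<Phi> f)"
    and Phi_homeo: "\<And>f. f \<in> faces S G \<Longrightarrow>
      homeomorphic_map (top_of_set (ball 0 1)) (subtopology S f) (\<Phi> f)"
    and Phi_step: "\<And>f k t. f \<in> faces S G \<Longrightarrow> k < 4 \<Longrightarrow> t \<in> {0..1} \<Longrightarrow>
      \<Phi> f (side k t) = step_path G (W f ! k) t"
begin

abbreviation F where "F \<equiv> faces S G"

definition skel :: "'a set" where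
  "skel = verts G \<union> (\<Union>e\<in>edges G. curve G e ` {0..1})"

definition dirpar :: "bool \<Rightarrow> real \<Rightarrow> real" where "dirpar b t = (if b then t else 1 - t)"

lemma Haus: "Hausdorff_space S" using surf by (simp add: surface_def)

lemma curve_embedding: "e \<in> edges G \<Longrightarrow> embedding_map (top_of_set {0..1}) S (curve G e)"
  and fin_verts: "finite (verts G)" and fin_edges: "finite (edges G)" and verts_top: "verts G \<subseteq> topspace S"
  and curve_ends: "e \<in> edges G \<Longrightarrow> curve G e 0 \<in> verts G" "e \<in> edges G \<Longrightarrow> curve G e 1 \<in> verts G"
  and curve_interior: "e \<in> edges G \<Longrightarrow> 0 < t \<Longrightarrow> t < 1 \<Longrightarrow> curve G e t \<notin> verts G"
  and curves_disjoint: "e \<in> edges G \<Longrightarrow> e' \<in> edges G \<Longrightarrow> e \<noteq> e' \<Longrightarrow>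
     curve G e ` {0<..<1} \<inter> curve G e' ` {0<..<1} = {}"
  using emb unfolding embedded_graph_def by (auto simp: disjoint_iff)

lemma curve_inj: "e \<in> edges G \<Longrightarrow> inj_on (curve G e) {0..1}"
  and curve_cont: "e \<in> edges G \<Longrightarrow> continuous_map (top_of_set {0..1}) S (curve G e)"
  using curve_embedding[of e] unfolding embedding_map_def
  by (auto simp: homeomorphic_eq_everything_map continuous_map_in_subtopology)

lemma curve_top: "e \<in> edges G \<Longrightarrow> t \<in> {0..1} \<Longrightarrow> curve G e t \<in> topspace S"
  using continuous_map_image_subset_topspace[OF curve_cont[of e]] by auto

lemma curve_eq:
  assumes "e \<in> edges G" "e' \<in> edges G" "0 < t" "t < 1" "t' \<in> {0..1}" "curve G e t = curve G e' t'"
  shows "e' = e \<and> t' = t"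
proof -
  have "t' \<noteq> 0" "t' \<noteq> 1" using curve_interior[OF assms(1,3,4)] curve_ends[OF assms(2)] assms(6) by auto
  then have t': "0 < t'" "t' < 1" using assms(5) by auto
  then have "e' = e" using curves_disjoint[of e e'] assms by fastforce
  moreover from this have "t' = t"
    using inj_onD[OF curve_inj[OF assms(1)], of t t'] assms by auto
  ultimately show ?thesis by simp
qed

lemma curve_ends_ne: "e \<in> edges G \<Longrightarrow> curve G e 0 \<noteq> curve G e 1"
  using inj_onD[OF curve_inj, of e 0 1] by auto

lemma closed_image:
  assumes "continuous_map (top_of_set A) S p" "compact A"
  shows "closedin S (p ` A)"
proof -
  have "compactin S (p ` A)"
    using image_compactin[OF _ assms(1), of A] assms(2) by (simp add: compactin_subtopology)
  then show ?thesis using Haus compactin_imp_closedin by blast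
qed

lemma closed_curve: "e \<in> edges G \<Longrightarrow> closedin S (curve G e ` {0..1})"
  using closed_image[OF curve_cont] by simp

lemma closed_verts: "V \<subseteq> verts G \<Longrightarrow> closedin S V"
  using Hausdorff_imp_t1_space[OF Haus] fin_verts verts_top
  by (meson dual_order.trans finite_subset t1_space_closedin_finite)

lemma face_sub: "f \<in> F \<Longrightarrow> f \<subseteq> topspace S - skel"
  using connected_components_of_subset unfolding faces_def skel_def by fastforce

lemma face_disj: "f \<in> F \<Longrightarrow> f' \<in> F \<Longrightarrow> x \<in> f \<Longrightarrow> x \<in> f' \<Longrightarrow> f = f'"
  unfolding faces_def using pairwise_disjoint_connected_components_of
  by (metis connected_components_of_overlap disjoint_iff)

lemma face_Union: "\<Union>F = topspace S - skel"
  unfolding faces_def skel_def Union_connected_components_of by auto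

lemma Phi_ball: "f \<in> F \<Longrightarrow> \<Phi> f ` ball 0 1 = f"
  using homeomorphic_imp_surjective_map[OF Phi_homeo, of f] face_sub[of f] by (auto simp: topspace_subtopology)

lemma Phi_inj: "f \<in> F \<Longrightarrow> inj_on (\<Phi> f) (ball 0 1)"
  using homeomorphic_imp_injective_map[OF Phi_homeo, of f] by simp

lemma Phi_top: "f \<in> F \<Longrightarrow> y \<in> disc \<Longrightarrow> \<Phi> f y \<in> topspace S"
  using continuous_map_image_subset_topspace[OF Phi_cont, of f] by auto

lemma W_edge: "f \<in> F \<Longrightarrow> k < 4 \<Longrightarrow> fst (W f ! k) \<in> edges G"
  using W_edges[of f] W_len[of f] nth_mem[of k "W f"] by auto

lemma Phi_side:
  assumes "f \<in> F" "k < 4" "t \<in> {0..1}"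
  shows "\<Phi> f (side k t) = curve G (fst (W f ! k)) (dirpar (snd (W f ! k)) t)"
  using Phi_step[OF assms] by (simp add: step_path_def dirpar_def)

lemma dirpar_in [simp]: "dirpar b t \<in> {0..1} \<longleftrightarrow> t \<in> {0..1}" "0 \<le> dirpar b t \<and> dirpar b t \<le> 1 \<longleftrightarrow> 0 \<le> t \<and> t \<le> 1"
  and dirpar_pos: "0 < t \<Longrightarrow> t < 1 \<Longrightarrow> 0 < dirpar b t" "0 < t \<Longrightarrow> t < 1 \<Longrightarrow> dirpar b t < 1"
  and dirpar_inj [simp]: "dirpar b t = dirpar b t' \<longleftrightarrow> t = t'" and dirpar_dirpar [simp]: "dirpar b (dirpar b t) = t"
  by (auto simp: dirpar_def)

lemma Phi_sphere:
  assumes "f \<in> F" "norm y = 1"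
  shows "\<Phi> f y \<in> skel"
proof -
  obtain k t where "k < 4" "0 \<le> t" "t < 1" "y = side k t" using sphere_side[OF assms(2)] .
  then show ?thesis using Phi_side[OF assms(1), of k t] W_edge[OF assms(1), of k] unfolding skel_def by force
qed

lemma Phi_skel_iff:
  assumes "f \<in> F" "y \<in> disc"
  shows "\<Phi> f y \<in> skel \<longleftrightarrow> norm y = 1"
proof
  assume "\<Phi> f y \<in> skel"
  then have "\<Phi> f y \<notin> f" using face_sub[OF assms(1)] by auto
  then have "y \<notin> ball 0 1" using Phi_ball[OF assms(1)] by auto
  then show "norm y = 1" using assms(2) by auto
qed (use Phi_sphere assms in auto)

lemma Phi_eq_interior:
  assumes "f \<in> F" "f' \<in> F" "norm y < 1" "y' \<in> disc" "\<Phi> f y = \<Phi> f' y'"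
  shows "f' = f \<and> y' = y"
proof -
  have "\<Phi> f y \<notin> skel" using Phi_skel_iff[of f y] assms by auto
  then have "norm y' < 1" using Phi_skel_iff[of f' y'] assms by fastforce
  then have "\<Phi> f y \<in> f" "\<Phi> f y \<in> f'"
    using Phi_ball[OF assms(1)] Phi_ball[OF assms(2)] assms(3,5) by (metis image_eqI mem_ball_0)+
  then have "f' = f" using face_disj assms by blast
  then show ?thesis using inj_onD[OF Phi_inj[of f], of y' y] assms \<open>norm y' < 1\<close> by auto
qed

section \<open>Every edge has exactly two sides\<close>

definition places :: "'e \<Rightarrow> ('a set \<times> nat) set" where
  "places e = {(f, i). f \<in> F \<and> i < 4 \<and> fst (W f ! i) = e}"

text \<open>Coordinates of the closed half-disc that the face \<open>f\<close> attaches along its side \<open>i\<close>: the real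
  part is the parameter of the edge, the imaginary part the distance from the boundary circle.\<close>

definition page :: "'a set \<Rightarrow> nat \<Rightarrow> complex \<Rightarrow> 'a" where
  "page f i z = \<Phi> f (of_real (1 - Im z) * side i (dirpar (snd (W f ! i)) (Re z)))"

lemma page_edge: "(f, i) \<in> places e \<Longrightarrow> Re z \<in> {0..1} \<Longrightarrow> Im z = 0 \<Longrightarrow> page f i z = curve G e (Re z)"
  unfolding page_def places_def using Phi_side[of f i "dirpar (snd (W f ! i)) (Re z)"] by auto

lemma page_arg:
  assumes "0 < Re z" "Re z < 1" "0 < Im z" "Im z < 1"
  shows "norm (of_real (1 - Im z) * side i (dirpar b (Re z))) < 1"
    "of_real (1 - Im z) * side i (dirpar b (Re z)) \<in> sector i"
  using assms scaled_side_in_sector[of "1 - Im z" "dirpar b (Re z)" i] dirpar_pos[of "Re z" b]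
  by (auto simp: norm_mult simp del: of_real_diff)

lemma page_skel:
  assumes "(f, i) \<in> places e" "0 < Re z" "Re z < 1" "0 < Im z" "Im z < 1"
  shows "page f i z \<notin> skel"
  using page_arg[OF assms(2-), of i "snd (W f ! i)"] assms(1) Phi_skel_iff
  unfolding page_def places_def by (auto simp: less_imp_le simp del: of_real_diff)

lemma page_inj:
  assumes "(f, i) \<in> places e" "0 < Re z" "Re z < 1" "0 < Im z" "Im z < 1"
    and "(f', i') \<in> places e" "0 < Re z'" "Re z' < 1" "0 < Im z'" "Im z' < 1"
    and eq: "page f i z = page f' i' z'"
  shows "(f', i') = (f, i) \<and> z' = z"
proof -
  let ?y = "of_real (1 - Im z) * side i (dirpar (snd (W f ! i)) (Re z))"
  let ?y' = "of_real (1 - Im z') * side i' (dirpar (snd (W f' ! i')) (Re z'))"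
  have F: "f \<in> F" "f' \<in> F" "i < 4" "i' < 4" using assms unfolding places_def by auto
  have "f' = f \<and> ?y' = ?y"
    using eq page_arg[OF assms(2-5), of i] page_arg[OF assms(7-10), of i']
    unfolding page_def by (intro Phi_eq_interior F) (auto simp: less_imp_le simp del: of_real_diff)
  then have ff: "f' = f" and yy: "?y' = ?y" by auto
  have ii: "i' = i"
    using page_arg(2)[OF assms(2-5), of i "snd (W f ! i)"] page_arg(2)[OF assms(7-10), of i' "snd (W f' ! i')"]
    unfolding yy by (intro sector_disjoint F)
  have "norm ?y' = norm ?y" using yy by simp
  then have im: "Im z' = Im z" using assms by (simp add: norm_mult del: of_real_diff)
  moreover have "side i (dirpar (snd (W f ! i)) (Re z')) = side i (dirpar (snd (W f ! i)) (Re z))"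
    using yy assms(5) unfolding ff ii im by simp
  then have "dirpar (snd (W f ! i)) (Re z') = dirpar (snd (W f ! i)) (Re z)"
    using side_inj[OF F(3) _ _ F(3)] dirpar_pos assms by (meson less_imp_le)
  ultimately show ?thesis using ff ii by (simp add: complex_eq_iff)
qed

lemma page_cont:
  assumes "(f, i) \<in> places e" "A \<subseteq> {z. Re z \<in> {0..1} \<and> Im z \<in> {0..1}}"
  shows "continuous_map (top_of_set A) S (page f i)"
proof -
  let ?p = "\<lambda>z. of_real (1 - Im z) * side i (dirpar (snd (W f ! i)) (Re z))"
  have "continuous_on A ?p"
    unfolding dirpar_def by (cases "snd (W f ! i)") (auto intro!: continuous_intros)
  moreover have "?p ` A \<subseteq> disc"
    using assms(2) by (auto simp: norm_mult subset_iff simp del: of_real_diff)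
  ultimately have "continuous_map (top_of_set A) (top_of_set disc) ?p"
    by (simp add: continuous_map_in_subtopology image_subset_iff_funcset)
  from continuous_map_compose[OF this Phi_cont]
  show ?thesis using assms(1) unfolding places_def page_def comp_def by auto
qed

text \<open>Two pages glued along the edge fill a neighborhood of its midpoint by invariance of
  domain, so points of a third page near the midpoint would lie in one of these two.\<close>

lemma no_three_places:
  assumes e: "e \<in> edges G" and p: "(f1, i1) \<in> places e" "(f2, i2) \<in> places e" "(f3, i3) \<in> places e"
    and ne: "(f1, i1) \<noteq> (f2, i2)" "(f1, i1) \<noteq> (f3, i3)" "(f2, i2) \<noteq> (f3, i3)"
  shows False
proof -
  define R where "R = {z. 0 < Re z \<and> Re z < 1 \<and> -1 < Im z \<and> Im z < 1}"
  \<comment> \<open>The second page is reflected to the lower half-plane. On the real axis both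
    pages use the parameter of the edge, so they agree whatever the directions of the sides.\<close>
  define \<Psi> where "\<Psi> = (\<lambda>z. if 0 \<le> Im z then page f1 i1 z else page f2 i2 (cnj z))"
  have "open R"
    unfolding R_def by (intro open_Collect_conj open_Collect_less continuous_intros)
  have cont: "continuous_map (top_of_set R) S \<Psi>"
    unfolding \<Psi>_def
  proof (rule continuous_map_cases_le)
    show "continuous_map (subtopology (top_of_set R) {x \<in> topspace (top_of_set R). 0 \<le> Im x}) S (page f1 i1)"
      unfolding subtopology_subtopology by (intro page_cont[OF p(1)]) (auto simp: R_def)
    have "continuous_map (top_of_set {x\<in>R. Im x \<le> 0}) (top_of_set {z. Re z \<in> {0..1} \<and> Im z \<in> {0..1}}) cnj"
      by (auto simp: continuous_map_in_subtopology R_def intro!: continuous_intros)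
    from continuous_map_compose[OF this page_cont[OF p(2) order_refl]]
    show "continuous_map (subtopology (top_of_set R) {x \<in> topspace (top_of_set R). Im x \<le> 0}) S (\<lambda>z. page f2 i2 (cnj z))"
      unfolding subtopology_subtopology comp_def by (simp add: Collect_conj_eq Int_absorb2 Int_assoc)
    show "page f1 i1 x = page f2 i2 (cnj x)" if "x \<in> topspace (top_of_set R)" "0 = Im x" for x
      using that page_edge[OF p(1), of x] page_edge[OF p(2), of "cnj x"] by (simp add: R_def)
  qed (auto intro!: continuous_intros)
  have onR: "(Im z = 0 \<and> \<Psi> z = curve G e (Re z) \<and> \<Psi> z \<in> skel) \<or> (\<exists>z' f i. (f, i) \<in> {(f1, i1), (f2, i2)} \<and>
      ((f, i) = (f1, i1) \<longleftrightarrow> 0 \<le> Im z) \<and> 0 < Re z' \<and> Re z' < 1 \<and> 0 < Im z' \<and> Im z' < 1 \<and>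
      \<Psi> z = page f i z' \<and> \<Psi> z \<notin> skel \<and> z = (if 0 \<le> Im z then z' else cnj z'))" if "z \<in> R" for z
  proof -
    consider "Im z = 0" | "Im z > 0" | "Im z < 0" by linarith
    then show ?thesis
    proof cases
      case 1
      moreover from this have "\<Psi> z = curve G e (Re z)"
        using that page_edge[OF p(1), of z] by (simp add: \<Psi>_def R_def)
      moreover have "curve G e (Re z) \<in> skel"
        using that e unfolding R_def skel_def by force
      ultimately show ?thesis by simp
    next
      case 2
      then show ?thesis using that page_skel[OF p(1), of z] ne(1)
        by (intro disjI2 exI[of _ z] exI[of _ f1] exI[of _ i1]) (auto simp: \<Psi>_def R_def)
    next
      case 3
      then show ?thesis using that page_skel[OF p(2), of "cnj z"] ne(1)
        by (intro disjI2 exI[of _ "cnj z"] exI[of _ f2] exI[of _ i2]) (auto simp: \<Psi>_def R_def)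
    qed
  qed
  have "inj_on \<Psi> R"
  proof (rule inj_onI)
    fix z z' assume z: "z \<in> R" "z' \<in> R" "\<Psi> z = \<Psi> z'"
    show "z = z'"
    proof (cases "\<Psi> z \<in> skel")
      case True
      then have "Im z = 0" "Im z' = 0" "curve G e (Re z) = curve G e (Re z')"
        using onR[OF z(1)] onR[OF z(2)] z(3) by auto
      then show ?thesis using z(1,2) inj_onD[OF curve_inj[OF e], of "Re z" "Re z'"]
        by (auto simp: R_def complex_eq_iff)
    next
      case False
      then obtain w f i where w: "(f, i) \<in> {(f1, i1), (f2, i2)}" "(f, i) = (f1, i1) \<longleftrightarrow> 0 \<le> Im z"
        "0 < Re w" "Re w < 1" "0 < Im w" "Im w < 1" "\<Psi> z = page f i w" "z = (if 0 \<le> Im z then w else cnj w)"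
        using onR[OF z(1)] by blast
      have "\<Psi> z' \<notin> skel" using False z(3) by simp
      then obtain w' f' i' where w': "(f', i') \<in> {(f1, i1), (f2, i2)}" "(f', i') = (f1, i1) \<longleftrightarrow> 0 \<le> Im z'"
        "0 < Re w'" "Re w' < 1" "0 < Im w'" "Im w' < 1" "\<Psi> z' = page f' i' w'" "z' = (if 0 \<le> Im z' then w' else cnj w')"
        using onR[OF z(2)] by blast
      have "(f', i') = (f, i) \<and> w' = w"
        using w w' z(3) p by (intro page_inj[of f i e w f' i' w']) auto
      then show ?thesis using w(2,8) w'(2,8) by auto
    qed
  qed
  then have op: "openin S (\<Psi> ` R)"
    using surface_open_image[OF surf \<open>open R\<close> cont] by blast
  define H where "H = {z. Re z \<in> {0..1} \<and> Im z \<in> {0..1}}"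
  have "openin (top_of_set H) {z \<in> H. page f3 i3 z \<in> \<Psi> ` R}"
    using openin_continuous_map_preimage[OF page_cont[OF p(3) order_refl] op] by (simp add: H_def)
  moreover have mid: "Complex (1/2) 0 \<in> {z \<in> H. page f3 i3 z \<in> \<Psi> ` R}"
  proof -
    have "page f3 i3 (Complex (1/2) 0) = \<Psi> (Complex (1/2) 0)"
      using page_edge[OF p(3)] page_edge[OF p(1)] by (simp add: \<Psi>_def)
    moreover have "Complex (1/2) 0 \<in> R" by (simp add: R_def)
    ultimately show ?thesis by (auto simp: H_def)
  qed
  ultimately obtain r where r: "r > 0" "ball (Complex (1/2) 0) r \<inter> H \<subseteq> {z \<in> H. page f3 i3 z \<in> \<Psi> ` R}"
    unfolding openin_contains_ball by blast
  \<comment> \<open>The height of a point of the third page just off the edge, small enough to land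
    in the open set.\<close>
  define s where "s = min (r/2) (1/2)"
  have "Complex (1/2) s \<in> ball (Complex (1/2) 0) r \<inter> H"
    using r(1) by (auto simp: s_def H_def dist_norm cmod_def)
  then obtain z where z: "z \<in> R" "page f3 i3 (Complex (1/2) s) = \<Psi> z" using r(2) by auto
  have s: "0 < s" "s < 1" using r(1) by (auto simp: s_def)
  have "\<Psi> z \<notin> skel" using page_skel[OF p(3), of "Complex (1/2) s"] s z(2) by simp
  then obtain w f i where w: "(f, i) \<in> {(f1, i1), (f2, i2)}"
        "0 < Re w" "Re w < 1" "0 < Im w" "Im w < 1" "\<Psi> z = page f i w"
    using onR[OF z(1)] by blast
  have "(f, i) = (f3, i3)"
    using page_inj[OF p(3), of "Complex (1/2) s" f i w] w s z(2) p by auto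
  then show False using w(1) ne by auto
qed

lemma finite_places: "e \<in> edges G \<Longrightarrow> finite (places e)"
  and card_places_le: "e \<in> edges G \<Longrightarrow> card (places e) \<le> 2"
proof -
  assume e: "e \<in> edges G"
  have no3: "\<not> (T \<subseteq> places e \<and> card T = 3)" for T
  proof
    assume T: "T \<subseteq> places e \<and> card T = 3"
    then obtain x y z where "T = {x, y, z}" "x \<noteq> y" "x \<noteq> z" "y \<noteq> z"
      by (metis card_3_iff)
    then show False
      using no_three_places[OF e, of "fst x" "snd x" "fst y" "snd y" "fst z" "snd z"] T by auto
  qed
  show "finite (places e)"
    using infinite_arbitrarily_large[of "places e" 3] no3 by blast
  show "card (places e) \<le> 2"
    using obtain_subset_with_card_n[of 3 "places e"] no3 by (metis not_less_eq_eq numeral_2_eq_2 numeral_3_eq_3)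
qed

text \<open>Each face takes up a place at the edge of its first step, and every edge has finitely
  many places.\<close>

lemma finite_faces: "finite F"
proof -
  have "F \<subseteq> (\<Union>e\<in>edges G. fst ` places e)"
  proof
    fix f assume "f \<in> F"
    then have "fst (W f ! 0) \<in> edges G" "(f, 0) \<in> places (fst (W f ! 0))"
      using W_edge[of f 0] by (auto simp: places_def)
    then show "f \<in> (\<Union>e\<in>edges G. fst ` places e)" by force
  qed
  then show ?thesis using finite_places fin_edges by (meson finite_UN finite_imageI finite_subset)
qed

lemma closed_Phi: "f \<in> F \<Longrightarrow> A \<subseteq> disc \<Longrightarrow> closed A \<Longrightarrow> closedin S (\<Phi> f ` A)"
  by (intro closed_image) (auto intro: continuous_map_from_subtopology_mono[OF Phi_cont]
      bounded_subset simp: compact_eq_bounded_closed)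

text \<open>The parameter of the arc would map the open set injectively to the real line, and the
  image would be open in the plane.\<close>

lemma no_open_in_edge:
  assumes e: "e \<in> edges G" and V: "openin S V" "V \<subseteq> curve G e ` {0..1}"
  shows "V = {}"
proof (rule ccontr)
  assume "V \<noteq> {}"
  obtain c where c: "homeomorphic_maps (top_of_set {0..1}) (subtopology S (curve G e ` {0..1})) (curve G e) c"
    using curve_embedding[OF e] unfolding embedding_map_def homeomorphic_map_maps by auto
  let ?p = "\<lambda>x. complex_of_real (c x)"
  have "continuous_map (subtopology S V) euclideanreal c"
    using c V(2) unfolding homeomorphic_maps_def
    by (metis continuous_map_from_subtopology_mono continuous_map_into_fulltopology)
  from continuous_map_compose[OF this, of euclidean complex_of_real]
  have "continuous_map (subtopology S V) euclidean ?p"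
    by (simp add: comp_def continuous_on_of_real_id)
  moreover have "inj_on ?p V"
  proof (rule inj_onI)
    fix x y assume "x \<in> V" "y \<in> V" "?p x = ?p y"
    moreover have "curve G e (c x) = x" if "x \<in> V" for x
      using c that V openin_subset[OF V(1)] unfolding homeomorphic_maps_def by (auto simp: topspace_subtopology)
    ultimately show "x = y" by (metis of_real_eq_iff)
  qed
  ultimately have "open (?p ` V)" using surface_open_coordinates[OF surf V(1)] by blast
  moreover obtain x where x: "x \<in> V" using \<open>V \<noteq> {}\<close> by auto
  ultimately obtain r where r: "r > 0" "ball (?p x) r \<subseteq> ?p ` V" unfolding open_contains_ball by blast
  have "?p x + of_real (r/2) * \<i> \<in> ball (?p x) r" using r(1) by (simp add: dist_norm norm_mult)
  then have "?p x + of_real (r/2) * \<i> \<in> ?p ` V" using r(2) by blast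
  then have "Im (?p x + of_real (r/2) * \<i>) = 0" by (metis (no_types, lifting) Im_complex_of_real imageE)
  then show False using r(1) by simp
qed

lemma no_open_in_verts:
  assumes V: "openin S V" "V \<subseteq> verts G"
  shows "V = {}"
proof (rule ccontr)
  assume "V \<noteq> {}"
  then obtain v where v: "v \<in> V" by auto
  have "openin S (V - (verts G - {v}))" using V(1) closed_verts[of "verts G - {v}"] by blast
  moreover have "V - (verts G - {v}) = {v}" using v V(2) by auto
  ultimately have "openin S {v}" by simp
  then have "open ((\<lambda>_. 0::complex) ` {v})"
    by (rule surface_open_coordinates[OF surf]) auto
  then show False using not_open_singleton[of "0::complex"] by simp
qed

lemma no_open_in_skel:
  assumes V: "openin S V" "V \<subseteq> skel"
  shows "V = {}"
proof -
  have "V = {}"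
    if "finite E" "E \<subseteq> edges G" "openin S V" "V \<subseteq> verts G \<union> (\<Union>e\<in>E. curve G e ` {0..1})" for E V
    using that
  proof (induction E arbitrary: V rule: finite_induct)
    case (insert e E V)
    have "openin S (V - curve G e ` {0..1})" using insert.prems closed_curve[of e] by blast
    then have "V - curve G e ` {0..1} = {}"
      using insert.prems by (intro insert.IH) auto
    then show ?case using no_open_in_edge[of e V] insert.prems by auto
  qed (use no_open_in_verts in auto)
  then show ?thesis using fin_edges V unfolding skel_def by blast
qed

text \<open>The union of the finitely many closed faces is closed, and its complement lies in the
  skeleton, which has empty interior.\<close>

lemma cover: "topspace S = (\<Union>f\<in>F. \<Phi> f ` disc)"
proof
  have "closedin S (\<Union>f\<in>F. \<Phi> f ` disc)"
    using finite_faces closed_Phi by (intro closedin_Union) auto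
  then have "openin S (topspace S - (\<Union>f\<in>F. \<Phi> f ` disc))" by blast
  moreover have "topspace S - (\<Union>f\<in>F. \<Phi> f ` disc) \<subseteq> skel"
  proof
    fix x assume x: "x \<in> topspace S - (\<Union>f\<in>F. \<Phi> f ` disc)"
    have "x \<notin> f" if f: "f \<in> F" for f
    proof
      assume "x \<in> f"
      then have "x \<in> \<Phi> f ` disc"
        using Phi_ball[OF f] image_mono[OF ball_subset_cball, of "\<Phi> f" 0 1] by blast
      then show False using x f by blast
    qed
    then have "x \<notin> \<Union>F" by blast
    then show "x \<in> skel" using x unfolding face_Union by blast
  qed
  ultimately show "topspace S \<subseteq> (\<Union>f\<in>F. \<Phi> f ` disc)" using no_open_in_skel by blast
qed (use Phi_top in auto)

lemma edge_point_preimage: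
  assumes "e \<in> edges G" "0 < t" "t < 1" "f \<in> F" "y \<in> disc" "\<Phi> f y = curve G e t"
  obtains k where "(f, k) \<in> places e" "y = side k (dirpar (snd (W f ! k)) t)"
proof -
  have "norm y = 1" using assms Phi_skel_iff[of f y] unfolding skel_def by fastforce
  then obtain k s where ks: "k < 4" "0 \<le> s" "s < 1" "y = side k s" by (rule sphere_side)
  have "fst (W f ! k) = e \<and> dirpar (snd (W f ! k)) s = t"
    using assms ks Phi_side[of f k s] W_edge[of f k] by (intro curve_eq) auto
  then show thesis using that[of k] ks assms(4) by (auto simp: places_def)
qed

text \<open>With a single place the edge would be a boundary of the surface: around its midpoint the
  inverse of one face map would be a coordinate with values in the closed disc, and its open image
  would contain a point of the circle.\<close>

lemma card_places: "e \<in> edges G \<Longrightarrow> card (places e) = 2"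
proof (rule ccontr)
  assume e: "e \<in> edges G" and ne: "card (places e) \<noteq> 2"
  \<comment> \<open>The midpoint has the same parameter in both directions of traversal.\<close>
  define s where "s = curve G e (1/2)"
  have s_top: "s \<in> topspace S" using curve_top[OF e] by (simp add: s_def)
  then obtain f y where fy: "f \<in> F" "y \<in> disc" "\<Phi> f y = s" using cover by auto
  then obtain i where i: "(f, i) \<in> places e" using edge_point_preimage[OF e, of "1/2" f y] by (auto simp: s_def)
  have i4: "i < 4" using i by (simp add: places_def)
  have "card (places e) \<noteq> 0" using i finite_places[OF e] by auto
  then have "card (places e) = 1" using card_places_le[OF e] ne by linarith
  then have single: "places e = {(f, i)}" using i by (metis card_1_singletonE singletonD)
  define C where "C = disc - sector i"
  have C: "closed C" "C \<subseteq> disc" by (auto simp: C_def open_sector closed_Diff)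
  \<comment> \<open>Closed pieces that miss the midpoint are removed, until all preimages of the
    remaining points lie in quadrant \<open>i\<close> of the disc of \<open>f\<close>.\<close>
  define V where "V = topspace S - (verts G \<union> (\<Union>e'\<in>edges G - {e}. curve G e' ` {0..1}) \<union>
     (\<Union>f'\<in>F - {f}. \<Phi> f' ` disc) \<union> \<Phi> f ` C)"
  have "closedin S (verts G \<union> (\<Union>e'\<in>edges G - {e}. curve G e' ` {0..1}) \<union>
     (\<Union>f'\<in>F - {f}. \<Phi> f' ` disc) \<union> \<Phi> f ` C)"
  proof (intro closedin_Un)
    show "closedin S (\<Union>e'\<in>edges G - {e}. curve G e' ` {0..1})"
      using fin_edges closed_curve by (intro closedin_Union) auto
    show "closedin S (\<Union>f'\<in>F - {f}. \<Phi> f' ` disc)"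
      using finite_faces closed_Phi by (intro closedin_Union) auto
  qed (use closed_verts closed_Phi fy C in auto)
  then have V: "openin S V" unfolding V_def by blast
  have pre: "f' = f \<and> x = side i (1/2)" if h: "f' \<in> F" "x \<in> disc" "\<Phi> f' x = s" for f' x
  proof -
    obtain k where "(f', k) \<in> places e" "x = side k (dirpar (snd (W f' ! k)) (1/2))"
      by (rule edge_point_preimage[OF e, of "1/2" f' x]) (use h in \<open>auto simp: s_def\<close>)
    moreover have "dirpar b (1/2) = 1/2" for b by (simp add: dirpar_def)
    ultimately show ?thesis using single by simp
  qed
  have inC: "side i (1/2) \<notin> C" using side_in_sector[of "1/2" i] by (simp add: C_def)
  have sV: "s \<in> V"
  proof -
    have "s \<notin> verts G" using curve_interior[OF e, of "1/2"] by (simp add: s_def)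
    moreover have "s \<notin> (\<Union>e'\<in>edges G - {e}. curve G e' ` {0..1})"
    proof
      assume "s \<in> (\<Union>e'\<in>edges G - {e}. curve G e' ` {0..1})"
      then obtain e' t where "e' \<in> edges G" "e' \<noteq> e" "t \<in> {0..1}" "curve G e (1/2) = curve G e' t"
        unfolding s_def by blast
      then show False using curve_eq[OF e, of e' "1/2" t] by simp
    qed
    moreover have "s \<notin> (\<Union>f'\<in>F - {f}. \<Phi> f' ` disc)"
    proof
      assume "s \<in> (\<Union>f'\<in>F - {f}. \<Phi> f' ` disc)"
      then obtain f' x where "f' \<in> F" "f' \<noteq> f" "x \<in> disc" "\<Phi> f' x = s" by blast
      then show False using pre by simp
    qed
    moreover have "s \<notin> \<Phi> f ` C"
    proof
      assume "s \<in> \<Phi> f ` C"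
      then obtain x where "x \<in> C" "\<Phi> f x = s" by blast
      then show False using pre[OF fy(1), of x] inC C(2) by auto
    qed
    ultimately show ?thesis using s_top unfolding V_def by blast
  qed
  have V_pre: "\<exists>y. y \<in> disc \<and> y \<in> sector i \<and> \<Phi> f y = x" if x: "x \<in> V" for x
  proof -
    have "x \<in> topspace S" using x by (simp add: V_def)
    then obtain f' y where y: "f' \<in> F" "y \<in> disc" "\<Phi> f' y = x" using cover by auto
    have "f' = f"
    proof (rule ccontr)
      assume "f' \<noteq> f"
      then have "x \<in> (\<Union>f'\<in>F - {f}. \<Phi> f' ` disc)" using y by blast
      then show False using x unfolding V_def by blast
    qed
    moreover have "y \<in> sector i"
    proof (rule ccontr)
      assume "y \<notin> sector i"
      then have "y \<in> C" using y by (simp add: C_def)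
      then have "x \<in> \<Phi> f ` C" using y \<open>f' = f\<close> by blast
      then show False using x unfolding V_def by blast
    qed
    ultimately show ?thesis using y by auto
  qed
  have inj: "y = y'" if y: "y \<in> disc" "y \<in> sector i" "y' \<in> disc" "y' \<in> sector i" "\<Phi> f y = \<Phi> f y'" for y y'
  proof (cases "norm y < 1")
    case True
    then show ?thesis using Phi_eq_interior[OF fy(1) fy(1) _ y(3,5)] by simp
  next
    case False
    then have "norm y = 1" using y by auto
    moreover from this have "norm y' = 1"
      using Phi_skel_iff[OF fy(1) y(1)] Phi_skel_iff[OF fy(1) y(3)] y(5) by simp
    ultimately obtain j t j' t' where jt: "j < 4" "0 \<le> t" "t < 1" "y = side j t"
      "j' < 4" "0 \<le> t'" "t' < 1" "y' = side j' t'" by (meson sphere_side)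
    then have *: "j = i" "j' = i"
      using side_sector_iff[of j i t] side_sector_iff[of j' i t'] i4 y(2,4) by auto
    have "curve G e (dirpar (snd (W f ! i)) t) = curve G e (dirpar (snd (W f ! i)) t')"
      using jt * y(5) Phi_side[OF fy(1) i4, of t] Phi_side[OF fy(1) i4, of t'] i by (simp add: places_def)
    then have "t = t'"
      using inj_onD[OF curve_inj[OF e], of "dirpar (snd (W f ! i)) t" "dirpar (snd (W f ! i)) t'"] jt by auto
    then show ?thesis using jt * by simp
  qed
  define p where "p = (\<lambda>x. SOME y. y \<in> disc \<and> y \<in> sector i \<and> \<Phi> f y = x)"
  have p: "p x \<in> disc" "p x \<in> sector i" "\<Phi> f (p x) = x" if "x \<in> V" for x
    using someI_ex[OF V_pre[OF that]] unfolding p_def by auto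
  \<comment> \<open>The preimage under \<open>p\<close> of a closed set is the trace on
    \<open>V\<close> of the image of a compact set, hence closed.\<close>
  have "continuous_map (subtopology S V) euclidean p"
    unfolding continuous_map_closedin
  proof (intro conjI allI impI)
    fix B :: "complex set" assume B: "closedin euclidean B"
    have "{x \<in> topspace (subtopology S V). p x \<in> B} = \<Phi> f ` (B \<inter> disc) \<inter> V"
    proof (intro equalityI subsetI)
      fix x assume "x \<in> \<Phi> f ` (B \<inter> disc) \<inter> V"
      then obtain y where y: "y \<in> B" "y \<in> disc" "x = \<Phi> f y" "x \<in> V" by auto
      have "x \<notin> \<Phi> f ` C" using y(4) unfolding V_def by blast
      then have "y \<notin> C" using y(3) by blast
      then have "y \<in> sector i" using y(2) by (simp add: C_def)
      then have "p x = y" using inj[OF p(1,2)[OF y(4)] y(2)] p(3)[OF y(4)] y(3) by simp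
      then show "x \<in> {x \<in> topspace (subtopology S V). p x \<in> B}" using y openin_subset[OF V] by auto
    qed (use p in \<open>force simp: topspace_subtopology\<close>)
    moreover have "closedin S (\<Phi> f ` (B \<inter> disc))" using B by (intro closed_Phi fy(1)) auto
    ultimately show "closedin (subtopology S V) {x \<in> topspace (subtopology S V). p x \<in> B}"
      by (metis closedin_subtopology)
  qed auto
  moreover have "inj_on p V" using p(3) by (intro inj_on_inverseI)
  ultimately have "open (p ` V)" by (rule surface_open_coordinates[OF surf V])
  moreover have "p ` V \<subseteq> disc" using p(1) by blast
  ultimately have "p ` V \<subseteq> interior disc" by (rule interior_maximal[rotated])
  then have "p s \<in> interior disc" using sV by blast
  then have "norm (p s) < 1" unfolding interior_cball mem_ball_0 .
  moreover have "p s = side i (1/2)" using pre[OF fy(1) p(1)[OF sV] p(3)[OF sV]] by (rule conjunct2)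
  then have "norm (p s) = 1" by (simp only: norm_side)
  ultimately show False by linarith
qed

end

section \<open>Sections over a quadrilateral\<close>

text \<open>The phase of \<open>G\<close> turns by half a circle, forwards or backwards, along each of the
  four sides.\<close>

lemma quadrilateral_section:
  fixes b :: "nat \<Rightarrow> bool"
  obtains G :: "complex \<Rightarrow> complex" where "continuous_on UNIV G" "\<And>z. G z = 0 \<longleftrightarrow> z = 0"
    "\<And>k t. k < 4 \<Longrightarrow> 0 \<le> t \<Longrightarrow> t < 1 \<Longrightarrow> G (side k t) = (- 1) ^ k * cis (pi * (if b k then t else - t))"
    "\<And>h n. circle_degree h n \<Longrightarrow> circle_degree (G \<circ> h) (n * (int (card {k. k < 4 \<and> b k}) - 2))"
proof -
  define \<epsilon> :: "nat \<Rightarrow> real" where "\<epsilon> = (\<lambda>k. if b k then 1 else -1)"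
  \<comment> \<open>The traversed part of side \<open>k\<close> at position \<open>x\<close> of the
    boundary, measured in sides; \<open>pi * \<eta> x\<close> is the phase at
    \<open>x\<close>.\<close>
  define c :: "nat \<Rightarrow> real \<Rightarrow> real" where "c = (\<lambda>k x. max 0 (min 1 (x - real k)))"
  define \<eta> where "\<eta> = (\<lambda>x. \<Sum>k<4. \<epsilon> k * c k x)"
  \<comment> \<open>With \<open>n\<close> sides forwards and \<open>4 - n\<close> backwards the
    phase makes \<open>n - (4 - n)\<close> half turns, that is, \<open>n - 2\<close> full
    turns.\<close>
  define d where "d = int (card {k. k < 4 \<and> b k}) - 2"
  have "(\<Sum>k<4. \<epsilon> k) = 2 * of_int d"
  proof -
    have "(\<Sum>k<4. \<epsilon> k) = (\<Sum>k<4. 2 * (if b k then 1 else 0) - 1)"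
      by (intro sum.cong) (auto simp: \<epsilon>_def)
    also have "\<dots> = 2 * real (card {k. k < 4 \<and> b k}) - 4"
      by (simp add: sum_subtractf sum_distrib_left[symmetric] sum.If_cases lessThan_def Int_def)
    finally show ?thesis by (simp add: d_def)
  qed
  moreover have "\<eta> 4 = (\<Sum>k<4. \<epsilon> k)"
    unfolding \<eta>_def by (intro sum.cong) (auto simp: c_def)
  ultimately have \<eta>4: "\<eta> 4 = 2 * of_int d" by simp
  have \<eta>0: "\<eta> 0 = 0" by (simp add: \<eta>_def c_def)
  have cont\<eta>: "continuous_on A \<eta>" for A
    unfolding \<eta>_def c_def by (intro continuous_intros)
  \<comment> \<open>Subtracting a uniform rotation by \<open>d\<close> turns makes the phase
    periodic, so that it descends to the circle.\<close>
  have "continuous_on {0..2*pi} (\<lambda>\<theta>. of_real (pi * \<eta> (2 * \<theta> / pi) - of_int d * \<theta>) :: complex)"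
    by (intro continuous_intros continuous_on_compose2[OF cont\<eta>[of UNIV]]) auto
  then obtain \<mu> :: "complex \<Rightarrow> complex" where \<mu>: "continuous_on (sphere 0 1) \<mu>"
    "\<And>t. t \<in> {0..2*pi} \<Longrightarrow> \<mu> (cis t) = of_real (pi * \<eta> (2 * t / pi) - of_int d * t)"
  proof (rule continuous_on_circle_lift)
    have *: "2 * (2 * pi) / pi = 4" "2 * 0 / pi = 0" by simp_all
    show "complex_of_real (pi * \<eta> (2 * 0 / pi) - of_int d * 0) =
        complex_of_real (pi * \<eta> (2 * (2 * pi) / pi) - of_int d * (2 * pi))"
      unfolding * \<eta>4 \<eta>0 by simp
  qed blast
  define G where "G = (\<lambda>z. of_real (norm z) * (sgn z powi d * exp (\<i> * \<mu> (sgn z))))"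
  have sgnS: "sgn z \<in> sphere 0 1" if "z \<noteq> 0" for z :: complex using that by (simp add: norm_sgn)
  have "norm (exp (\<i> * \<mu> \<xi>)) = 1" if \<xi>: "\<xi> \<in> sphere 0 1" for \<xi>
  proof -
    obtain t where "t \<in> {0..2*pi}" "\<xi> = cis t" using \<xi> cis_image_circle by (metis imageE)
    then show ?thesis by (simp only: \<mu>(2) norm_exp_i_times)
  qed
  then have normG: "norm (G z) = norm z" for z
    using sgnS[of z] by (cases "z = 0") (auto simp: G_def norm_mult norm_power_int)
  show thesis
  proof (rule that[of G])
    show "G z = 0 \<longleftrightarrow> z = 0" for z using normG[of z] by (metis norm_eq_zero)
    show "continuous_on UNIV G"
    proof (rule continuous_at_imp_continuous_on, intro ballI)
      fix z :: complex
      show "isCont G z"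
      proof (cases "z = 0")
        case True
        have "(\<lambda>w. norm (G w)) \<midarrow>0\<rightarrow> 0" unfolding normG by (intro tendsto_norm_zero tendsto_ident_at)
        then have "G \<midarrow>0\<rightarrow> 0" by (rule tendsto_norm_zero_cancel)
        then show ?thesis using True normG[of 0] by (simp add: isCont_def)
      next
        case False
        have "continuous_on (- {0}) G"
          unfolding G_def
          by (intro continuous_intros continuous_on_compose2[OF \<mu>(1)]) (auto simp: norm_sgn sgn_zero_iff split: if_splits)
        then show ?thesis using False by (simp add: continuous_on_eq_continuous_at open_Compl)
      qed
    qed
    show "G (side k t) = (- 1) ^ k * cis (pi * (if b k then t else - t))" if kt: "k < 4" "0 \<le> t" "t < 1" for k t
    proof -
      define \<theta> where "\<theta> = 2 * pi * (real k + t) / 4"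
      have \<theta>: "\<theta> \<in> {0..2*pi}" using kt by (auto simp: \<theta>_def)
      have th: "2 * \<theta> / pi = real k + t" by (simp add: \<theta>_def)
      have "G (side k t) = cis \<theta> powi d * exp (\<i> * \<mu> (cis \<theta>))"
        by (simp add: G_def side_def \<theta>_def sgn_eq)
      also have "\<dots> = cis (of_int d * \<theta>) * cis (pi * \<eta> (real k + t) - of_int d * \<theta>)"
        using \<mu>(2)[OF \<theta>] th by (simp only: cis_power_int) (simp only: cis_conv_exp)
      also have "\<dots> = cis (pi * \<eta> (real k + t))" by (simp add: cis_mult)
      also have "\<dots> = cis (\<Sum>i<4. pi * (\<epsilon> i * c i (real k + t)))" by (simp add: \<eta>_def sum_distrib_left)
      also have "\<dots> = (\<Prod>i<4. cis (pi * (\<epsilon> i * c i (real k + t))))"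
        by (simp add: cis_conv_exp exp_sum sum_distrib_left)
      \<comment> \<open>A completed side contributes \<open>-1\<close> in either direction.\<close>
      also have "\<dots> = (\<Prod>i<4. if i < k then -1 else if i = k then cis (pi * (\<epsilon> k * t)) else 1)"
      proof (rule prod.cong)
        fix i :: nat assume "i \<in> {..<4}"
        consider "i < k" | "i = k" | "k < i" by linarith
        then show "cis (pi * (\<epsilon> i * c i (real k + t))) = (if i < k then -1 else if i = k then cis (pi * (\<epsilon> k * t)) else 1)"
        proof cases
          case 1
          then have "c i (real k + t) = 1" using kt by (simp add: c_def)
          then show ?thesis using 1 by (simp add: \<epsilon>_def cis_cnj[symmetric])
        next
          case 2
          then have "c i (real k + t) = t" using kt by (simp add: c_def)
          then show ?thesis using 2 by simp
        next
          case 3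
          then have "c i (real k + t) = 0" using kt by (simp add: c_def)
          then show ?thesis using 3 by simp
        qed
      qed simp
      also have "\<dots> = (- 1) ^ k * cis (pi * (\<epsilon> k * t))"
        using less_4_cases[OF kt(1)] by (elim disjE) (simp_all add: numeral_eq_Suc)
      finally show ?thesis by (simp add: \<epsilon>_def)
    qed
    show "circle_degree (G \<circ> h) (n * (int (card {k. k < 4 \<and> b k}) - 2))" if h: "circle_degree h n" for h n
    proof -
      obtain L where L: "continuous_on (sphere 0 1) L" "\<And>\<xi>. \<xi> \<in> sphere 0 1 \<Longrightarrow> h \<xi> = \<xi> powi n * exp (L \<xi>)"
        using h unfolding circle_degree_def by metis
      \<comment> \<open>The phase of \<open>h\<close>. Since \<open>G\<close> extends a function on
        the circle radially, the modulus of \<open>h\<close> only contributes a positive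
        factor.\<close>
      define v where "v = (\<lambda>\<xi>. \<xi> powi n * exp (\<i> * of_real (Im (L \<xi>))))"
      have vS: "v \<xi> \<in> sphere 0 1" if "\<xi> \<in> sphere 0 1" for \<xi>
        using that by (simp add: v_def norm_mult norm_power_int)
      have cv: "continuous_on (sphere 0 1) v"
        unfolding v_def by (intro continuous_intros L) auto
      have hv: "norm (h \<xi>) = exp (Re (L \<xi>))" "sgn (h \<xi>) = v \<xi>" if "\<xi> \<in> sphere 0 1" for \<xi>
      proof -
        show 1: "norm (h \<xi>) = exp (Re (L \<xi>))"
          using that by (simp add: L(2) norm_mult norm_power_int)
        have "exp (L \<xi>) = of_real (exp (Re (L \<xi>))) * exp (\<i> * of_real (Im (L \<xi>)))"
          by (subst exp_eq_polar) (simp only: cis_conv_exp)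
        then have "h \<xi> = of_real (exp (Re (L \<xi>))) * v \<xi>" using that by (simp add: L(2) v_def)
        moreover have "norm (v \<xi>) = 1" using vS[OF that] by simp
        ultimately show "sgn (h \<xi>) = v \<xi>" by (simp add: sgn_eq norm_mult)
      qed
      show ?thesis unfolding d_def[symmetric]
      proof (rule circle_degreeI)
        show "continuous_on (sphere 0 1)
          (\<lambda>\<xi>. of_real (Re (L \<xi>)) + of_int d * (\<i> * of_real (Im (L \<xi>))) + \<i> * \<mu> (v \<xi>))"
          using vS by (intro continuous_intros L continuous_on_compose2[OF \<mu>(1) cv]) auto
        show "(G \<circ> h) \<xi> = \<xi> powi (n * d) *
            exp (of_real (Re (L \<xi>)) + of_int d * (\<i> * of_real (Im (L \<xi>))) + \<i> * \<mu> (v \<xi>))"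
          if "\<xi> \<in> sphere 0 1" for \<xi>
          using hv[OF that]
          by (simp add: G_def exp_add exp_of_real v_def power_int_mult_distrib power_int_mult exp_power_int)
      qed
    qed
  qed
qed

section \<open>Labelled quadrangulations\<close>

text \<open>On a walk, \<open>sg\<close> of the label is the parity of the length; this character of
  \<open>K\<close> defines the line bundle.\<close>

locale labelled_surface = quadrangulated_surface S G W \<Phi> + group K
  for S :: "'a topology" and G :: "('a, 'e) drawing" and W \<Phi> and K :: "('k, 'm) monoid_scheme" (structure) +
  fixes X :: "'e \<times> bool \<Rightarrow> 'k" and sg :: "'k \<Rightarrow> complex"
  assumes X_carrier: "\<And>e b. e \<in> edges G \<Longrightarrow> X (e, b) \<in> carrier K"
    and X_inv: "\<And>e. e \<in> edges G \<Longrightarrow> X (e, False) = inv X (e, True)"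
    and face_label: "\<And>f. f \<in> faces S G \<Longrightarrow> foldr (\<otimes>) (map X (W f)) \<one> = \<one>"
    and sg_mult: "\<And>x y. x \<in> carrier K \<Longrightarrow> y \<in> carrier K \<Longrightarrow> sg (x \<otimes> y) = sg x * sg y"
    and sg_sq: "\<And>x. x \<in> carrier K \<Longrightarrow> sg x * sg x = 1"
    and sg_X: "\<And>e b. e \<in> edges G \<Longrightarrow> sg (X (e, b)) = - 1"
begin

text \<open>Labels of initial pieces of the boundary walk. Triviality around the face makes corner
  \<open>4\<close> interchangeable with corner \<open>0\<close>.\<close>

definition pre :: "'a set \<Rightarrow> nat \<Rightarrow> 'k" where
  "pre f k = foldr (\<otimes>) (map X (take k (W f))) \<one>"

lemma foldr_mult_carrier: "set xs \<subseteq> carrier K \<Longrightarrow> a \<in> carrier K \<Longrightarrow> foldr (\<otimes>) xs a \<in> carrier K"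
  by (induction xs) auto

lemma foldr_mult_append:
  "set xs \<subseteq> carrier K \<Longrightarrow> a \<in> carrier K \<Longrightarrow> foldr (\<otimes>) xs \<one> \<otimes> a = foldr (\<otimes>) xs a"
  by (induction xs) (auto simp: m_assoc foldr_mult_carrier)

lemma W_carrier: "f \<in> F \<Longrightarrow> set (map X (W f)) \<subseteq> carrier K"
  using W_edges[of f] by (auto simp: X_carrier image_subset_iff)

lemma take_carrier: "f \<in> F \<Longrightarrow> set (map X (take k (W f))) \<subseteq> carrier K"
  using W_carrier[of f] set_take_subset[of k "W f"] by auto

lemma Wk_carrier: "f \<in> F \<Longrightarrow> k < 4 \<Longrightarrow> X (W f ! k) \<in> carrier K"
  using W_carrier[of f] W_len[of f] nth_mem[of k "W f"] by auto

lemma pre_carrier: "f \<in> F \<Longrightarrow> pre f k \<in> carrier K"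
  unfolding pre_def by (intro foldr_mult_carrier take_carrier) auto

lemma pre_0 [simp]: "pre f 0 = \<one>" by (simp add: pre_def)

lemma pre_4: "f \<in> F \<Longrightarrow> pre f 4 = \<one>" using face_label[of f] W_len[of f] by (simp add: pre_def)

lemma pre_Suc:
  assumes "f \<in> F" "k < 4"
  shows "pre f (Suc k) = pre f k \<otimes> X (W f ! k)"
proof -
  have "take (Suc k) (W f) = take k (W f) @ [W f ! k]"
    using assms W_len[of f] by (intro take_Suc_conv_app_nth) auto
  then have "pre f (Suc k) = foldr (\<otimes>) (map X (take k (W f))) (X (W f ! k))"
    using Wk_carrier[OF assms] by (simp add: pre_def)
  then show ?thesis
    using foldr_mult_append[OF take_carrier Wk_carrier] assms by (simp add: pre_def)
qed

lemma sg_one: "sg \<one> = 1"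
proof -
  have "sg \<one> * sg \<one> = sg \<one>" using sg_mult[of \<one> \<one>] by simp
  then show ?thesis using sg_sq[of \<one>] by auto
qed

lemma sg_W: "f \<in> F \<Longrightarrow> k < 4 \<Longrightarrow> sg (X (W f ! k)) = - 1"
  using sg_X[of "fst (W f ! k)" "snd (W f ! k)"] W_edge[of f k] by simp

lemma sg_pre: "f \<in> F \<Longrightarrow> k \<le> 4 \<Longrightarrow> sg (pre f k) = (- 1) ^ k"
  by (induction k) (auto simp: sg_one pre_Suc sg_mult pre_carrier Wk_carrier sg_W)

lemma sg_inv: "x \<in> carrier K \<Longrightarrow> sg (inv x) = sg x"
  using sg_mult[of x "inv x"] sg_one sg_sq[of x]
  by (metis inv_closed mult.assoc mult.right_neutral mult_1 r_inv)

text \<open>The label of the boundary walk of \<open>f\<close> from its first corner to the base vertex of the cell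
  containing \<open>\<Phi> f y\<close>; the base vertex of an edge \<open>e\<close> is \<open>curve G e 0\<close>, and the base vertex of \<open>f\<close>
  is its first corner.\<close>

definition cf :: "'a set \<Rightarrow> complex \<Rightarrow> 'k" where
  "cf f y = (if norm y < 1 then \<one> else
     let p = 2 * Arg2pi y / pi; k = nat \<lfloor>p\<rfloor> in if p = real k \<or> snd (W f ! k) then pre f k else pre f (Suc k))"

lemma cf_interior: "norm y < 1 \<Longrightarrow> cf f y = \<one>" by (simp add: cf_def)

lemma cf_side:
  assumes "k < 4" "0 \<le> t" "t < 1"
  shows "cf f (side k t) = (if t = 0 \<or> snd (W f ! k) then pre f k else pre f (Suc k))"
proof -
  have p: "2 * Arg2pi (side k t) / pi = real k + t" unfolding Arg2pi_side[OF assms] by simp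
  have "nat \<lfloor>real k + t\<rfloor> = k" using assms by linarith
  then show ?thesis unfolding cf_def Let_def p using assms by simp
qed

lemma cf_carrier: "f \<in> F \<Longrightarrow> cf f y \<in> carrier K"
  by (auto simp: cf_def Let_def pre_carrier)

section \<open>Displacements between nearby points of the surface\<close>

definition disp :: "'a set \<Rightarrow> complex \<Rightarrow> complex \<Rightarrow> 'k" where
  "disp f x y = inv (cf f x) \<otimes> cf f y"

text \<open>Points are compared inside one closed face, through preimages closer than \<epsilon>.
  This is a relation because a point of the skeleton may have several preimages, even in one
  face.\<close>

definition near :: "real \<Rightarrow> 'a \<Rightarrow> 'a \<Rightarrow> 'k \<Rightarrow> bool" where
  "near \<epsilon> s s' k \<longleftrightarrow> (\<exists>f\<in>F. \<exists>x\<in>disc. \<exists>y\<in>disc.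
     \<Phi> f x = s \<and> \<Phi> f y = s' \<and> dist x y < \<epsilon> \<and> k = disp f x y)"

lemma disp_carrier: "f \<in> F \<Longrightarrow> disp f x y \<in> carrier K"
  by (simp add: disp_def cf_carrier)

lemma disp_self: "f \<in> F \<Longrightarrow> cf f x = cf f y \<Longrightarrow> disp f x y = \<one>"
  by (simp add: disp_def cf_carrier)

lemma disp_trans: "f \<in> F \<Longrightarrow> disp f x y \<otimes> disp f y z = disp f x z"
proof -
  assume f: "f \<in> F"
  note c = cf_carrier[OF f]
  have "cf f y \<otimes> (inv cf f y \<otimes> cf f z) = cf f z" using c by (simp add: m_assoc[symmetric])
  then show ?thesis unfolding disp_def using c by (simp add: m_assoc)
qed

lemma skel_cases:
  assumes "s \<in> skel"
  obtains "s \<in> verts G" | e t where "e \<in> edges G" "0 < t" "t < 1" "s = curve G e t"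
proof -
  have "s \<in> verts G \<or> (\<exists>e\<in>edges G. \<exists>t\<in>{0..1}. s = curve G e t)" using assms unfolding skel_def by auto
  then show thesis
  proof (elim disjE bexE)
    fix e and t :: real assume e: "e \<in> edges G" "t \<in> {0..1}" "s = curve G e t"
    show thesis
    proof (cases "t = 0 \<or> t = 1")
      case True
      then show ?thesis using e curve_ends[OF e(1)] that(1) by auto
    next
      case False
      then show ?thesis using e that(2)[of e t] by auto
    qed
  qed (use that in auto)
qed

lemma vertex_preimage:
  assumes "f \<in> F" "y \<in> disc" "\<Phi> f y \<in> verts G"
  obtains k where "k < 4" "y = side k 0"
proof -
  have "norm y = 1" using assms Phi_skel_iff[of f y] unfolding skel_def by blast
  then obtain k t where kt: "k < 4" "0 \<le> t" "t < 1" "y = side k t" by (rule sphere_side)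
  have "t = 0"
  proof (rule ccontr)
    assume "t \<noteq> 0"
    then have "0 < t" using kt by simp
    then have "\<Phi> f y \<notin> verts G"
      using kt Phi_side[OF assms(1) kt(1), of t]
        curve_interior[OF W_edge[OF assms(1) kt(1)] dirpar_pos, of t "snd (W f ! k)"] by simp
    then show False using assms(3) by simp
  qed
  then show thesis using that kt by simp
qed

lemma near_face:
  assumes "f0 \<in> F" "norm x0 < 1" "s = \<Phi> f0 x0" "near (1 - norm x0) s s' k"
  shows "k = \<one>"
proof -
  obtain f x y where *: "f \<in> F" "x \<in> disc" "y \<in> disc" "\<Phi> f x = s" "\<Phi> f y = s'"
    "dist x y < 1 - norm x0" "k = disp f x y" using assms(4) unfolding near_def by blast
  have "f = f0 \<and> x = x0" using Phi_eq_interior[OF assms(1) *(1) assms(2) *(2)] assms(3) *(4) by simp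
  moreover have "norm y < 1"
    using *(6) calculation norm_triangle_ineq2[of y x] by (simp add: dist_norm norm_minus_commute)
  ultimately show ?thesis using * assms(2) disp_self[of f x y] by (simp add: cf_interior)
qed

text \<open>At this scale the preimage of \<open>s'\<close> lies in the quadrant of the side
  carrying the edge. If \<open>s'\<close> is off the skeleton, it determines face and side, even
  when both sides of the edge belong to one face; otherwise \<open>s'\<close> lies on the same edge,
  with the same base vertex, and the displacement is trivial.\<close>

lemma near_edge_point:
  assumes e: "e \<in> edges G" "0 < t" "t < 1"
    and \<epsilon>: "\<And>k b. k < 4 \<Longrightarrow> ball (side k (dirpar b t)) \<epsilon> \<subseteq> sector k"
    and n: "near \<epsilon> (curve G e t) s' \<kappa>" "near \<epsilon> (curve G e t) s' \<kappa>'"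
  shows "\<kappa> = \<kappa>'"
proof -
  have unpack: "\<exists>f k y. f \<in> F \<and> k < 4 \<and> y \<in> disc \<and> \<Phi> f y = s' \<and> y \<in> sector k \<and>
      \<kappa> = disp f (side k (dirpar (snd (W f ! k)) t)) y"
    if n: "near \<epsilon> (curve G e t) s' \<kappa>" for \<kappa>
  proof -
    obtain f x y where *: "f \<in> F" "x \<in> disc" "y \<in> disc" "\<Phi> f x = curve G e t" "\<Phi> f y = s'"
      "dist x y < \<epsilon>" "\<kappa> = disp f x y" using n unfolding near_def by blast
    obtain k where k: "(f, k) \<in> places e" "x = side k (dirpar (snd (W f ! k)) t)"
      by (rule edge_point_preimage[OF e *(1,2,4)])
    then have "k < 4" by (simp add: places_def)
    then have "y \<in> sector k" using \<epsilon>[of k "snd (W f ! k)"] * k by auto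
    then show ?thesis using * k \<open>k < 4\<close> by blast
  qed
  obtain f k y where 1: "f \<in> F" "k < 4" "y \<in> disc" "\<Phi> f y = s'" "y \<in> sector k"
      "\<kappa> = disp f (side k (dirpar (snd (W f ! k)) t)) y" using unpack[OF n(1)] by blast
  obtain f' k' y' where 2: "f' \<in> F" "k' < 4" "y' \<in> disc" "\<Phi> f' y' = s'" "y' \<in> sector k'"
      "\<kappa>' = disp f' (side k' (dirpar (snd (W f' ! k')) t)) y'" using unpack[OF n(2)] by blast
  show ?thesis
  proof (cases "norm y < 1")
    case True
    have "f' = f \<and> y' = y" using Phi_eq_interior[OF 1(1) 2(1) True 2(3)] 1 2 by simp
    moreover from this have "k' = k" using sector_disjoint[OF 2(2) 1(2)] 1 2 by simp
    ultimately show ?thesis using 1 2 by simp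
  next
    case False
    have one: "disp f (side k (dirpar b t)) y  = \<one>" if h: "f \<in> F" "k < 4" "norm y = 1" "y \<in> sector k" for f k y b
    proof -
      obtain j u where u: "j < 4" "0 \<le> u" "u < 1" "y = side j u" by (rule sphere_side[OF h(3)])
      have "j = k" "0 < u" using side_sector_iff[OF u(1) h(2) u(2,3)] h(4) u(4) by auto
      then show ?thesis
        using u h dirpar_pos[OF e(2,3), of b] by (intro disp_self) (auto simp: cf_side)
    qed
    have "norm y = 1" using False 1(3) by simp
    moreover from this have "norm y' = 1"
      using Phi_skel_iff[OF 1(1,3)] Phi_skel_iff[OF 2(1,3)] 1(4) 2(4) by simp
    ultimately show ?thesis using one 1 2 by simp
  qed
qed

lemma near_vertex_unpack:
  assumes "s \<in> verts G" "near (1/2) s s' \<kappa>"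
  obtains f k y where "f \<in> F" "k < 4" "y \<in> disc" "\<Phi> f (side k 0) = s" "\<Phi> f y = s'"
    "dist (side k 0) y < 1/2" "\<kappa> = disp f (side k 0) y"
proof -
  obtain f x y where *: "f \<in> F" "x \<in> disc" "y \<in> disc" "\<Phi> f x = s" "\<Phi> f y = s'"
    "dist x y < 1/2" "\<kappa> = disp f x y" using assms(2) unfolding near_def by blast
  obtain k where "k < 4" "x = side k 0" using vertex_preimage[OF *(1,2)] *(4) assms(1) by metis
  then show thesis using * that by blast
qed

text \<open>The value is the label from \<open>s\<close> to the base vertex of \<open>e\<close>. It
  depends only on which end of \<open>e\<close> is \<open>s\<close>, and this is unambiguous as
  there are no loops.\<close>

lemma near_vertex_edge:
  assumes s: "s \<in> verts G" and n: "near (1/2) s (curve G e u) \<kappa>" and e: "e \<in> edges G" "0 < u" "u < 1"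
  shows "\<kappa> = (if s = curve G e 0 then \<one> else X (e, False))"
proof -
  obtain f k y where *: "f \<in> F" "k < 4" "y \<in> disc" "\<Phi> f (side k 0) = s" "\<Phi> f y = curve G e u"
    "dist (side k 0) y < 1/2" "\<kappa> = disp f (side k 0) y" by (rule near_vertex_unpack[OF s n])
  obtain j where j: "(f, j) \<in> places e" "y = side j (dirpar (snd (W f ! j)) u)"
    by (rule edge_point_preimage[OF e *(1,3,5)])
  let ?b = "snd (W f ! j)"
  have j4: "j < 4" "W f ! j = (e, ?b)" "fst (W f ! j) = e" using j(1) by (auto simp: places_def)
  have b: "0 < dirpar ?b u" "dirpar ?b u < 1" using dirpar_pos[OF e(2,3)] by auto
  have cfy: "cf f y = (if ?b then pre f j else pre f (Suc j))"
    using cf_side[OF j4(1), of "dirpar ?b u" f] b j(2) by simp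
  have cfk: "cf f (side k 0) = pre f k" using cf_side[OF *(2), of 0 f] by simp
  have preS: "pre f (Suc j) = pre f j \<otimes> X (e, ?b)" using pre_Suc[OF *(1) j4(1)] j4(2) by simp
  have Xc: "X (e, b) \<in> carrier K" for b using X_carrier e(1) by blast
  have pc: "pre f i \<in> carrier K" for i using pre_carrier *(1) by blast
  have ends: "curve G e 0 \<noteq> curve G e 1" using curve_ends_ne e(1) by blast
  have "y \<in> sector j" unfolding j(2) using b by (rule side_in_sector)
  then consider "j = k" | "Suc j mod 4 = k"
    using sector_near_corner[OF j4(1) *(2)] *(6) by (auto simp: dist_commute)
  then show ?thesis
  proof cases
    case 1
    have "s = curve G e (dirpar ?b 0)" using Phi_side[OF *(1) j4(1), of 0] *(4) 1 j4(3) by simp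
    moreover have "\<kappa> = inv (pre f j) \<otimes> (if ?b then pre f j else pre f j \<otimes> X (e, ?b))"
      using *(7) cfy cfk preS 1 by (simp add: disp_def)
    ultimately show ?thesis using ends pc[of j] Xc
      by (cases ?b) (auto simp: dirpar_def m_assoc[symmetric])
  next
    case 2
    have "side (Suc j) 0 = side k 0" "pre f (Suc j) = pre f k"
    proof -
      \<comment> \<open>Side \<open>3\<close> ends at corner \<open>0\<close>; this is where the
        triviality of the face label enters.\<close>
      have "Suc j = k \<or> Suc j = 4 \<and> k = 0" using 2 j4(1) by (cases "Suc j = 4") auto
      then show "side (Suc j) 0 = side k 0" "pre f (Suc j) = pre f k"
        using pre_4[OF *(1)] unfolding side_0 by (metis i4 power_0, metis pre_0)
    qed
    then have s1: "s = curve G e (dirpar ?b 1)" and pk: "pre f k = pre f (Suc j)"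
      using Phi_side[OF *(1) j4(1), of 1] *(4) j4(3) side_1[of j] by simp_all
    have k: "\<kappa> = inv (pre f j \<otimes> X (e, ?b)) \<otimes> (if ?b then pre f j else pre f j \<otimes> X (e, ?b))"
      using *(7) cfy cfk preS pk by (simp add: disp_def)
    show ?thesis
    proof (cases ?b)
      case True
      then have "\<kappa> = inv X (e, True) \<otimes> (inv (pre f j) \<otimes> pre f j)"
        using k pc[of j] Xc[of True] by (simp add: inv_mult_group m_assoc)
      then show ?thesis using True s1 ends pc[of j] Xc[of True] X_inv[OF e(1)] by (simp add: dirpar_def)
    next
      case False
      then show ?thesis using k s1 pc[of j] Xc[of False] by (simp add: dirpar_def)
    qed
  qed
qed

lemma near_vertex_vertex:
  assumes s: "s \<in> verts G" "s' \<in> verts G" and n: "near (1/2) s s' \<kappa>"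
  shows "\<kappa> = \<one>"
proof -
  obtain f k y where *: "f \<in> F" "k < 4" "y \<in> disc" "\<Phi> f (side k 0) = s" "\<Phi> f y = s'"
    "dist (side k 0) y < 1/2" "\<kappa> = disp f (side k 0) y" by (rule near_vertex_unpack[OF s(1) n])
  obtain j where "j < 4" "y = side j 0" using vertex_preimage[OF *(1,3)] *(5) s(2) by metis
  then have "y = side k 0" using corners_apart[of k j] * by auto
  then show ?thesis using * by (simp add: disp_self)
qed

text \<open>Local flatness: around a point of any kind of cell there is a scale at which all faces
  agree on the displacement.\<close>

lemma near_unique:
  assumes "s \<in> topspace S"
  obtains \<epsilon> where "\<epsilon> > 0" "\<And>s' \<kappa> \<kappa>'. near \<epsilon> s s' \<kappa> \<Longrightarrow> near \<epsilon> s s' \<kappa>' \<Longrightarrow> \<kappa> = \<kappa>'"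
proof (cases "s \<in> skel")
  case False
  obtain f x where fx: "f \<in> F" "x \<in> disc" "\<Phi> f x = s" using assms cover by auto
  then have x1: "norm x < 1" using False Phi_skel_iff[of f x] by auto
  have "\<kappa> = \<one>" if "near (1 - norm x) s s' \<kappa>" for s' \<kappa>
    using near_face[OF fx(1) x1 fx(3)[symmetric] that] by simp
  then show thesis using x1 by (intro that[of "1 - norm x"]) auto
next
  case True
  then show thesis
  proof (cases rule: skel_cases)
    case 1
    show thesis
    proof (rule that[of "1/2"])
      fix s' \<kappa> \<kappa>' assume n: "near (1/2) s s' \<kappa>" "near (1/2) s s' \<kappa>'"
      show "\<kappa> = \<kappa>'"
      proof (cases "s' \<in> skel")
        case True
        then show ?thesis
        proof (cases rule: skel_cases)
          case 1
          then show ?thesis using near_vertex_vertex \<open>s \<in> verts G\<close> n by metis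
        next
          case (2 e t)
          then show ?thesis using near_vertex_edge[OF \<open>s \<in> verts G\<close>] n by metis
        qed
      next
        case False
        obtain f k y where *: "f \<in> F" "k < 4" "y \<in> disc" "\<Phi> f (side k 0) = s" "\<Phi> f y = s'"
          "dist (side k 0) y < 1/2" "\<kappa> = disp f (side k 0) y" by (rule near_vertex_unpack[OF 1 n(1)])
        obtain f' k' y' where **: "f' \<in> F" "k' < 4" "y' \<in> disc" "\<Phi> f' (side k' 0) = s" "\<Phi> f' y' = s'"
          "dist (side k' 0) y' < 1/2" "\<kappa>' = disp f' (side k' 0) y'" by (rule near_vertex_unpack[OF 1 n(2)])
        have "norm y < 1" using False Phi_skel_iff[OF *(1,3)] * by auto
        then have "f' = f \<and> y' = y" using Phi_eq_interior[OF *(1) **(1) _ **(3)] *(5) **(5) by simp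
        \<comment> \<open>Two corners within \<open>1/2\<close> of the same point of the disc
          coincide.\<close>
        moreover from this have "k = k'"
          using * ** dist_triangle[of "side k 0" "side k' 0" y]
          by (intro corners_apart) (auto simp: dist_commute)
        ultimately show ?thesis using * ** by simp
      qed
    qed simp
  next
    case (2 e t)
    have "\<exists>\<epsilon>>0. ball (side k (dirpar b t)) \<epsilon> \<subseteq> sector k" for k b
    proof -
      have "side k (dirpar b t) \<in> sector k" using dirpar_pos[OF 2(2,3)] by (intro side_in_sector)
      then show ?thesis using open_sector[of k] unfolding open_contains_ball by blast
    qed
    then obtain r where r: "\<And>k b. r k b > 0 \<and> ball (side k (dirpar b t)) (r k b) \<subseteq> sector k"
      by metis
    \<comment> \<open>The minimum is over all four sides and both directions in which the edge may
      occur.\<close>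
    define \<epsilon> where "\<epsilon> = Min (case_prod r ` ({..<4} \<times> UNIV))"
    have "\<epsilon> > 0" unfolding \<epsilon>_def by (subst Min_gr_iff) (auto simp: r lessThan_empty_iff)
    moreover have "ball (side k (dirpar b t)) \<epsilon> \<subseteq> sector k" if "k < 4" for k b
    proof -
      have "\<epsilon> \<le> r k b" unfolding \<epsilon>_def using that by (intro Min_le) force+
      then show ?thesis using r[of k b] subset_ball[of \<epsilon> "r k b"] by blast
    qed
    ultimately show thesis
      using near_edge_point[OF 2(1-3), of \<epsilon>] unfolding 2(4)[symmetric] by (intro that[of \<epsilon>]) blast+
  qed
qed

text \<open>The points at distance at least \<epsilon> from every preimage of \<open>s\<close> form
  a compact set in each disc; the images of these finitely many sets are closed and miss
  \<open>s\<close>.\<close>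

lemma preimages_near:
  assumes "s \<in> topspace S" "\<epsilon> > 0"
  obtains U where "openin S U" "s \<in> U"
    "\<And>f y. f \<in> F \<Longrightarrow> y \<in> disc \<Longrightarrow> \<Phi> f y \<in> U \<Longrightarrow> \<exists>x\<in>disc. \<Phi> f x = s \<and> dist x y < \<epsilon>"
proof -
  define A where "A = (\<lambda>f. {y \<in> disc. \<forall>x\<in>disc. \<Phi> f x = s \<longrightarrow> \<epsilon> \<le> dist x y})"
  have A: "closed (A f)" for f
  proof -
    have "A f = disc \<inter> (\<Inter>x\<in>{x\<in>disc. \<Phi> f x = s}. {y. \<epsilon> \<le> dist x y})" by (auto simp: A_def)
    then show ?thesis
      by (simp only:) (intro closed_Int closed_INT ballI closed_cball closed_Collect_le continuous_intros)
  qed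
  define U where "U = topspace S - (\<Union>f\<in>F. \<Phi> f ` A f)"
  have "closedin S (\<Phi> f ` A f)" if "f \<in> F" for f
    by (intro closed_Phi that A) (auto simp: A_def)
  then have "closedin S (\<Union>f\<in>F. \<Phi> f ` A f)"
    using finite_faces by (intro closedin_Union) auto
  then have "openin S U" unfolding U_def by blast
  moreover have "s \<in> U"
    using assms by (auto simp: U_def A_def)
  moreover have "\<exists>x\<in>disc. \<Phi> f x = s \<and> dist x y < \<epsilon>" if "f \<in> F" "y \<in> disc" "\<Phi> f y \<in> U" for f y
  proof (rule ccontr)
    assume "\<not> ?thesis"
    then have "y \<in> A f" using that by (auto simp: A_def)
    then show False using that by (auto simp: U_def)
  qed
  ultimately show thesis by (rule that)
qed

end

section \<open>Transport over the polygon\<close>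

text \<open>All generating pairs lie on the circle, so no interior point is identified with another
  point.\<close>

lemma equivclp_crosscap_pairing:
  "equivclp (crosscap_pairing g) x y \<Longrightarrow> x = y \<or> norm x = 1 \<and> norm y = 1"
  unfolding equivclp_def
proof (induction rule: rtranclp_induct)
  case (step y z)
  then show ?case by (auto simp: symclp_def crosscap_pairing_def)
qed auto

text \<open>\<open>p f\<close> is a point of the open polygon over the centre of \<open>f\<close>;
  the pulled back section will vanish there.\<close>

locale labelled_crosscap_surface = labelled_surface S G W \<Phi> K X sg
  for S :: "'a topology" and G :: "('a, 'e) drawing" and W \<Phi>
    and K :: "('k, 'm) monoid_scheme" (structure) and X sg +
  fixes g :: nat and q :: "complex \<Rightarrow> 'a" and p :: "'a set \<Rightarrow> complex"
  assumes g_pos: "g \<ge> 1" and q_quot: "quotient_map (top_of_set disc) S q"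
    and q_eq: "\<And>x y. x \<in> disc \<Longrightarrow> y \<in> disc \<Longrightarrow> q x = q y \<longleftrightarrow> equivclp (crosscap_pairing g) x y"
    and centre: "\<And>f. f \<in> faces S G \<Longrightarrow> p f \<in> ball 0 1 \<and> \<Phi> f 0 = q (p f)"
begin

lemma q_cont: "continuous_map (top_of_set disc) S q"
  using q_quot quotient_imp_continuous_map by blast

lemma q_top: "z \<in> disc \<Longrightarrow> q z \<in> topspace S"
  using continuous_map_image_subset_topspace[OF q_cont] by auto

lemma q_inj: "x \<in> ball 0 1 \<Longrightarrow> y \<in> disc \<Longrightarrow> q x = q y \<Longrightarrow> x = y"
  using q_eq[of x y] equivclp_crosscap_pairing[of g x y] by auto

definition rim :: "nat \<Rightarrow> real \<Rightarrow> complex" where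
  "rim k t = cis (2 * pi * (real k + t) / real (2 * g))"

lemma rim_sphere [simp]: "norm (rim k t) = 1" by (simp add: rim_def)

lemma rim_cont [continuous_intros]: "continuous_on A f \<Longrightarrow> continuous_on A (\<lambda>t. rim k (f t))"
  unfolding rim_def using g_pos by (intro continuous_intros) auto

lemma rim_1: "rim k 1 = rim (Suc k) 0" by (simp add: rim_def add.commute)

lemma q_rim: "j < g \<Longrightarrow> t \<in> {0..1} \<Longrightarrow> q (rim (2 * j) t) = q (rim (2 * j + 1) t)"
proof -
  assume "j < g" "t \<in> {0..1}"
  then have "crosscap_pairing g (rim (2 * j) t) (rim (2 * j + 1) t)"
    unfolding crosscap_pairing_def rim_def by blast
  then show ?thesis by (subst q_eq) (auto intro: r_into_equivclp)
qed

lemma q_preimage_nbhd: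
  assumes "openin S U" "a \<in> disc" "q a \<in> U"
  obtains d where "d > 0" "\<And>b. b \<in> disc \<Longrightarrow> dist a b < d \<Longrightarrow> q b \<in> U"
proof -
  have "openin (top_of_set disc) {x \<in> disc. q x \<in> U}"
    using openin_continuous_map_preimage[OF q_cont assms(1)] by simp
  then obtain d where "d > 0" "ball a d \<inter> disc \<subseteq> {x \<in> disc. q x \<in> U}"
    using assms(2,3) unfolding openin_contains_ball by blast
  then show thesis by (intro that[of d]) (auto simp: subset_iff)
qed

lemma face_point: "z \<in> disc \<Longrightarrow> \<exists>f\<in>F. \<exists>y\<in>disc. \<Phi> f y = q z"
  using q_top cover by (metis (no_types, lifting) UN_iff imageE)

lemma near_ex:
  assumes "a \<in> disc" "e > 0"
  obtains d where "d > 0" "\<And>b. b \<in> disc \<Longrightarrow> dist a b < d \<Longrightarrow>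
    \<exists>k. near e (q a) (q b) k"
proof -
  obtain U where U: "openin S U" "q a \<in> U"
    "\<And>f y. f \<in> F \<Longrightarrow> y \<in> disc \<Longrightarrow> \<Phi> f y \<in> U \<Longrightarrow> \<exists>x\<in>disc. \<Phi> f x = q a \<and> dist x y < e"
    using preimages_near[OF q_top[OF assms(1)] assms(2)] by blast
  obtain d where d: "d > 0" "\<And>b. b \<in> disc \<Longrightarrow> dist a b < d \<Longrightarrow> q b \<in> U"
    using q_preimage_nbhd[OF U(1) assms(1) U(2)] by blast
  show thesis
  proof (rule that[OF d(1)])
    fix b :: complex assume b: "b \<in> disc" "dist a b < d"
    obtain f y where fy: "f \<in> F" "y \<in> disc" "\<Phi> f y = q b" using face_point[OF b(1)] by blast
    then have "\<Phi> f y \<in> U" using d(2)[OF b] by simp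
    then show "\<exists>k. near e (q a) (q b) k"
      using U(3)[OF fy(1,2)] fy unfolding near_def by blast
  qed
qed

definition Rq :: "real \<Rightarrow> complex \<Rightarrow> complex \<Rightarrow> 'k \<Rightarrow> bool" where
  "Rq e a b k \<longleftrightarrow> near e (q a) (q b) k"

text \<open>This is \<open>parallel disc\<close> for the relation \<open>Rq\<close>.\<close>

definition transported :: "(complex \<Rightarrow> 'k) \<Rightarrow> bool" where
  "transported T \<longleftrightarrow> T \<in> disc \<rightarrow> carrier K \<and>
     (\<forall>a\<in>disc. \<exists>e>0. \<forall>b\<in>disc. dist a b < e \<longrightarrow>
       (\<forall>k. near e (q a) (q b) k \<longrightarrow> T b = T a \<otimes> k))"

lemma transported_carrier: "transported T \<Longrightarrow> z \<in> disc \<Longrightarrow> T z \<in> carrier K"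
  by (auto simp: transported_def)

lemma transported_step:
  assumes "transported T" "a \<in> disc"
  obtains e where "e > 0"
    "\<And>b k. b \<in> disc \<Longrightarrow> dist a b < e \<Longrightarrow> near e (q a) (q b) k \<Longrightarrow> T b = T a \<otimes> k"
  using assms unfolding transported_def by blast

text \<open>Around \<open>a\<close> the displacement from \<open>a\<close> is itself a parallel
  function, single-valued by \<open>near_unique\<close>. Convexity of the polygon turns local
  existence into global existence.\<close>

lemma transport_ex: "\<exists>T. transported T"
proof -
  interpret transport K Rq "disc"
  proof
    show "Rq d a b k" if "Rq e a b k" "e \<le> d" for e d a b k
      using that unfolding Rq_def near_def by force
    show "k \<in> carrier K" if "Rq e a b k" for e a b k
      using that disp_carrier unfolding Rq_def near_def by blast
    fix a :: complex and e :: real assume a: "a \<in> disc" "e > 0"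
    show "\<exists>d>0. \<forall>b\<in>disc. dist a b < d \<longrightarrow> (\<exists>k. Rq e a b k)"
      unfolding Rq_def by (rule near_ex[OF a]) blast
  qed
  have local: "\<exists>d>0. \<exists>T. parallel (disc \<inter> ball a d) T" if a: "a \<in> disc" for a
  proof -
    obtain e where e: "e > 0" "\<And>s' \<kappa> \<kappa>'. near e (q a) s' \<kappa> \<Longrightarrow> near e (q a) s' \<kappa>' \<Longrightarrow> \<kappa> = \<kappa>'"
      using near_unique[OF q_top[OF a]] by blast
    have e2: "e / 2 > 0" using e(1) by simp
    obtain U where U: "openin S U" "q a \<in> U"
      "\<And>f y. f \<in> F \<Longrightarrow> y \<in> disc \<Longrightarrow> \<Phi> f y \<in> U \<Longrightarrow> \<exists>x\<in>disc. \<Phi> f x = q a \<and> dist x y < e / 2"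
      using preimages_near[OF q_top[OF a] e2] by blast
    obtain d where d: "d > 0" "\<And>b. b \<in> disc \<Longrightarrow> dist a b < d \<Longrightarrow> q b \<in> U"
      using q_preimage_nbhd[OF U(1) a U(2)] by blast
    define T where "T = (\<lambda>b. SOME k. near e (q a) (q b) k)"
    have T: "T b = k" if "near e (q a) (q b) k" for b k
      unfolding T_def using e(2) that by (metis someI)
    have "T b \<in> carrier K" if b: "b \<in> disc \<inter> ball a d" for b
    proof -
      obtain f y where fy: "f \<in> F" "y \<in> disc" "\<Phi> f y = q b" using face_point b by blast
      then have "\<Phi> f y \<in> U" using d(2)[of b] b by simp
      then obtain x where "x \<in> disc" "\<Phi> f x = q a" "dist x y < e / 2" using U(3) fy by blast
      then have "near e (q a) (q b) (disp f x y)" unfolding near_def using fy e(1) by force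
      then show ?thesis using T disp_carrier fy by simp
    qed
    moreover have "T b = T c \<otimes> k" if c: "c \<in> disc \<inter> ball a d" and k: "near (e / 2) (q c) (q b) k" for b c k
    proof -
      obtain f x1 y where *: "f \<in> F" "x1 \<in> disc" "y \<in> disc" "\<Phi> f x1 = q c" "\<Phi> f y = q b"
        "dist x1 y < e / 2" "k = disp f x1 y" using k unfolding near_def by blast
      \<comment> \<open>A preimage of \<open>q a\<close> is found in the same disc as those of
        \<open>q c\<close> and \<open>q b\<close>, so that displacements compose; each of the two
        distances is below \<open>e / 2\<close>.\<close>
      have "\<Phi> f x1 \<in> U" using d(2)[of c] c *(4) by simp
      then obtain x where x: "x \<in> disc" "\<Phi> f x = q a" "dist x x1 < e / 2" using U(3) * by blast
      have "near e (q a) (q c) (disp f x x1)" unfolding near_def using * x e(1) by force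
      moreover have "dist x y < e" using x(3) *(6) dist_triangle_half_l[of x x1 e y] by (simp add: dist_commute)
      then have "near e (q a) (q b) (disp f x y)" unfolding near_def using * x by force
      ultimately show ?thesis using T *(7) disp_trans[OF *(1)] by simp
    qed
    ultimately have "parallel (disc \<inter> ball a d) T"
      unfolding parallel_def Rq_def using e2 by blast
    then show ?thesis using d(1) by blast
  qed
  interpret planar_transport K Rq "disc"
    by unfold_locales (auto intro: local)
  show ?thesis using parallel_ex unfolding parallel_def Rq_def transported_def .
qed

text \<open>The common value is \<open>1\<close> at a vertex and \<open>cis (pi * t)\<close> at
  parameter \<open>t\<close> of an edge, whatever the face. The factor \<open>(-1) ^ k\<close> from
  the preceding sides cancels against the sign of \<open>pre f k\<close>. On a side run backwards
  the base vertex is the far corner, and its additional sign turns the phase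
  \<open>pi * (t - 1)\<close> into \<open>pi * t\<close>.\<close>

lemma face_section:
  assumes f: "f \<in> F" "f' \<in> F" and y: "y \<in> disc" "y' \<in> disc" and eq: "\<Phi> f y = \<Phi> f' y'"
    and G: "\<And>f k t. f \<in> F \<Longrightarrow> k < 4 \<Longrightarrow> 0 \<le> t \<Longrightarrow> t < 1 \<Longrightarrow>
      Gf f (side k t) = (- 1) ^ k * cis (pi * (if snd (W f ! k) then t else - t))"
  shows "sg (cf f y) * Gf f y = sg (cf f' y') * Gf f' y'"
proof (cases "norm y < 1")
  case True
  then show ?thesis using Phi_eq_interior[OF f True y(2) eq] by simp
next
  case False
  then have "\<Phi> f y \<in> skel" using Phi_skel_iff[OF f(1) y(1)] y(1) by simp
  then show ?thesis
  proof (cases rule: skel_cases)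
    case 1
    have "sg (cf f y) * Gf f y = 1" if "f \<in> F" "y \<in> disc" "\<Phi> f y \<in> verts G" for f y
    proof -
      obtain k where k: "k < 4" "y = side k 0" using vertex_preimage[OF \<open>f \<in> F\<close> \<open>y \<in> disc\<close> \<open>\<Phi> f y \<in> verts G\<close>] .
      then show ?thesis using sg_pre[OF \<open>f \<in> F\<close>, of k] cf_side[of k 0 f] G[OF \<open>f \<in> F\<close>, of k 0]
        by (simp add: power_mult_distrib[symmetric])
    qed
    then show ?thesis using f y eq 1 by simp
  next
    case (2 e t)
    have "sg (cf f y) * Gf f y = cis (pi * t)" if h: "f \<in> F" "y \<in> disc" "\<Phi> f y = curve G e t" for f y
    proof -
      obtain k where k: "(f, k) \<in> places e" "y = side k (dirpar (snd (W f ! k)) t)"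
        by (rule edge_point_preimage[OF 2(1-3) h])
      have k4: "k < 4" using k by (simp add: places_def)
      let ?u = "dirpar (snd (W f ! k)) t"
      have u: "0 < ?u" "?u < 1" using dirpar_pos[OF 2(2,3)] by auto
      have c: "cf f y = (if snd (W f ! k) then pre f k else pre f (Suc k))"
        unfolding k(2) using cf_side[OF k4, of ?u f] u by simp
      have Gy: "Gf f y = (- 1) ^ k * cis (pi * (if snd (W f ! k) then ?u else - ?u))"
        unfolding k(2) using G[OF h(1) k4, of ?u] u by simp
      have sq: "(- 1) ^ k * ((- 1) ^ k * z) = z" for z :: complex
        by (simp add: mult.assoc[symmetric] power_mult_distrib[symmetric])
      show ?thesis
      proof (cases "snd (W f ! k)")
        case True
        then show ?thesis using c Gy sg_pre[OF h(1), of k] k4 sq by (simp add: dirpar_def)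
      next
        case False
        have "cis (pi * (t - 1)) = - cis (pi * t)"
          by (simp add: right_diff_distrib cis_divide[symmetric])
        moreover have "sg (cf f y) = - ((- 1) ^ k)" using c False sg_pre[OF h(1), of "Suc k"] k4 by simp
        moreover have "Gf f y = (- 1) ^ k * cis (pi * (t - 1))" using Gy False by (simp add: dirpar_def)
        ultimately show ?thesis using sq by simp
      qed
    qed
    then show ?thesis using f y eq 2 by simp
  qed
qed

lemma sg_norm: "x \<in> carrier K \<Longrightarrow> norm (sg x) = 1"
  using sg_sq[of x] by (metis norm_mult norm_one norm_ge_zero abs_of_nonneg abs_square_eq_1 power2_eq_square)

lemma sg_disp: "f \<in> F \<Longrightarrow> sg (disp f x y) = sg (cf f x) * sg (cf f y)"
  by (simp add: disp_def sg_mult cf_carrier sg_inv)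

text \<open>The coordinate is \<open>q\<close> followed by the inverse of \<Phi> f. It is injective
  because \<open>q\<close> identifies no interior points of the polygon, as
  \<open>odd_degree_injective\<close> requires.\<close>

lemma q_face_coordinates:
  assumes "f \<in> F"
  obtains h r where "r > 0" "cball (p f) r \<subseteq> ball 0 1" "continuous_on (cball (p f) r) h" "inj_on h (cball (p f) r)"
    "h (p f) = 0" "\<And>z. z \<in> cball (p f) r \<Longrightarrow> h z \<in> ball 0 1 \<and> \<Phi> f (h z) = q z"
proof -
  note pf = centre[OF assms]
  have "continuous_map (top_of_set (ball 0 1)) S (\<Phi> f)"
    by (rule continuous_map_from_subtopology_mono[OF Phi_cont[OF assms]]) (rule ball_subset_cball)
  then have "openin S (\<Phi> f ` ball 0 1)"
    using surface_open_image[OF surf open_ball _ Phi_inj[OF assms]] by blast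
  then have f_open: "openin S f" using Phi_ball[OF assms] by simp
  obtain \<psi> where \<psi>: "homeomorphic_maps (top_of_set (ball 0 1)) (subtopology S f) (\<Phi> f) \<psi>"
    using Phi_homeo[OF assms] homeomorphic_map_maps by blast
  have top_f: "topspace (subtopology S f) = f"
    by (rule topspace_subtopology_subset[OF openin_subset[OF f_open]])
  have \<psi>_cont: "continuous_map (subtopology S f) (top_of_set (ball 0 1)) \<psi>"
    and \<psi>1: "\<And>y. y \<in> ball 0 1 \<Longrightarrow> \<psi> (\<Phi> f y) = y" and \<psi>2: "\<And>x. x \<in> f \<Longrightarrow> \<Phi> f (\<psi> x) = x"
    using \<psi> top_f unfolding homeomorphic_maps_def by auto
  have \<psi>3: "\<psi> x \<in> ball 0 1" if "x \<in> f" for x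
    using continuous_map_image_subset_topspace[OF \<psi>_cont] that top_f by auto
  have pf1: "p f \<in> disc" using pf by auto
  have "q (p f) \<in> f" using pf Phi_ball[OF assms] by (metis centre_in_ball image_eqI zero_less_one)
  then obtain d where d: "d > 0" "\<And>b. b \<in> disc \<Longrightarrow> dist (p f) b < d \<Longrightarrow> q b \<in> f"
    using q_preimage_nbhd[OF f_open pf1] by blast
  obtain d' where d': "d' > 0" "cball (p f) d' \<subseteq> ball 0 1"
    using pf open_contains_cball_eq[OF open_ball] by blast
  define r where "r = min (d / 2) d'"
  have r: "r > 0" "cball (p f) r \<subseteq> ball 0 1" using d d' by (auto simp: r_def)
  have qf: "q z \<in> f" if "z \<in> cball (p f) r" for z
  proof (rule d(2))
    show "z \<in> disc" using that r(2) ball_subset_cball by blast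
    show "dist (p f) z < d" using that d(1) by (simp add: r_def)
  qed
  show thesis
  proof (rule that[of r "\<psi> \<circ> q"])
    have "cball (p f) r \<subseteq> disc" using r(2) ball_subset_cball by blast
    then have "continuous_map (top_of_set (cball (p f) r)) (subtopology S f) q"
      using qf continuous_map_from_subtopology_mono[OF q_cont, of "cball (p f) r"]
      by (auto simp: continuous_map_in_subtopology)
    from continuous_map_compose[OF this \<psi>_cont]
    show "continuous_on (cball (p f) r) (\<psi> \<circ> q)"
      by (simp add: continuous_map_in_subtopology)
    show "inj_on (\<psi> \<circ> q) (cball (p f) r)"
    proof (rule inj_onI)
      fix z z' assume z: "z \<in> cball (p f) r" "z' \<in> cball (p f) r" "(\<psi> \<circ> q) z = (\<psi> \<circ> q) z'"
      then have "\<Phi> f (\<psi> (q z)) = \<Phi> f (\<psi> (q z'))" by simp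
      then have "q z = q z'" by (simp only: \<psi>2[OF qf[OF z(1)]] \<psi>2[OF qf[OF z(2)]])
      moreover have "z \<in> ball 0 1" "z' \<in> ball 0 1" using z(1,2) r(2) by blast+
      ultimately show "z = z'" using q_inj[of z z'] ball_subset_cball by blast
    qed
    show "(\<psi> \<circ> q) (p f) = 0" using \<psi>1[of 0] pf by simp
    show "(\<psi> \<circ> q) z \<in> ball 0 1 \<and> \<Phi> f ((\<psi> \<circ> q) z) = q z" if "z \<in> cball (p f) r" for z
      using \<psi>2[OF qf[OF that]] \<psi>3[OF qf[OF that]] by simp
  qed (use r in auto)
qed

text \<open>The index at the centre of the section over \<open>f\<close>, in the coordinates of the
  face disc.\<close>

definition turning :: "'a set \<Rightarrow> int" where
  "turning f = int (card {k. k < 4 \<and> snd (W f ! k)}) - 2"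

lemma p_inj: "inj_on p F"
proof (rule inj_onI)
  fix f f' assume f: "f \<in> F" "f' \<in> F" "p f = p f'"
  then have "\<Phi> f 0 = \<Phi> f' 0" using centre by metis
  then show "f = f'" using Phi_eq_interior[OF f(1,2), of 0 0] by simp
qed

text \<open>\<open>u\<close> is the sign of \<open>T\<close> times the section glued from the faces.
  Where the cell changes, the signs of \<open>T z\<close> and of \<open>cf f y\<close> jump
  together, so \<open>u\<close> is continuous; it vanishes precisely at the points
  \<open>p f\<close>.\<close>

lemma transported_section:
  assumes T: "transported T"
  obtains u M where "circle_degree u M" "even (M - (\<Sum>f\<in>F. turning f))"
    "\<And>a b c. a \<in> disc \<Longrightarrow> b \<in> disc \<Longrightarrow> q a = q b \<Longrightarrow> c \<in> carrier K \<Longrightarrow> T b = c \<otimes> T a \<Longrightarrow> u b = sg c * u a"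
proof -
  have "\<exists>G. continuous_on UNIV G \<and> (\<forall>z. G z = 0 \<longleftrightarrow> z = 0) \<and>
    (\<forall>k t. k < 4 \<longrightarrow> 0 \<le> t \<longrightarrow> t < 1 \<longrightarrow> G (side k t) = (- 1) ^ k * cis (pi * (if snd (W f ! k) then t else - t))) \<and>
    (\<forall>h n. circle_degree h n \<longrightarrow> circle_degree (G \<circ> h) (n * turning f))" for f
    unfolding turning_def by (rule quadrilateral_section[of "\<lambda>k. snd (W f ! k)"]) blast
  then obtain Gf where Gf: "\<And>f. continuous_on UNIV (Gf f)" "\<And>f z. Gf f z = 0 \<longleftrightarrow> z = 0"
    "\<And>f k t. k < 4 \<Longrightarrow> 0 \<le> t \<Longrightarrow> t < 1 \<Longrightarrow> Gf f (side k t) = (- 1) ^ k * cis (pi * (if snd (W f ! k) then t else - t))"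
    "\<And>f h n. circle_degree h n \<Longrightarrow> circle_degree (Gf f \<circ> h) (n * turning f)"
    by metis
  define sel where "sel = (\<lambda>z. SOME fy. fst fy \<in> F \<and> snd fy \<in> disc \<and> \<Phi> (fst fy) (snd fy) = q z)"
  define uc where "uc = (\<lambda>fy. sg (cf (fst fy) (snd fy)) * Gf (fst fy) (snd fy))"
  define u where "u = (\<lambda>z. sg (T z) * uc (sel z))"
  have sel: "fst (sel z) \<in> F \<and> snd (sel z) \<in> disc \<and> \<Phi> (fst (sel z)) (snd (sel z)) = q z" if z: "z \<in> disc" for z
  proof -
    have "\<exists>fy. fst fy \<in> F \<and> snd fy \<in> disc \<and> \<Phi> (fst fy) (snd fy) = q z"
      using face_point[OF z] by (metis fst_conv snd_conv)
    then show ?thesis unfolding sel_def by (rule someI_ex)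
  qed
  have u: "u z = sg (T z) * (sg (cf f y) * Gf f y)"
    if "z \<in> disc" "f \<in> F" "y \<in> disc" "\<Phi> f y = q z" for z f y
    using sel[OF that(1)] face_section[of "fst (sel z)" f "snd (sel z)" y Gf] that Gf(3)
    unfolding u_def uc_def by simp
  have Tc: "T z \<in> carrier K" if "z \<in> disc" for z using transported_carrier[OF T that] .
  have sgT: "sg (T z) \<noteq> 0" if "z \<in> disc" for z using sg_norm[OF Tc[OF that]] by auto
  \<comment> \<open>Near \<open>a\<close> the sign is frozen at its value at \<open>a\<close>, and
    \<open>u\<close> is a constant times \<open>Gf f\<close> in face coordinates. Both continuity
    and the indices follow from this formula.\<close>
  have u_near: "\<exists>e>0. \<forall>b\<in>disc. dist a b < e \<longrightarrow> (\<forall>f\<in>F. \<forall>x\<in>disc. \<forall>y\<in>disc.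
      \<Phi> f x = q a \<longrightarrow> \<Phi> f y = q b \<longrightarrow> dist x y < e \<longrightarrow> u b = sg (T a) * sg (cf f x) * Gf f y)"
    if a: "a \<in> disc" for a
  proof -
    obtain e where e: "e > 0" "\<And>b k. b \<in> disc \<Longrightarrow> dist a b < e \<Longrightarrow> near e (q a) (q b) k \<Longrightarrow> T b = T a \<otimes> k"
      by (rule transported_step[OF T a]) (rule that)
    show ?thesis
    proof (intro exI[of _ e] conjI ballI impI)
      fix b f x y assume *: "b \<in> disc" "dist a b < e" "f \<in> F" "x \<in> disc" "y \<in> disc"
        "\<Phi> f x = q a" "\<Phi> f y = q b" "dist x y < e"
      then have "near e (q a) (q b) (disp f x y)" unfolding near_def by blast
      then have "T b = T a \<otimes> disp f x y" using e(2) * by blast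
      then have "sg (T b) = sg (T a) * (sg (cf f x) * sg (cf f y))"
        using sg_mult[OF Tc[OF a] disp_carrier] sg_disp *(3) by simp
      moreover have "sg (cf f y) * sg (cf f y) = 1" using sg_sq cf_carrier *(3) by blast
      ultimately show "u b = sg (T a) * sg (cf f x) * Gf f y"
        using u[OF *(1,3,5,7)] by (simp add: algebra_simps)
    qed (rule e(1))
  qed
  have u_cont: "continuous_on disc u"
    unfolding continuous_on_iff
  proof (intro ballI allI impI)
    fix a :: complex and \<eta> :: real assume a: "a \<in> disc" and \<eta>: "0 < \<eta>"
    obtain e where e: "e > 0" "\<And>b f x y. b \<in> disc \<Longrightarrow> dist a b < e \<Longrightarrow> f \<in> F \<Longrightarrow> x \<in> disc \<Longrightarrow> y \<in> disc \<Longrightarrow>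
      \<Phi> f x = q a \<Longrightarrow> \<Phi> f y = q b \<Longrightarrow> dist x y < e \<Longrightarrow> u b = sg (T a) * sg (cf f x) * Gf f y"
      using u_near[OF a] by blast
    have "\<exists>d>0. \<forall>x\<in>disc. \<forall>y\<in>disc. dist y x < d \<longrightarrow> dist (Gf f y) (Gf f x) < \<eta>" for f
    proof -
      have "uniformly_continuous_on disc (Gf f)"
        using Gf(1) by (intro compact_uniformly_continuous compact_cball) (rule continuous_on_subset, auto)
      then show ?thesis using \<eta> unfolding uniformly_continuous_on_def by blast
    qed
    then obtain \<delta> where \<delta>: "\<And>f. \<delta> f > 0 \<and> (\<forall>x\<in>disc. \<forall>y\<in>disc. dist y x < \<delta> f \<longrightarrow> dist (Gf f y) (Gf f x) < \<eta>)"
      by metis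
    \<comment> \<open>One modulus of continuity for all faces, since the face through which
      \<open>b\<close> is reached may vary with \<open>b\<close>.\<close>
    define m where "m = Min (insert e (\<delta> ` F))"
    have m: "m > 0" "m \<le> e" "\<And>f. f \<in> F \<Longrightarrow> m \<le> \<delta> f"
      unfolding m_def using finite_faces e(1) \<delta> by auto
    obtain d where d: "d > 0" "\<And>b. b \<in> disc \<Longrightarrow> dist a b < d \<Longrightarrow>
      \<exists>k. near m (q a) (q b) k"
      using near_ex[OF a m(1)] by blast
    show "\<exists>d>0. \<forall>b\<in>disc. dist b a < d \<longrightarrow> dist (u b) (u a) < \<eta>"
    proof (intro exI[of _ "min d e"] conjI ballI impI)
      fix b :: complex assume b: "b \<in> disc" "dist b a < min d e"
      then have ab: "dist a b < d" "dist a b < e" by (auto simp: dist_commute)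
      obtain f x y where *: "f \<in> F" "x \<in> disc" "y \<in> disc" "\<Phi> f x = q a" "\<Phi> f y = q b" "dist x y < m"
        using d(2)[OF b(1) ab(1)] unfolding near_def by blast
      have "u b = sg (T a) * sg (cf f x) * Gf f y"
        using e(2)[OF b(1) ab(2) *(1-5)] *(6) m(2) by simp
      moreover have "u a = sg (T a) * sg (cf f x) * Gf f x"
        using u[OF a *(1,2,4)] by simp
      ultimately have "dist (u b) (u a) = dist (Gf f y) (Gf f x)"
        using sg_norm[OF Tc[OF a]] sg_norm[OF cf_carrier[OF *(1)], of x]
        by (simp add: dist_norm norm_mult flip: right_diff_distrib)
      also have "\<dots> < \<eta>" using \<delta>[of f] *(2,3,6) m(3)[OF *(1)] by (auto simp: dist_commute)
      finally show "dist (u b) (u a) < \<eta>" .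
    qed (use d e in auto)
  qed
  have u_zero: "u z = 0 \<longleftrightarrow> z \<in> p ` F" if z: "z \<in> disc" for z
  proof
    assume "u z = 0"
    obtain f y where fy: "f \<in> F" "y \<in> disc" "\<Phi> f y = q z" using face_point[OF z] by blast
    have "sg (cf f y) \<noteq> 0" using sg_norm[OF cf_carrier[OF fy(1)], of y] by auto
    then have "y = 0" using u[OF z fy] \<open>u z = 0\<close> sgT[OF z] Gf(2) by auto
    then have "q (p f) = q z" using centre[OF fy(1)] fy(3) by simp
    then have "p f = z" using q_inj[of "p f" z] centre[OF fy(1)] z by blast
    then show "z \<in> p ` F" using fy(1) by blast
  next
    assume "z \<in> p ` F"
    then obtain f where f: "f \<in> F" "z = p f" by blast
    then have "\<Phi> f 0 = q z" using centre by simp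
    then have "u z = sg (T z) * (sg (cf f 0) * Gf f 0)" using u[OF z f(1)] by simp
    then show "u z = 0" using Gf(2) by simp
  qed
  have u_deg: "\<exists>r0>0. \<forall>r. 0 < r \<and> r < r0 \<longrightarrow>
      (\<exists>m. circle_degree (\<lambda>\<xi>. u (p f + of_real r * \<xi>)) m \<and> even (m - turning f))" if f: "f \<in> F" for f
  proof -
    obtain h r1 where h: "r1 > 0" "cball (p f) r1 \<subseteq> ball 0 1" "continuous_on (cball (p f) r1) h"
      "inj_on h (cball (p f) r1)" "h (p f) = 0" "\<And>z. z \<in> cball (p f) r1 \<Longrightarrow> h z \<in> ball 0 1 \<and> \<Phi> f (h z) = q z"
      by (rule q_face_coordinates[OF f]) (rule that)
    have pf: "p f \<in> disc" using centre[OF f] by auto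
    obtain e where e: "e > 0" "\<And>b f' x y. b \<in> disc \<Longrightarrow> dist (p f) b < e \<Longrightarrow> f' \<in> F \<Longrightarrow> x \<in> disc \<Longrightarrow> y \<in> disc \<Longrightarrow>
      \<Phi> f' x = q (p f) \<Longrightarrow> \<Phi> f' y = q b \<Longrightarrow> dist x y < e \<Longrightarrow> u b = sg (T (p f)) * sg (cf f' x) * Gf f' y"
      using u_near[OF pf] by blast
    obtain d where d: "d > 0" "\<And>z. z \<in> cball (p f) r1 \<Longrightarrow> dist z (p f) < d \<Longrightarrow> dist (h z) (h (p f)) < e"
    proof -
      have "p f \<in> cball (p f) r1" using h(1) by simp
      then show thesis using h(3) e(1) that unfolding continuous_on_iff by blast
    qed
    show ?thesis
    proof (intro exI[of _ "min r1 (min d e)"] conjI allI impI)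
      show "0 < min r1 (min d e)" using h(1) d(1) e(1) by simp
      fix r assume r: "0 < r \<and> r < min r1 (min d e)"
      have sub: "cball (p f) r \<subseteq> cball (p f) r1" using r by (intro subset_cball) auto
      \<comment> \<open>The change of coordinates has odd degree \<open>n\<close>, so the index
        \<open>n * turning f\<close> has the parity of \<open>turning f\<close>.\<close>
      obtain n L where nL: "odd n" "continuous_on (sphere 0 1) L"
        "\<And>\<xi>. \<xi> \<in> sphere 0 1 \<Longrightarrow> h (p f + of_real r * \<xi>) - h (p f) = \<xi> powi n * exp (L \<xi>)"
        using odd_degree_injective[OF continuous_on_subset[OF h(3) sub] inj_on_subset[OF h(4) sub]] r by blast
      have "circle_degree (\<lambda>\<xi>. h (p f + of_real r * \<xi>)) n"
        using nL h(5) by (intro circle_degreeI[of L]) auto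
      from Gf(4)[OF this]
      have deg: "circle_degree (\<lambda>\<xi>. Gf f (h (p f + of_real r * \<xi>))) (n * turning f)"
        by (simp add: comp_def)
      have "circle_degree (\<lambda>_. sg (T (p f))) 0"
        using sgT[OF pf] by (intro circle_degree_0) auto
      from circle_degree_mult[OF this deg]
      have "circle_degree (\<lambda>\<xi>. sg (T (p f)) * Gf f (h (p f + of_real r * \<xi>))) (n * turning f)" by simp
      then have "circle_degree (\<lambda>\<xi>. u (p f + of_real r * \<xi>)) (n * turning f)"
      proof (rule circle_degree_cong)
        fix \<xi> :: complex assume "\<xi> \<in> sphere 0 1"
        define z where "z = p f + of_real r * \<xi>"
        have dz: "dist (p f) z = r" using \<open>\<xi> \<in> sphere 0 1\<close> r by (simp add: z_def dist_norm norm_mult)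
        have z: "z \<in> cball (p f) r1" using dz r by auto
        then have z1: "z \<in> disc" using h(2) ball_subset_cball by blast
        have hz: "h z \<in> ball 0 1" "\<Phi> f (h z) = q z" using h(6)[OF z] by auto
        have "dist 0 (h z) < e" using d(2)[OF z] dz r h(5) by (simp add: dist_commute)
        then have "u z = sg (T (p f)) * sg (cf f 0) * Gf f (h z)"
          using e(2)[OF z1 _ f _ _ _ hz(2), of 0] dz r hz(1) centre[OF f] by auto
        then show "u (p f + of_real r * \<xi>) = sg (T (p f)) * Gf f (h (p f + of_real r * \<xi>))"
          by (simp add: z_def cf_interior sg_one)
      qed
      moreover have "even (n * turning f - turning f)" using nL(1) by auto
      ultimately show "\<exists>m. circle_degree (\<lambda>\<xi>. u (p f + of_real r * \<xi>)) m \<and> even (m - turning f)" by blast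
    qed
  qed
  define d where "d = (\<lambda>z. turning (the_inv_into F p z))"
  have d: "d (p f) = turning f" if "f \<in> F" for f
    unfolding d_def using the_inv_into_f_f[OF p_inj that] by simp
  have "\<exists>M. circle_degree u M \<and> even (M - (\<Sum>z\<in>p ` F. d z))"
  proof (rule circle_degree_sum_zeros)
    show "finite (p ` F)" using finite_faces by simp
    show "p ` F \<subseteq> ball 0 1" using centre by auto
    show "\<exists>r0>0. \<forall>r. 0 < r \<and> r < r0 \<longrightarrow> (\<exists>m. circle_degree (\<lambda>\<xi>. u (z + of_real r * \<xi>)) m \<and> even (m - d z))"
      if "z \<in> p ` F" for z using u_deg d that by auto
  qed (use u_cont u_zero in auto)
  moreover have "(\<Sum>z\<in>p ` F. d z) = (\<Sum>f\<in>F. turning f)"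
    using d by (subst sum.reindex[OF p_inj]) simp
  ultimately obtain M where "circle_degree u M" "even (M - (\<Sum>f\<in>F. turning f))" by auto
  then show thesis
  proof (rule that)
    fix a b c assume ab: "a \<in> disc" "b \<in> disc" "q a = q b" and c: "c \<in> carrier K" "T b = c \<otimes> T a"
    obtain f y where fy: "f \<in> F" "y \<in> disc" "\<Phi> f y = q b" using face_point[OF ab(2)] by blast
    then show "u b = sg c * u a"
      using u[OF ab(2) fy] u[OF ab(1) fy(1,2)] ab(3) c sg_mult[OF c(1) Tc[OF ab(1)]] by simp
  qed
qed

text \<open>The two arcs have the same image under \<open>q\<close>, so \<open>T\<close> changes
  along them by the same right factors, and these cancel in the quotient \<open>w\<close>.\<close>

lemma rim_transport_const:
  assumes T: "transported T"
    and j: "j < g"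
  obtains z where "z \<in> carrier K" "\<And>t. t \<in> {0..1} \<Longrightarrow> T (rim (2 * j + 1) t) = z \<otimes> T (rim (2 * j) t)"
proof -
  let ?\<alpha> = "rim (2 * j)" and ?\<beta> = "rim (2 * j + 1)"
  define w where "w = (\<lambda>t. T (?\<beta> t) \<otimes> inv T (?\<alpha> t))"
  have Tc: "T (rim k t) \<in> carrier K" for k t using transported_carrier[OF T(1)] by simp
  have nb: "\<exists>\<delta>>0. \<forall>t. \<bar>t - s\<bar> < \<delta> \<longrightarrow> dist (rim k s) (rim k t) < e" if "e > 0" for k s e
  proof -
    have "continuous_on UNIV (rim k)" by (intro rim_cont continuous_on_id)
    then show ?thesis using that unfolding continuous_on_iff by (fastforce simp: dist_real_def dist_commute)
  qed
  have "w 0 = w t" if t: "t \<in> {0..1}" for t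
  proof (rule connected_equivalence_relation[OF connected_Icc, of 0 0 1 t])
    fix s :: real assume s: "s \<in> {0..1}"
    have a: "?\<alpha> s \<in> disc" "?\<beta> s \<in> disc" by auto
    obtain e1 where e1: "e1 > 0" "\<And>b k. b \<in> disc \<Longrightarrow> dist (?\<alpha> s) b < e1 \<Longrightarrow> near e1 (q (?\<alpha> s)) (q b) k \<Longrightarrow> T b = T (?\<alpha> s) \<otimes> k"
      by (rule transported_step[OF T(1) a(1)]) (rule that)
    obtain e2 where e2: "e2 > 0" "\<And>b k. b \<in> disc \<Longrightarrow> dist (?\<beta> s) b < e2 \<Longrightarrow> near e2 (q (?\<beta> s)) (q b) k \<Longrightarrow> T b = T (?\<beta> s) \<otimes> k"
      by (rule transported_step[OF T(1) a(2)]) (rule that)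
    have e: "min e1 e2 > 0" using e1 e2 by simp
    obtain d where d: "d > 0" "\<And>b. b \<in> disc \<Longrightarrow> dist (?\<alpha> s) b < d \<Longrightarrow>
      \<exists>k. near (min e1 e2) (q (?\<alpha> s)) (q b) k"
      using near_ex[OF a(1) e] by blast
    have de: "min d (min e1 e2) > 0" using d e by simp
    obtain \<delta>1 where \<delta>1: "\<delta>1 > 0" "\<And>t. \<bar>t - s\<bar> < \<delta>1 \<Longrightarrow> dist (?\<alpha> s) (?\<alpha> t) < min d (min e1 e2)"
      using nb[OF de] by blast
    obtain \<delta>2 where \<delta>2: "\<delta>2 > 0" "\<And>t. \<bar>t - s\<bar> < \<delta>2 \<Longrightarrow> dist (?\<beta> s) (?\<beta> t) < min d (min e1 e2)"
      using nb[OF de] by blast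
    show "\<exists>V. openin (top_of_set {0..1}) V \<and> s \<in> V \<and> (\<forall>t\<in>V. w s = w t)"
    proof (intro exI conjI ballI)
      show "openin (top_of_set {0..1}) ({0..1} \<inter> ball s (min \<delta>1 \<delta>2))" by blast
      show "s \<in> {0..1} \<inter> ball s (min \<delta>1 \<delta>2)" using s \<delta>1 \<delta>2 by auto
      fix t assume t: "t \<in> {0..1} \<inter> ball s (min \<delta>1 \<delta>2)"
      then have dt: "dist (?\<alpha> s) (?\<alpha> t) < min d (min e1 e2)" "dist (?\<beta> s) (?\<beta> t) < min d (min e1 e2)"
        using \<delta>1(2)[of t] \<delta>2(2)[of t] by (auto simp: dist_real_def abs_minus_commute)
      obtain k where n: "near (min e1 e2) (q (?\<alpha> s)) (q (?\<alpha> t)) k" using d(2)[of "?\<alpha> t"] dt(1) by auto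
      then have k: "k \<in> carrier K" using disp_carrier unfolding near_def by blast
      have n': "near e (q (?\<alpha> s)) (q (?\<alpha> t)) k" if "min e1 e2 \<le> e" for e
        using n that unfolding near_def by force
      have 1: "T (?\<alpha> t) = T (?\<alpha> s) \<otimes> k" using e1(2)[OF _ _ n'] dt by simp
      have "near e2 (q (?\<beta> s)) (q (?\<beta> t)) k" using n'[of e2] q_rim[OF j] s t by simp
      then have 2: "T (?\<beta> t) = T (?\<beta> s) \<otimes> k" using e2(2)[of "?\<beta> t"] dt by simp
      have "k \<otimes> (inv k \<otimes> inv T (?\<alpha> s)) = inv T (?\<alpha> s)" using k Tc by (simp add: m_assoc[symmetric])
      then show "w s = w t" unfolding w_def 1 2 using k Tc by (simp add: inv_mult_group m_assoc)
    qed
  qed (use t in auto)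
  then have "T (?\<beta> t) = w 0 \<otimes> T (?\<alpha> t)" if "t \<in> {0..1}" for t
    using that Tc by (simp add: w_def m_assoc)
  moreover have "w 0 \<in> carrier K" using Tc by (simp add: w_def)
  ultimately show thesis using that by blast
qed

text \<open>Each crosscap multiplies \<open>T\<close> twice from the left by \<open>z j\<close>, and
  after a full turn the initial value returns.\<close>

theorem squares_relation:
  assumes "odd (\<Sum>f\<in>F. turning f)"
  obtains zs where "set zs \<subseteq> carrier K" "length zs = g" "foldr (\<otimes>) (map (\<lambda>z. z \<otimes> z) zs) \<one> = \<one>"
    "sg (foldr (\<otimes>) zs \<one>) = - 1"
proof -
  obtain T where T: "transported T"
    using transport_ex by blast
  obtain u M where u: "circle_degree u M" "even (M - (\<Sum>f\<in>F. turning f))"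
    "\<And>a b c. a \<in> disc \<Longrightarrow> b \<in> disc \<Longrightarrow> q a = q b \<Longrightarrow> c \<in> carrier K \<Longrightarrow> T b = c \<otimes> T a \<Longrightarrow> u b = sg c * u a"
    by (rule transported_section[OF T]) (rule that)
  have "\<exists>z. z \<in> carrier K \<and> (\<forall>t\<in>{0..1}. T (rim (2 * j + 1) t) = z \<otimes> T (rim (2 * j) t))" if "j < g" for j
    by (rule rim_transport_const[OF T that]) blast
  then obtain z where z: "\<And>j. j < g \<Longrightarrow> z j \<in> carrier K"
    "\<And>j t. j < g \<Longrightarrow> t \<in> {0..1} \<Longrightarrow> T (rim (2 * j + 1) t) = z j \<otimes> T (rim (2 * j) t)"
    by metis
  have prod: "(\<Prod>j<g. sg (z j)) = - 1"
  proof (rule crosscap_sign_product[OF u(1) _ g_pos])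
    show "odd M" using u(2) assms by simp
    fix j t assume j: "j < g" and t: "t \<in> {0..1::real}"
    have "u (rim (2 * j + 1) t) = sg (z j) * u (rim (2 * j) t)"
      using z j t q_rim[OF j t] by (intro u(3)) auto
    then show "u (cis (2 * pi * (real (2 * j + 1) + t) / real (2 * g))) =
        sg (z j) * u (cis (2 * pi * (real (2 * j) + t) / real (2 * g)))" by (simp add: rim_def)
  qed
  \<comment> \<open>Later crosscaps multiply further to the left, hence the reversed order.\<close>
  define zs where "zs = (\<lambda>n. rev (map z [0..<n]))"
  have zs_Suc: "zs (Suc n) = z n # zs n" for n by (simp add: zs_def)
  have zs_carrier: "set (zs n) \<subseteq> carrier K" if "n \<le> g" for n using that z(1) by (auto simp: zs_def)
  have Tc: "T (rim k t) \<in> carrier K" for k t using transported_carrier[OF T(1)] by simp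
  let ?sq = "\<lambda>z. z \<otimes> z"
  have sq_carrier: "foldr (\<otimes>) (map ?sq (zs n)) \<one> \<in> carrier K" if "n \<le> g" for n
    using zs_carrier[OF that] by (intro foldr_mult_carrier) auto
  have tele: "foldr (\<otimes>) (map ?sq (zs n)) \<one> \<otimes> T (rim 0 0) = T (rim (2 * n) 0)" if "n \<le> g" for n
    using that
  proof (induction n)
    case (Suc n)
    then have n: "n < g" "n \<le> g" by auto
    have "T (rim (2 * Suc n) 0) = T (rim (2 * n + 1) 1)" using rim_1[of "2 * n + 1"] by simp
    also have "\<dots> = z n \<otimes> T (rim (2 * n) 1)" using z(2)[OF n(1), of 1] by simp
    also have "\<dots> = z n \<otimes> (z n \<otimes> T (rim (2 * n) 0))"
      using z(2)[OF n(1), of 0] rim_1[of "2 * n"] by simp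
    finally show ?case using Suc.IH[OF n(2)] z(1)[OF n(1)] sq_carrier[OF n(2)] Tc
      by (simp add: zs_Suc m_assoc)
  qed (simp add: zs_def Tc)
  have "rim (2 * g) 0 = rim 0 0"
    using g_pos by (simp add: rim_def)
  then have "foldr (\<otimes>) (map ?sq (zs g)) \<one> \<otimes> T (rim 0 0) = T (rim 0 0)" using tele[of g] by simp
  then have one: "foldr (\<otimes>) (map ?sq (zs g)) \<one> = \<one>" using Tc sq_carrier[of g] by (metis order_refl r_cancel_one)
  have "sg (foldr (\<otimes>) (zs n) \<one>) = (\<Prod>j<n. sg (z j))" if "n \<le> g" for n
    using that
  proof (induction n)
    case (Suc n)
    then show ?case using z(1)[of n] foldr_mult_carrier[OF zs_carrier[of n], of \<one>]
      by (simp add: zs_Suc sg_mult mult.commute)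
  qed (simp add: zs_def sg_one)
  then have "sg (foldr (\<otimes>) (zs g) \<one>) = - 1" using prod by simp
  then show thesis using that[of "zs g"] zs_carrier[of g] one by (simp add: zs_def)
qed

end

section \<open>The semi-free group of a Kneser graph\<close>

text \<open>For a two-element set \<open>A\<close> this is the transposition of its elements, acting
  on all natural numbers.\<close>

definition other :: "nat set \<Rightarrow> nat \<Rightarrow> nat" where
  "other A n = (if n \<in> A then the_elem (A - {n}) else n)"

lemma other_simps:
  assumes "a \<noteq> b"
  shows "other {a, b} a = b" "other {a, b} b = a" "n \<noteq> a \<Longrightarrow> n \<noteq> b \<Longrightarrow> other {a, b} n = n"
proof -
  have "{a, b} - {a} = {b}" "{a, b} - {b} = {a}" using assms by auto
  then show "other {a, b} a = b" "other {a, b} b = a" "n \<noteq> a \<Longrightarrow> n \<noteq> b \<Longrightarrow> other {a, b} n = n"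
    by (auto simp: other_def)
qed

lemma card_2_other:
  assumes "card A = 2"
  shows "other A (other A n) = n" "other A n \<in> A \<longleftrightarrow> n \<in> A" "n \<notin> A \<Longrightarrow> other A n = n"
proof -
  obtain a b where A: "A = {a, b}" "a \<noteq> b" using assms by (meson card_2_iff)
  have "n = a \<or> n = b \<or> n \<noteq> a \<and> n \<noteq> b" by auto
  then show "other A (other A n) = n" "other A n \<in> A \<longleftrightarrow> n \<in> A"
    using other_simps[OF A(2)] A by auto
  show "n \<notin> A \<Longrightarrow> other A n = n" by (simp add: other_def)
qed

lemma other_commute:
  assumes "card A = 2" "card B = 2" "A \<inter> B = {}"
  shows "other A (other B n) = other B (other A n)"
proof -
  consider "n \<in> A" | "n \<in> B" | "n \<notin> A" "n \<notin> B" by blast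
  then show ?thesis
  proof cases
    case 1
    then have "other A n \<notin> B" "n \<notin> B" using card_2_other(2)[OF assms(1), of n] assms(3) by auto
    then show ?thesis using card_2_other(3)[OF assms(2)] by simp
  next
    case 2
    then have "other B n \<notin> A" "n \<notin> A" using card_2_other(2)[OF assms(2), of n] assms(3) by auto
    then show ?thesis using card_2_other(3)[OF assms(1)] by simp
  qed (simp add: other_def)
qed

text \<open>A letter and its inverse act alike, a transposition being its own inverse.\<close>

definition word_action :: "nat set word \<Rightarrow> nat \<Rightarrow> nat" where
  "word_action w = foldr (\<lambda>l. other (fst l)) w"

lemma word_action_simps [simp]:
  "word_action [] = id" "word_action (v @ w) = word_action v \<circ> word_action w"
  "word_action ((A, b) # w) = other A \<circ> word_action w"
  by (auto simp: word_action_def)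

abbreviation pairs :: "nat \<Rightarrow> nat set set" where "pairs m \<equiv> {A. A \<subseteq> {1..m} \<and> card A = 2}"

abbreviation kneser_rels :: "nat \<Rightarrow> (nat set word \<times> nat set word) set" where
  "kneser_rels m \<equiv> {([(A, True), (B, True)], [(B, True), (A, True)]) | A B. {A, B} \<in> snd (kneser_graph m 2)}"

lemma kneser_edge: "{A, B} \<in> snd (kneser_graph m 2) \<longleftrightarrow> A \<in> pairs m \<and> B \<in> pairs m \<and> A \<noteq> B \<and> A \<inter> B = {}"
  unfolding kneser_graph_def Let_def by (auto simp: doubleton_eq_iff)

text \<open>The edges of the Kneser graph ask exactly that disjoint transpositions commute.\<close>

lemma word_action_pres_eq:
  "pres_eq (pairs m) (kneser_rels m) v w \<Longrightarrow> word_action v = word_action w"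
proof (induction rule: pres_eq.induct)
  case (pres_cancel u v A b)
  then have "other A \<circ> other A = id" using card_2_other(1) by (auto simp: fun_eq_iff)
  then show ?case by (simp add: comp_assoc[symmetric])
next
  case (pres_rel u v r s)
  then obtain A B where AB: "r = [(A, True), (B, True)]" "s = [(B, True), (A, True)]"
    "card A = 2" "card B = 2" "A \<inter> B = {}" using kneser_edge by auto
  then have "other A \<circ> other B = other B \<circ> other A" using other_commute by (auto simp: fun_eq_iff)
  then show ?case by (simp add: AB(1,2) comp_assoc[symmetric])
qed auto

section \<open>The group and its action by permutations\<close>

locale kneser_group =
  fixes m :: nat and \<Gamma> :: "nat set word set monoid" (structure)
  defines "\<Gamma> \<equiv> semi_free_group (kneser_graph m 2)"
begin

sublocale group \<Gamma> unfolding \<Gamma>_def by (rule group_semi_free_group)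

lemma \<Gamma>_eq: "\<Gamma> = presented_group (pairs m) (kneser_rels m)"
  unfolding \<Gamma>_def semi_free_group_def by (simp add: kneser_graph_def)

definition cls :: "nat set word \<Rightarrow> nat set word set" where
  "cls w = {u. pres_eq (pairs m) (kneser_rels m) w u}"

lemma carrier_cls: "A \<in> carrier \<Gamma> \<longleftrightarrow> (\<exists>w\<in>lists (pairs m \<times> UNIV). A = cls w)"
  unfolding \<Gamma>_eq presented_group_carrier cls_def by blast

lemma mult_cls: "v \<in> lists (pairs m \<times> UNIV) \<Longrightarrow> w \<in> lists (pairs m \<times> UNIV) \<Longrightarrow> cls v \<otimes> cls w = cls (v @ w)"
  unfolding \<Gamma>_eq cls_def by (rule presented_group_class_mult)

lemma one_cls: "\<one> = cls []" unfolding \<Gamma>_eq cls_def by (simp add: presented_group_def)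

definition act :: "nat set word set \<Rightarrow> nat \<Rightarrow> nat" where
  "act A = word_action (SOME w. w \<in> A)"

lemma act_cls: "w \<in> lists (pairs m \<times> UNIV) \<Longrightarrow> act (cls w) = word_action w"
proof -
  assume "w \<in> lists (pairs m \<times> UNIV)"
  then have "w \<in> cls w" unfolding cls_def by (simp add: pres_refl)
  then have "(SOME w'. w' \<in> cls w) \<in> cls w" by (rule someI)
  then show ?thesis unfolding act_def using word_action_pres_eq unfolding cls_def by fastforce
qed

lemma act_mult: "x \<in> carrier \<Gamma> \<Longrightarrow> y \<in> carrier \<Gamma> \<Longrightarrow> act (x \<otimes> y) = act x \<circ> act y"
  unfolding carrier_cls by (elim bexE) (simp only: mult_cls act_cls append_in_lists_conv word_action_simps simp_thms)

lemma act_one: "act \<one> = id"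
  unfolding one_cls by (subst act_cls) auto

lemma act_inv: "x \<in> carrier \<Gamma> \<Longrightarrow> act x a = b \<Longrightarrow> act (inv x) b = a"
proof -
  assume x: "x \<in> carrier \<Gamma>" "act x a = b"
  have "act (inv x) (act x a) = act (inv x \<otimes> x) a" using act_mult[of "inv x" x] x(1) by simp
  then show ?thesis using x by (simp add: act_one)
qed

definition gen :: "nat set \<Rightarrow> nat set word set" where "gen A = cls [(A, True)]"

lemma gen_carrier: "A \<in> pairs m \<Longrightarrow> gen A \<in> carrier \<Gamma>"
  unfolding gen_def carrier_cls by (intro bexI[of _ "[(A, True)]"]) auto

lemma act_gen: "A \<in> pairs m \<Longrightarrow> act (gen A) = other A"
  unfolding gen_def by (subst act_cls) auto

lemma gen_commute:
  assumes "A \<in> pairs m" "B \<in> pairs m" "A \<inter> B = {}"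
  shows "gen A \<otimes> gen B = gen B \<otimes> gen A"
proof -
  have "A \<noteq> B" using assms by auto
  then have "([(A, True), (B, True)], [(B, True), (A, True)]) \<in> kneser_rels m"
    using assms kneser_edge[of A B m] by blast
  then have e: "pres_eq (pairs m) (kneser_rels m) [(A, True), (B, True)] [(B, True), (A, True)]"
    using pres_rel[of "[]" "pairs m" "[]" "[(A, True), (B, True)]" "[(B, True), (A, True)]" "kneser_rels m"] assms
    by auto
  have "cls [(A, True), (B, True)] = cls [(B, True), (A, True)]"
    unfolding cls_def using pres_trans[OF e] pres_trans[OF pres_sym[OF e]] by blast
  then show ?thesis unfolding gen_def using assms by (subst (1 2) mult_cls) auto
qed

text \<open>One transposition takes \<open>a\<close> to \<open>1\<close>; another one, fixing
  \<open>1\<close>, takes the image of \<open>b\<close> to \<open>2\<close>. The identity stands in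
  when the two points already coincide.\<close>

lemma act_transitive:
  assumes "a \<in> {1..m}" "b \<in> {1..m}" "a \<noteq> b"
  obtains \<gamma> where "\<gamma> \<in> carrier \<Gamma>" "act \<gamma> a = 1" "act \<gamma> b = 2"
proof -
  have m2: "2 \<le> m" using assms by auto
  define t where "t = (if a = 1 then \<one> else gen {a, 1})"
  have t: "t \<in> carrier \<Gamma>" "act t a = 1"
    using assms(1) m2 gen_carrier[of "{a, 1}"] act_gen[of "{a, 1}"] other_simps[of a 1]
    by (auto simp: t_def act_one)
  define b' where "b' = act t b"
  have b': "b' \<in> {1..m}" "b' \<noteq> 1"
  proof -
    have "act (inv t) b' = b" "act (inv t) 1 = a" using t act_inv by (auto simp: b'_def)
    then show "b' \<noteq> 1" using assms(3) by auto
    show "b' \<in> {1..m}"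
    proof (cases "a = 1")
      case True
      then show ?thesis using assms by (simp add: b'_def t_def act_one)
    next
      case False
      then have "act t = other {a, 1}" using act_gen[of "{a, 1}"] assms(1) m2 by (simp add: t_def)
      then show ?thesis using other_simps[of a 1] False assms by (cases "b = 1") (auto simp: b'_def)
    qed
  qed
  define s where "s = (if b' = 2 then \<one> else gen {b', 2})"
  have s: "s \<in> carrier \<Gamma>" "act s b' = 2" "act s 1 = 1"
    using b' m2 gen_carrier[of "{b', 2}"] act_gen[of "{b', 2}"] other_simps[of b' 2]
    by (auto simp: s_def act_one)
  show thesis
    by (rule that[of "s \<otimes> t"]) (use s t in \<open>auto simp: act_mult b'_def[symmetric]\<close>)
qed

text \<open>Only the edges between two pairs of opposite vertices with distinct colors force generators
  to commute: then \<open>b\<inverse> b'\<close> involves the pair of colors of two opposite vertices and \<open>a\<inverse> a'\<close> that of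
  the other two.\<close>

lemma quadrilateral_product:
  assumes c: "a \<in> carrier \<Gamma>" "a' \<in> carrier \<Gamma>" "b \<in> carrier \<Gamma>" "b' \<in> carrier \<Gamma>" "d \<in> carrier \<Gamma>" "d' \<in> carrier \<Gamma>"
      "e \<in> carrier \<Gamma>" "e' \<in> carrier \<Gamma>"
    and Y: "inv d \<otimes> d' = inv a \<otimes> a'" and X: "inv e \<otimes> e' = inv (inv b \<otimes> b')"
    and comm: "(inv b \<otimes> b') \<otimes> (inv a \<otimes> a') = (inv a \<otimes> a') \<otimes> (inv b \<otimes> b')"
  shows "(a \<otimes> inv b) \<otimes> ((b' \<otimes> inv d) \<otimes> ((d' \<otimes> inv e) \<otimes> (e' \<otimes> inv a'))) = \<one>"
proof -
  let ?X = "inv b \<otimes> b'" and ?Y = "inv a \<otimes> a'"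
  have XY: "?X \<in> carrier \<Gamma>" "?Y \<in> carrier \<Gamma>" using c by auto
  have "(a \<otimes> inv b) \<otimes> ((b' \<otimes> inv d) \<otimes> ((d' \<otimes> inv e) \<otimes> (e' \<otimes> inv a')))
      = a \<otimes> ((?X \<otimes> (inv d \<otimes> d')) \<otimes> ((inv e \<otimes> e') \<otimes> inv a'))"
    using c by (simp add: m_assoc)
  also have "\<dots> = a \<otimes> ((?Y \<otimes> ?X) \<otimes> (inv ?X \<otimes> inv a'))" unfolding X Y comm ..
  also have "\<dots> = a \<otimes> (?Y \<otimes> ((?X \<otimes> inv ?X) \<otimes> inv a'))" using c XY by (simp only: m_assoc m_closed inv_closed)
  also have "\<dots> = a \<otimes> (?Y \<otimes> inv a')" using c XY by simp
  also have "\<dots> = (a \<otimes> inv a) \<otimes> (a' \<otimes> inv a')" using c by (simp only: m_assoc m_closed inv_closed)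
  also have "\<dots> = \<one>" using c by simp
  finally show ?thesis .
qed

end

section \<open>Edge labels from a local 3-coloring\<close>

locale locally_colored = kneser_group m \<Gamma>
  for m and \<Gamma> :: "nat set word set monoid" (structure) +
  fixes G :: "('a, 'e) drawing" and c :: "'a \<Rightarrow> nat"
  assumes fin: "finite (verts G)"
    and ends: "\<And>e. e \<in> edges G \<Longrightarrow> curve G e 0 \<in> verts G \<and> curve G e 1 \<in> verts G"
    and col: "local_3_coloring G c" and c_range: "c ` verts G \<subseteq> {1..m}"
begin

definition cN :: "'a \<Rightarrow> nat set" where "cN v = c ` nbrs G v"

text \<open>\<open>Max\<close> makes the choice depend on the set \<open>cN v\<close> alone, so
  vertices with the same neighbor colors choose alike.\<close>

definition rep :: "'a \<Rightarrow> nat" where "rep v = Max (cN v)"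

definition turn :: "'a \<Rightarrow> nat \<Rightarrow> nat set word set" where
  "turn v x = (if x = rep v then \<one> else gen {x, rep v})"

lemma nbrs_verts: "w \<in> nbrs G v \<Longrightarrow> v \<in> verts G \<and> w \<in> verts G"
  unfolding nbrs_def using ends by (auto simp: doubleton_eq_iff)

lemma nbrs_sym: "w \<in> nbrs G v \<Longrightarrow> v \<in> nbrs G w"
  unfolding nbrs_def by (auto simp: insert_commute)

lemma cN: "finite (cN v)" "cN v \<subseteq> {1..m}"
proof -
  have "nbrs G v \<subseteq> verts G" using nbrs_verts by auto
  then show "finite (cN v)" "cN v \<subseteq> {1..m}"
    unfolding cN_def using fin c_range finite_subset by blast+
qed

lemma card_cN: "v \<in> verts G \<Longrightarrow> card (cN v) \<le> 2"
  using col unfolding local_3_coloring_def cN_def by blast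

lemma own_color: "w \<in> nbrs G v \<Longrightarrow> c v \<notin> cN v"
  using col nbrs_verts unfolding local_3_coloring_def cN_def by blast

lemma cN_I: "w \<in> nbrs G v \<Longrightarrow> c w \<in> cN v" by (simp add: cN_def)

lemma rep_in: "x \<in> cN v \<Longrightarrow> rep v \<in> cN v"
  unfolding rep_def using cN by (intro Max_in) auto

lemma cN_eq: "v \<in> verts G \<Longrightarrow> x \<in> cN v \<Longrightarrow> y \<in> cN v \<Longrightarrow> x \<noteq> y \<Longrightarrow> cN v = {x, y}"
  using card_cN[of v] card_seteq[of "cN v" "{x, y}"] cN(1)[of v] by auto

lemma turn_pair: "x \<in> cN v \<Longrightarrow> x \<noteq> rep v \<Longrightarrow> {x, rep v} \<in> pairs m"
  using cN(2)[of v] rep_in[of x v] by (auto simp: card_insert_if)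

lemma turn_carrier: "x \<in> cN v \<Longrightarrow> turn v x \<in> carrier \<Gamma>"
  using turn_pair[of x v] gen_carrier by (auto simp: turn_def)

lemma act_turn: "x \<in> cN v \<Longrightarrow> act (turn v x) x = rep v"
  using turn_pair[of x v] act_gen other_simps(1)[of x "rep v"] by (auto simp: turn_def act_one)

lemma act_turn_fix: "x \<in> cN v \<Longrightarrow> y \<notin> cN v \<Longrightarrow> act (turn v x) y = y"
  using turn_pair[of x v] act_gen other_simps(3)[of x "rep v" y] rep_in[of x v]
  by (auto simp: turn_def act_one)

definition lab :: "'a \<Rightarrow> 'a \<Rightarrow> nat set word set" where
  "lab v w = turn v (c w) \<otimes> inv (turn w (c v))"

lemma lab_carrier: "w \<in> nbrs G v \<Longrightarrow> lab v w \<in> carrier \<Gamma>"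
  using turn_carrier cN_I nbrs_sym by (simp add: lab_def)

lemma lab_inv: "w \<in> nbrs G v \<Longrightarrow> lab w v = inv (lab v w)"
  using turn_carrier cN_I nbrs_sym by (simp add: lab_def inv_mult_group)

text \<open>The ordered pair \<open>(c v, rep v)\<close> serves as a frame at \<open>v\<close>, and
  the label interchanges the entries of the frames along the edge. The factor of one end fixes the
  color of that end, which is not among its neighbor colors.\<close>

lemma act_lab:
  assumes "w \<in> nbrs G v"
  shows "act (lab v w) (c w) = rep v" "act (lab v w) (rep w) = c v"
proof -
  have vw: "v \<in> nbrs G w" using nbrs_sym[OF assms] .
  note cw = cN_I[OF assms] and cv = cN_I[OF vw]
  have t: "turn v (c w) \<in> carrier \<Gamma>" "turn w (c v) \<in> carrier \<Gamma>" using cw cv turn_carrier by auto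
  have "act (inv (turn w (c v))) (c w) = c w"
    using act_turn_fix[OF cv own_color[OF vw]] by (intro act_inv t)
  moreover have "act (inv (turn w (c v))) (rep w) = c v"
    using act_turn[OF cv] by (intro act_inv t)
  ultimately show "act (lab v w) (c w) = rep v" "act (lab v w) (rep w) = c v"
    using act_turn[OF cw] act_turn_fix[OF cw own_color[OF assms]] t by (simp_all add: lab_def act_mult)
qed

text \<open>The bound of two neighbor colors enters here: vertices sharing two distinct neighbor
  colors have equal sets \<open>cN\<close>, hence equal turns.\<close>

lemma turn_eq:
  assumes "v \<in> verts G" "w \<in> verts G" "x \<in> cN v" "y \<in> cN v" "x \<in> cN w" "y \<in> cN w" "x \<noteq> y"
  shows "turn v x = turn w x" "turn v y = turn w y" "turn v x \<in> {\<one>, gen {x, y}}" "turn v y \<in> {\<one>, gen {x, y}}"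
proof -
  have "cN v = {x, y}" "cN w = {x, y}" using cN_eq assms by blast+
  then have r: "rep w = rep v" "rep v \<in> {x, y}" using rep_in[OF assms(3)] by (auto simp: rep_def)
  show "turn v x = turn w x" "turn v y = turn w y" unfolding turn_def r(1) by auto
  show "turn v x \<in> {\<one>, gen {x, y}}" "turn v y \<in> {\<one>, gen {x, y}}"
    using r(2) assms(7) unfolding turn_def by (auto simp: insert_commute)
qed

lemma commute_inv:
  assumes "s \<in> carrier \<Gamma>" "t \<in> carrier \<Gamma>" "s \<otimes> t = t \<otimes> s"
  shows "s \<otimes> inv t = inv t \<otimes> s"
proof -
  have "inv t \<otimes> s = inv t \<otimes> ((s \<otimes> t) \<otimes> inv t)" using assms(1,2) by (simp add: m_assoc)
  also have "\<dots> = (inv t \<otimes> t) \<otimes> (s \<otimes> inv t)" using assms by (simp only: m_assoc m_closed inv_closed)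
  finally show ?thesis using assms(1,2) by simp
qed

lemma commute_inv_mult:
  assumes "{a, a'} \<subseteq> {\<one>, s}" "{b, b'} \<subseteq> {\<one>, t}" "s \<in> carrier \<Gamma>" "t \<in> carrier \<Gamma>" "s \<otimes> t = t \<otimes> s"
  shows "(inv b \<otimes> b') \<otimes> (inv a \<otimes> a') = (inv a \<otimes> a') \<otimes> (inv b \<otimes> b')"
proof -
  have 1: "s \<otimes> inv t = inv t \<otimes> s" "inv s \<otimes> t = t \<otimes> inv s" "inv s \<otimes> inv t = inv t \<otimes> inv s"
    using commute_inv[of s t] commute_inv[of t s] commute_inv[of "inv t" s] assms(3-5) by simp_all
  have "inv a \<otimes> a' \<in> {\<one>, s, inv s}" "inv b \<otimes> b' \<in> {\<one>, t, inv t}"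
    using assms(1-4) by auto
  then show ?thesis using 1 assms(3-5) by auto
qed

text \<open>Opposite corners share the colors of the other two corners as neighbor colors. If these
  two colors differ, the turns at the opposite corners agree; if not, the corresponding products are
  trivial. When both pairs consist of distinct colors they are disjoint, as the coloring is
  proper.\<close>

lemma face_product:
  assumes n: "v2 \<in> nbrs G v1" "v3 \<in> nbrs G v2" "v4 \<in> nbrs G v3" "v1 \<in> nbrs G v4"
  shows "lab v1 v2 \<otimes> (lab v2 v3 \<otimes> (lab v3 v4 \<otimes> lab v4 v1)) = \<one>"
proof -
  note n' = n[THEN nbrs_sym]
  note V = n[THEN nbrs_verts, THEN conjunct1]
  note C = n[THEN cN_I] n'[THEN cN_I]
  have Y: "inv (turn v3 (c v2)) \<otimes> turn v3 (c v4) = inv (turn v1 (c v2)) \<otimes> turn v1 (c v4)"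
  proof (cases "c v2 = c v4")
    case False
    then show ?thesis using turn_eq[OF V(1,3), of "c v2" "c v4"] C by simp
  qed (use C turn_carrier in simp)
  have X: "inv (turn v4 (c v3)) \<otimes> turn v4 (c v1) = inv (inv (turn v2 (c v1)) \<otimes> turn v2 (c v3))"
  proof (cases "c v1 = c v3")
    case False
    then show ?thesis using turn_eq[OF V(2,4), of "c v1" "c v3"] C turn_carrier by (simp add: inv_mult_group)
  qed (use C turn_carrier in simp)
  have comm: "(inv (turn v2 (c v1)) \<otimes> turn v2 (c v3)) \<otimes> (inv (turn v1 (c v2)) \<otimes> turn v1 (c v4)) =
      (inv (turn v1 (c v2)) \<otimes> turn v1 (c v4)) \<otimes> (inv (turn v2 (c v1)) \<otimes> turn v2 (c v3))"
  proof (cases "c v2 = c v4 \<or> c v1 = c v3")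
    case True
    then show ?thesis using C turn_carrier by auto
  next
    case False
    have P: "{c v2, c v4} \<in> pairs m" "{c v1, c v3} \<in> pairs m"
      using c_range V False by (auto simp: card_insert_if image_subset_iff)
    moreover have "{c v2, c v4} \<inter> {c v1, c v3} = {}"
      using own_color[OF n(1)] own_color[OF n(2)] own_color[OF n(3)] own_color[OF n(4)] C by auto
    ultimately have "gen {c v2, c v4} \<otimes> gen {c v1, c v3} = gen {c v1, c v3} \<otimes> gen {c v2, c v4}"
      by (rule gen_commute)
    then show ?thesis
      using turn_eq[OF V(1,3), of "c v2" "c v4"] turn_eq[OF V(2,4), of "c v1" "c v3"] C False P gen_carrier
      by (intro commute_inv_mult[of _ _ "gen {c v2, c v4}" _ _ "gen {c v1, c v3}"]) auto
  qed
  show ?thesis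
    unfolding lab_def by (rule quadrilateral_product[OF _ _ _ _ _ _ _ _ Y X comm]) (use C turn_carrier in auto)
qed

end

section \<open>Local 3-colorings\<close>

context locally_colored
begin

text \<open>The setwise stabilizer of \<open>{1, 2}\<close>. Multiplicativity of \<open>sign\<close>
  may fail outside it, so the transport takes place in this subgroup.\<close>

definition flip :: "nat set word set set" where
  "flip = {\<gamma> \<in> carrier \<Gamma>. act \<gamma> 1 = 1 \<and> act \<gamma> 2 = 2 \<or> act \<gamma> 1 = 2 \<and> act \<gamma> 2 = 1}"

definition sign :: "nat set word set \<Rightarrow> complex" where
  "sign \<gamma> = (if act \<gamma> 1 = 1 then 1 else - 1)"

lemma flip_subgroup: "subgroup flip \<Gamma>"
proof
  show "x \<otimes> y \<in> flip" if "x \<in> flip" "y \<in> flip" for x y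
    using that by (auto simp: flip_def act_mult)
  show "inv x \<in> flip" if "x \<in> flip" for x
    using that act_inv[of x 1] act_inv[of x 2] by (auto simp: flip_def)
qed (auto simp: flip_def act_one)

lemma sign_mult: "x \<in> flip \<Longrightarrow> y \<in> flip \<Longrightarrow> sign (x \<otimes> y) = sign x * sign y"
  by (auto simp: flip_def sign_def act_mult)

text \<open>Double transitivity provides it for every vertex with a neighbor; at other vertices the
  value is arbitrary and enters no edge label.\<close>

definition gauge :: "'a \<Rightarrow> nat set word set" where
  "gauge v = (SOME \<gamma>. \<gamma> \<in> carrier \<Gamma> \<and> act \<gamma> (c v) = 1 \<and> act \<gamma> (rep v) = 2)"

lemma gauge:
  assumes "w \<in> nbrs G v"
  shows "gauge v \<in> carrier \<Gamma>" "act (gauge v) (c v) = 1" "act (gauge v) (rep v) = 2"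
proof -
  have "c v \<in> {1..m}" using nbrs_verts[OF assms] c_range by auto
  moreover have r: "rep v \<in> cN v" using rep_in[OF cN_I[OF assms]] .
  moreover have "rep v \<in> {1..m}" using r cN(2) by blast
  moreover have "c v \<noteq> rep v" using r own_color[OF assms] by auto
  ultimately have "\<exists>\<gamma>. \<gamma> \<in> carrier \<Gamma> \<and> act \<gamma> (c v) = 1 \<and> act \<gamma> (rep v) = 2"
    using act_transitive by metis
  from someI_ex[OF this] show "gauge v \<in> carrier \<Gamma>" "act (gauge v) (c v) = 1" "act (gauge v) (rep v) = 2"
    unfolding gauge_def by auto
qed

definition label :: "'a \<Rightarrow> 'a \<Rightarrow> nat set word set" where
  "label v w = gauge v \<otimes> (lab v w \<otimes> inv (gauge w))"

text \<open>\<open>(1, 2)\<close> is carried to \<open>(c w, rep w)\<close>, then to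
  \<open>(rep v, c v)\<close>, and finally to \<open>(2, 1)\<close>.\<close>

lemma label_flip:
  assumes "w \<in> nbrs G v"
  shows "label v w \<in> flip" "sign (label v w) = - 1"
proof -
  note gv = gauge[OF assms] and gw = gauge[OF nbrs_sym[OF assms]]
  have a: "act (inv (gauge w)) 1 = c w" "act (inv (gauge w)) 2 = rep w"
    using gw by (auto intro: act_inv)
  then have "act (label v w) 1 = 2" "act (label v w) 2 = 1"
    using gv gw lab_carrier[OF assms] act_lab[OF assms] by (auto simp: label_def act_mult)
  then show "label v w \<in> flip" "sign (label v w) = - 1"
    using gv gw lab_carrier[OF assms] by (auto simp: flip_def sign_def label_def)
qed

lemma label_inv: "w \<in> nbrs G v \<Longrightarrow> label w v = inv (label v w)"
  using gauge(1)[of w v] gauge(1)[OF nbrs_sym, of w v] lab_carrier[of w v] lab_inv[of w v]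
  by (simp add: label_def inv_mult_group m_assoc)

lemma label_product:
  assumes n: "v2 \<in> nbrs G v1" "v3 \<in> nbrs G v2" "v4 \<in> nbrs G v3" "v1 \<in> nbrs G v4"
  shows "label v1 v2 \<otimes> (label v2 v3 \<otimes> (label v3 v4 \<otimes> label v4 v1)) = \<one>"
proof -
  have g: "gauge v1 \<in> carrier \<Gamma>" "gauge v2 \<in> carrier \<Gamma>" "gauge v3 \<in> carrier \<Gamma>" "gauge v4 \<in> carrier \<Gamma>"
    using n gauge(1) by blast+
  have l: "lab v1 v2 \<in> carrier \<Gamma>" "lab v2 v3 \<in> carrier \<Gamma>" "lab v3 v4 \<in> carrier \<Gamma>" "lab v4 v1 \<in> carrier \<Gamma>"
    using n lab_carrier by blast+
  have canc: "inv x \<otimes> (x \<otimes> y) = y" if "x \<in> carrier \<Gamma>" "y \<in> carrier \<Gamma>" for x y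
    using that by (simp add: m_assoc[symmetric])
  have "label v1 v2 \<otimes> (label v2 v3 \<otimes> (label v3 v4 \<otimes> label v4 v1)) =
      gauge v1 \<otimes> ((lab v1 v2 \<otimes> (lab v2 v3 \<otimes> (lab v3 v4 \<otimes> lab v4 v1))) \<otimes> inv (gauge v1))"
    using g l by (simp add: label_def m_assoc canc)
  then show ?thesis using face_product[OF n] g by simp
qed

definition step_label :: "'e \<times> bool \<Rightarrow> nat set word set" where
  "step_label d = label (step_path G d 0) (step_path G d 1)"

lemma step_nbrs: "fst d \<in> edges G \<Longrightarrow> step_path G d 1 \<in> nbrs G (step_path G d 0)"
  unfolding nbrs_def step_path_def by (auto simp: insert_commute)

end

text \<open>The face maps may be chosen with centres off the image of the boundary circle of the
  polygon, on which \<open>q\<close> need not be injective.\<close>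

lemma centred_face_map:
  fixes q :: "complex \<Rightarrow> 'a"
  assumes S: "surface S" and w: "quad_boundary_walk S G f w" "f \<in> faces S G"
    and q: "quotient_map (top_of_set (cball 0 1)) S q"
  obtains \<phi> p where "continuous_map (top_of_set (cball 0 1)) S \<phi>"
    "homeomorphic_map (top_of_set (ball 0 1)) (subtopology S f) \<phi>"
    "\<And>k t. k < 4 \<Longrightarrow> t \<in> {0..1} \<Longrightarrow> \<phi> (side k t) = step_path G (w ! k) t"
    "p \<in> ball 0 1" "\<phi> 0 = q p"
proof -
  obtain \<psi> where \<psi>: "continuous_map (top_of_set (cball 0 1)) S \<psi>"
    "homeomorphic_map (top_of_set (ball 0 1)) (subtopology S f) \<psi>"
    "\<And>k t. k < 4 \<Longrightarrow> t \<in> {0..1} \<Longrightarrow> \<psi> (side k t) = step_path G (w ! k) t"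
    using w(1) unfolding quad_boundary_walk_def side_def by blast
  have fS: "f \<subseteq> topspace S"
    using connected_components_of_subset[of f] w(2) unfolding faces_def by fastforce
  have im: "\<psi> ` ball 0 1 = f"
    using homeomorphic_imp_surjective_map[OF \<psi>(2)] fS by (auto simp: topspace_subtopology)
  have "continuous_map (top_of_set (ball 0 1)) S \<psi>"
    by (rule continuous_map_from_subtopology_mono[OF \<psi>(1)]) (rule ball_subset_cball)
  then have "openin S (\<psi> ` ball 0 1)"
    using surface_open_image[OF S open_ball] homeomorphic_imp_injective_map[OF \<psi>(2)] by simp
  then have "openin S f" using im by simp
  then have op: "openin (top_of_set (cball 0 1)) {x \<in> cball 0 1. q x \<in> f}"
    using openin_continuous_map_preimage[OF quotient_imp_continuous_map[OF q]] by simp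
  have "\<psi> 0 \<in> f" using im by force
  then obtain a where a: "a \<in> cball 0 1" "q a \<in> f"
    using quotient_imp_surjective_map[OF q] fS by (metis imageE subsetD topspace_euclidean_subtopology)
  then obtain r where r: "r > 0" "ball a r \<inter> cball 0 1 \<subseteq> {x \<in> cball 0 1. q x \<in> f}"
    using op unfolding openin_contains_ball by blast
  \<comment> \<open>The point \<open>a\<close> over \<open>f\<close> may lie on the rim; a slight
    contraction towards the origin moves it inside, and its image stays in the open face.\<close>
  define s where "s = min (1/2) (r / 2)"
  define p where "p = of_real (1 - s) * a"
  have s: "0 < s" "s < 1" "s < r" using r(1) by (auto simp: s_def)
  have "norm p \<le> 1 - s" using a(1) s by (simp add: p_def norm_mult mult_left_le del: of_real_diff)
  then have p1: "p \<in> ball 0 1" using s by simp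
  have "a - p = of_real s * a" by (simp add: p_def algebra_simps)
  then have "dist a p \<le> s" using a(1) s by (simp add: dist_norm norm_mult mult_left_le)
  then have "q p \<in> f" using r(2) s(3) p1 by (auto simp: subset_iff)
  then have "q p \<in> \<psi> ` ball 0 1" using im by simp
  then obtain y where y: "y \<in> ball 0 1" "\<psi> y = q p" by (metis imageE)
  have aff: "affine hull (ball 0 1) = (UNIV :: complex set)" by (simp add: affine_hull_open)
  \<comment> \<open>A homeomorphism of the closed disc taking \<open>0\<close> to \<open>y\<close>
    and fixing the circle, so that the boundary walk is kept.\<close>
  obtain h h' where h: "homeomorphism (cball 0 1) (cball (0::complex) 1) h h'" "h 0 = y"
    "{x. \<not> (h x = x \<and> h' x = x)} \<subseteq> ball 0 1"
  proof (rule homeomorphism_moving_point[of "ball (0::complex) 1" "cball 0 1" 0 y])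
    show "openin (top_of_set (affine hull ball 0 1)) (ball (0::complex) 1)" by (simp add: aff)
  qed (use y(1) aff in auto)
  have hfix: "h x = x \<and> h' x = x" if "x \<notin> ball 0 1" for x using h(3) that by blast
  have hc: "continuous_on (cball 0 1) h" "h ` cball 0 1 = cball 0 1"
    "continuous_on (cball 0 1) h'" "h' ` cball 0 1 = cball 0 1"
    "\<And>x. x \<in> cball 0 1 \<Longrightarrow> h' (h x) = x" "\<And>x. x \<in> cball 0 1 \<Longrightarrow> h (h' x) = x"
    using h(1) unfolding homeomorphism_def by auto
  have stays: "k x \<in> ball 0 1"
    if "x \<in> ball 0 1" "k' (k x) = x" "\<And>z. z \<notin> ball 0 1 \<Longrightarrow> k' z = z" for k k' and x :: complex
    using that by metis
  have hb: "h x \<in> ball 0 1" "h' x \<in> ball 0 1" if "x \<in> ball 0 1" for x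
    using stays[of x h' h] stays[of x h h'] hc(5,6)[of x] hfix that by auto
  show thesis
  proof (rule that[of "\<psi> \<circ> h" p])
    have "continuous_map (top_of_set (cball 0 1)) (top_of_set (cball 0 1)) h"
      using hc(1,2) by (simp add: continuous_map_in_subtopology) blast
    then show "continuous_map (top_of_set (cball 0 1)) S (\<psi> \<circ> h)"
      using \<psi>(1) by (rule continuous_map_compose)
    have "homeomorphic_maps (top_of_set (ball 0 1)) (top_of_set (ball 0 1)) h h'"
      unfolding homeomorphic_maps_def continuous_map_in_subtopology
      using hb hc continuous_on_subset[OF hc(1) ball_subset_cball] continuous_on_subset[OF hc(3) ball_subset_cball]
      by auto
    then show "homeomorphic_map (top_of_set (ball 0 1)) (subtopology S f) (\<psi> \<circ> h)"
      using \<psi>(2) homeomorphic_map_compose homeomorphic_maps_map by blast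
    show "(\<psi> \<circ> h) (side k t) = step_path G (w ! k) t" if "k < 4" "t \<in> {0..1}" for k t
      using \<psi>(3)[OF that] hfix[of "side k t"] by simp
    show "p \<in> ball 0 1" by (rule p1)
    show "(\<psi> \<circ> h) 0 = q p" using y(2) h(2) by simp
  qed
qed

section \<open>Counting directed sides modulo 2\<close>

context quadrangulated_surface
begin

lemma consecutive:
  assumes "f \<in> F"
  shows "k < 3 \<Longrightarrow> step_path G (W f ! k) 1 = step_path G (W f ! Suc k) 0"
    "step_path G (W f ! 3) 1 = step_path G (W f ! 0) 0"
proof -
  show "step_path G (W f ! k) 1 = step_path G (W f ! Suc k) 0" if "k < 3"
    using Phi_step[OF assms, of k 1] Phi_step[OF assms, of "Suc k" 0] side_1[of k] that by simp
  have "side 3 1 = side 0 0" using side_1[of 3] by (simp add: side_0 i4)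
  then show "step_path G (W f ! 3) 1 = step_path G (W f ! 0) 0"
    using Phi_step[OF assms, of 3 1] Phi_step[OF assms, of 0 0] by simp
qed

text \<open>The two places of an edge have equal directions exactly if none or both of them are
  forward.\<close>

lemma breaks_iff:
  assumes e: "e \<in> edges G"
  shows "breaks_consistency S G W e \<longleftrightarrow> even (card {P \<in> places e. snd (W (fst P) ! snd P)})"
proof -
  obtain P Q where PQ: "places e = {P, Q}" "P \<noteq> Q" using card_places[OF e] by (meson card_2_iff)
  let ?s = "\<lambda>P. snd (W (fst P) ! snd P)"
  have "breaks_consistency S G W e \<longleftrightarrow> (\<exists>P\<in>places e. \<exists>Q\<in>places e. P \<noteq> Q \<and> ?s P = ?s Q)"
  proof
    assume "breaks_consistency S G W e"
    then obtain f f' i j where "f \<in> F" "f' \<in> F" "i < length (W f)" "j < length (W f')" "(f, i) \<noteq> (f', j)"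
      "fst (W f ! i) = e" "fst (W f' ! j) = e" "snd (W f ! i) = snd (W f' ! j)"
      unfolding breaks_consistency_def by blast
    then have "(f, i) \<in> places e" "(f', j) \<in> places e" "(f, i) \<noteq> (f', j)" "?s (f, i) = ?s (f', j)"
      using W_len by (auto simp: places_def)
    then show "\<exists>P\<in>places e. \<exists>Q\<in>places e. P \<noteq> Q \<and> ?s P = ?s Q" by blast
  next
    assume "\<exists>P\<in>places e. \<exists>Q\<in>places e. P \<noteq> Q \<and> ?s P = ?s Q"
    then show "breaks_consistency S G W e"
      unfolding breaks_consistency_def places_def using W_len by fastforce
  qed
  also have "\<dots> \<longleftrightarrow> ?s P = ?s Q" using PQ by auto
  also have "\<dots> \<longleftrightarrow> even (card {P \<in> places e. ?s P})"
  proof -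
    have "{R \<in> {P, Q}. ?s R} = (if ?s P then {P} else {}) \<union> (if ?s Q then {Q} else {})" by auto
    then show ?thesis using PQ by auto
  qed
  finally show ?thesis .
qed

text \<open>Modulo 2 the forward places count the edges that keep consistency. As
  \<open>4 * card F = 2 * card (edges G)\<close>, the number of edges is even, so the breaking edges
  have the same parity.\<close>

lemma odd_turning:
  assumes "odd (card {e \<in> edges G. breaks_consistency S G W e})"
  shows "odd (\<Sum>f\<in>F. int (card {k. k < 4 \<and> snd (W f ! k)}) - 2)"
proof -
  let ?s = "\<lambda>P. snd (W (fst P) ! snd P)"
  have fin4: "finite {k::nat. k < 4 \<and> Q k}" for Q by simp
  have part: "(\<Sum>f\<in>F. card {k. k < 4 \<and> Q (f, k)}) = (\<Sum>e\<in>edges G. card {P \<in> places e. Q P})" for Q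
  proof -
    have "(\<Sum>f\<in>F. card {k. k < 4 \<and> Q (f, k)}) = card (SIGMA f:F. {k. k < 4 \<and> Q (f, k)})"
      using finite_faces by (simp add: card_SigmaI)
    also have "(SIGMA f:F. {k. k < 4 \<and> Q (f, k)}) = (\<Union>e\<in>edges G. {P \<in> places e. Q P})"
      using W_edge by (auto simp: places_def)
    also have "card \<dots> = (\<Sum>e\<in>edges G. card {P \<in> places e. Q P})"
      using fin_edges finite_places by (intro card_UN_disjoint) (auto simp: places_def)
    finally show ?thesis .
  qed
  have "4 * card F = 2 * card (edges G)"
    using part[of "\<lambda>_. True"] card_places by simp
  then have E: "even (card (edges G))" by presburger
  let ?B = "{e \<in> edges G. breaks_consistency S G W e}"
  have "even (\<Sum>e\<in>edges G. card {P \<in> places e. ?s P}) \<longleftrightarrow> even (card {e \<in> edges G. odd (card {P \<in> places e. ?s P})})"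
    using fin_edges by (rule even_sum_iff)
  also have "{e \<in> edges G. odd (card {P \<in> places e. ?s P})} = edges G - ?B" using breaks_iff by auto
  also have "card (edges G - ?B) = card (edges G) - card ?B"
    using fin_edges by (intro card_Diff_subset) auto
  also have "even \<dots> \<longleftrightarrow> False"
  proof -
    have "card ?B \<le> card (edges G)" using fin_edges by (intro card_mono) auto
    then show ?thesis using E assms by (simp add: even_diff_nat)
  qed
  finally have N: "odd (\<Sum>f\<in>F. card {k. k < 4 \<and> snd (W f ! k)})"
    using part[of ?s] by simp
  have "(\<Sum>f\<in>F. int (card {k. k < 4 \<and> snd (W f ! k)}) - 2) =
      int (\<Sum>f\<in>F. card {k. k < 4 \<and> snd (W f ! k)}) - 2 * int (card F)"
    by (simp add: sum_subtractf)
  moreover have "odd (int n - 2 * k)" if "odd n" for n k using that by simp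
  ultimately show ?thesis using N by (simp only: not_False_eq_True)
qed

end

theorem theorem3p4:
  fixes g m :: nat
    and \<Gamma> :: "nat set word set monoid"
    and S :: "'a topology"
    and G :: "('a, 'e) drawing"
  defines "\<Gamma> \<equiv> semi_free_group (kneser_graph m 2)"
  assumes "g \<ge> 1" and "m \<ge> 1"
    and "\<forall>zs. set zs \<subseteq> carrier \<Gamma> \<and> length zs = g \<and>
           foldr (\<otimes>\<^bsub>\<Gamma>\<^esub>) (map (\<lambda>z. z [^]\<^bsub>\<Gamma>\<^esub> (2::nat)) zs) \<one>\<^bsub>\<Gamma>\<^esub> = \<one>\<^bsub>\<Gamma>\<^esub>
         \<longrightarrow> foldr (\<otimes>\<^bsub>\<Gamma>\<^esub>) zs \<one>\<^bsub>\<Gamma>\<^esub> = \<one>\<^bsub>\<Gamma>\<^esub>"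
    and "nonorientable_surface_of_genus g S"
    and "odd_quadrangulation S G"
  shows "\<not> (\<exists>c :: 'a \<Rightarrow> nat. local_3_coloring G c \<and> card (c ` verts G) \<le> m)"
proof
  assume "\<exists>c :: 'a \<Rightarrow> nat. local_3_coloring G c \<and> card (c ` verts G) \<le> m"
  then obtain c0 :: "'a \<Rightarrow> nat" where c0: "local_3_coloring G c0" "card (c0 ` verts G) \<le> m" by blast
  have S: "surface S" and emb: "embedded_graph S G"
    using assms(6) unfolding odd_quadrangulation_def quadrangulation_def by auto
  obtain W where W: "\<And>f. f \<in> faces S G \<Longrightarrow> quad_boundary_walk S G f (W f)"
    "odd (card {e \<in> edges G. breaks_consistency S G W e})"
    using assms(6) unfolding odd_quadrangulation_def by blast
  obtain q where q: "quotient_map (top_of_set (cball 0 1)) S q"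
    "\<And>x y. x \<in> cball 0 1 \<Longrightarrow> y \<in> cball 0 1 \<Longrightarrow> q x = q y \<longleftrightarrow> equivclp (crosscap_pairing g) x y"
    using assms(5) unfolding nonorientable_surface_of_genus_def by blast
  have "\<exists>\<phi> p. continuous_map (top_of_set (cball 0 1)) S \<phi> \<and>
    homeomorphic_map (top_of_set (ball 0 1)) (subtopology S f) \<phi> \<and>
    (\<forall>k<4. \<forall>t\<in>{0..1}. \<phi> (side k t) = step_path G (W f ! k) t) \<and> p \<in> ball 0 1 \<and> \<phi> 0 = q p"
    if "f \<in> faces S G" for f
    by (rule centred_face_map[OF S W(1)[OF that] that q(1)]) blast
  then obtain \<Phi> p where \<Phi>: "\<And>f. f \<in> faces S G \<Longrightarrow> continuous_map (top_of_set (cball 0 1)) S (\<Phi> f) \<and>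
    homeomorphic_map (top_of_set (ball 0 1)) (subtopology S f) (\<Phi> f) \<and>
    (\<forall>k<4. \<forall>t\<in>{0..1}. \<Phi> f (side k t) = step_path G (W f ! k) t) \<and> p f \<in> ball 0 1 \<and> \<Phi> f 0 = q (p f)"
    by metis
  interpret quadrangulated_surface S G W \<Phi>
    using S emb W(1) \<Phi> by unfold_locales (auto simp: quad_boundary_walk_def)
  \<comment> \<open>The colors are renamed injectively into \<open>{1..m}\<close>, the ground set of
    the Kneser graph.\<close>
  have "finite (c0 ` verts G)" using fin_verts by simp
  moreover have "card (c0 ` verts G) \<le> card {1..m}" using c0(2) by simp
  ultimately obtain r where r: "inj_on r (c0 ` verts G)" "r ` c0 ` verts G \<subseteq> {1..m}"
    using inj_on_iff_card_le[of "c0 ` verts G" "{1..m}"] by auto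
  interpret kneser_group m \<Gamma> by unfold_locales (simp add: \<Gamma>_def)
  interpret locally_colored m \<Gamma> G "r \<circ> c0"
  proof unfold_locales
    have nb: "nbrs G v \<subseteq> verts G" for v
      unfolding nbrs_def using curve_ends by (auto simp: doubleton_eq_iff)
    show "local_3_coloring G (r \<circ> c0)"
      unfolding local_3_coloring_def
    proof (intro conjI ballI)
      fix v assume v: "v \<in> verts G"
      show "(r \<circ> c0) v \<noteq> (r \<circ> c0) w" if "w \<in> nbrs G v" for w
        using c0(1) inj_onD[OF r(1), of "c0 v" "c0 w"] v that nb unfolding local_3_coloring_def by auto
      have "finite (nbrs G v)" using nb finite_subset fin_verts by metis
      then have "card (r ` c0 ` nbrs G v) \<le> card (c0 ` nbrs G v)" by (intro card_image_le) auto
      also have "\<dots> \<le> 2" using c0(1) v unfolding local_3_coloring_def by blast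
      finally show "card ((r \<circ> c0) ` nbrs G v) \<le> 2" by (simp add: image_comp)
    qed
  qed (use fin_verts curve_ends r(2) in \<open>auto simp: \<Gamma>_def image_comp\<close>)
  \<comment> \<open>The operations are those of \<Gamma>, so a relation found in this subgroup is
    one to which the hypothesis on squares applies.\<close>
  let ?K = "\<Gamma>\<lparr>carrier := flip\<rparr>"
  interpret K: group ?K using subgroup.subgroup_is_group[OF flip_subgroup is_group] .
  have flip_carrier: "flip \<subseteq> carrier \<Gamma>" by (auto simp: flip_def)
  interpret labelled_crosscap_surface S G W \<Phi> ?K step_label sign g q p
  proof unfold_locales
    fix e b assume e: "e \<in> edges G"
    show "step_label (e, b) \<in> carrier ?K" "sign (step_label (e, b)) = - 1"
      using label_flip[OF step_nbrs[of "(e, b)"]] e by (auto simp: step_label_def)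
    have "step_label (e, False) = inv\<^bsub>\<Gamma>\<^esub> (step_label (e, True))"
      using label_inv[OF step_nbrs[of "(e, True)"]] e by (simp add: step_label_def step_path_def)
    then show "step_label (e, False) = inv\<^bsub>?K\<^esub> (step_label (e, True))"
      using m_inv_consistent[OF flip_subgroup] label_flip(1)[OF step_nbrs[of "(e, True)"]] e
      by (simp add: step_label_def)
  next
    fix f assume f: "f \<in> faces S G"
    have W4: "W f = [W f ! 0, W f ! 1, W f ! 2, W f ! 3]"
      using W_len[OF f] by (intro nth_equalityI) (auto simp: less_Suc_eq numeral_eq_Suc)
    let ?v = "\<lambda>k. step_path G (W f ! k) 0"
    have lb: "step_label (W f ! 0) = label (?v 0) (?v 1)" "step_label (W f ! 1) = label (?v 1) (?v 2)"
      "step_label (W f ! 2) = label (?v 2) (?v 3)" "step_label (W f ! 3) = label (?v 3) (?v 0)"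
      using consecutive(1)[OF f, of 0] consecutive(1)[OF f, of 1] consecutive(1)[OF f, of 2] consecutive(2)[OF f]
      by (simp_all add: step_label_def numeral_2_eq_2 numeral_3_eq_3)
    have nb: "?v 1 \<in> nbrs G (?v 0)" "?v 2 \<in> nbrs G (?v 1)" "?v 3 \<in> nbrs G (?v 2)" "?v 0 \<in> nbrs G (?v 3)"
      using step_nbrs[OF W_edge[OF f, of 0]] step_nbrs[OF W_edge[OF f, of 1]]
        step_nbrs[OF W_edge[OF f, of 2]] step_nbrs[OF W_edge[OF f, of 3]]
        consecutive(1)[OF f, of 0] consecutive(1)[OF f, of 1] consecutive(1)[OF f, of 2] consecutive(2)[OF f]
      by (simp_all add: numeral_2_eq_2 numeral_3_eq_3)
    have cl: "label (?v 3) (?v 0) \<in> carrier \<Gamma>" using label_flip(1)[OF nb(4)] flip_carrier by blast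
    have "foldr (\<otimes>\<^bsub>\<Gamma>\<^esub>) (map step_label (W f)) \<one>\<^bsub>\<Gamma>\<^esub> = \<one>\<^bsub>\<Gamma>\<^esub>"
      by (subst W4) (use label_product[OF nb] cl in \<open>simp add: lb[unfolded One_nat_def]\<close>)
    then show "foldr (\<otimes>\<^bsub>?K\<^esub>) (map step_label (W f)) \<one>\<^bsub>?K\<^esub> = \<one>\<^bsub>?K\<^esub>" by simp
  next
    show "sign (x \<otimes>\<^bsub>?K\<^esub> y) = sign x * sign y" if "x \<in> carrier ?K" "y \<in> carrier ?K" for x y
      using that sign_mult by simp
    show "sign x * sign x = 1" for x by (simp add: sign_def)
  qed (use assms(2) q \<Phi> in auto)
  obtain zs where zs: "set zs \<subseteq> carrier ?K" "length zs = g"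
    "foldr (\<otimes>\<^bsub>?K\<^esub>) (map (\<lambda>z. z \<otimes>\<^bsub>?K\<^esub> z) zs) \<one>\<^bsub>?K\<^esub> = \<one>\<^bsub>?K\<^esub>" "sign (foldr (\<otimes>\<^bsub>?K\<^esub>) zs \<one>\<^bsub>?K\<^esub>) = - 1"
    using squares_relation odd_turning[OF W(2)] unfolding turning_def by blast
  have zc: "set zs \<subseteq> carrier \<Gamma>" using zs(1) flip_carrier by auto
  have sq: "map (\<lambda>z. z [^]\<^bsub>\<Gamma>\<^esub> (2::nat)) zs = map (\<lambda>z. z \<otimes>\<^bsub>\<Gamma>\<^esub> z) zs"
    using zc by (intro map_cong) (auto simp: numeral_2_eq_2)
  have "foldr (\<otimes>\<^bsub>\<Gamma>\<^esub>) (map (\<lambda>z. z \<otimes>\<^bsub>\<Gamma>\<^esub> z) zs) \<one>\<^bsub>\<Gamma>\<^esub> = \<one>\<^bsub>\<Gamma>\<^esub>"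
    using zs(3) by simp
  then have "foldr (\<otimes>\<^bsub>\<Gamma>\<^esub>) zs \<one>\<^bsub>\<Gamma>\<^esub> = \<one>\<^bsub>\<Gamma>\<^esub>"
    using assms(4)[rule_format, of zs] zc zs(2) by (simp only: sq simp_thms)
  \<comment> \<open>The trivial element has sign \<open>1\<close>, whereas oddness forced the
    product to have sign \<open>-1\<close>.\<close>
  then have "sign \<one>\<^bsub>\<Gamma>\<^esub> = - 1" using zs(4) by simp
  then show False by (simp add: sign_def act_one)
qed

end
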